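(* There exist two positive constants $\beta$ and $K$ such that, for every $n\ge1$ and every $d\ge2$, the expected number $E_{d,n}$ of local minima of a random polynomial of degree at most $d$ in $n$ variables satisfies $$E_{d,n}\le K\, e^{-\beta n^2+\frac{n}{2}\log(d-1)} .$$ (The constants $\beta$ and $K$ do not depend on $n$ or $d$.)
   Context: A random polynomial of degree at most $d$ in $n$ variables is $f(x)=\sum_{|\alpha|\le d} f_\alpha x^\alpha$, $x\in\mathbb{R}^n$, where $\alpha=(\alpha_1,\dots,\alpha_n)\in\mathbb{N}^n$, $|\alpha|=\alpha_1+\dots+\alpha_n$, $x^\alpha=x_1^{\alpha_1}\cdots x_n^{\alpha_n}$, and the coefficients $f_\alpha$ are independent centered real Gaussian random variables, $f_\alpha$ having variance $\binom{d}{\alpha}=\frac{d!}{\alpha_1!\cdots\alpha_n!\,(d-|\alpha|)!}$. With probability one all critical points of $f$ are nondegenerate, so that the local minima are the $x\in\mathbb{R}^n$ with $Df(x)=0$ and $D^2f(x)$ positive definite. *)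

theory Defs
  imports "HOL-Probability.Probability"
begin

text \<open>
  Points of n-dimensional Euclidean space are the functions \<open>x :: nat \<Rightarrow> real\<close> with \<open>x i = 0\<close> for all
  \<open>i \<ge> n\<close>, as in \<^const>\<open>Euclidean_space\<close>; this allows the dimension to be quantified inside a
  statement. Multi-indices are encoded the same way, with coordinates \<open>0, \<dots>, n - 1\<close>.
\<close>

definition multi_indices :: "nat \<Rightarrow> nat \<Rightarrow> (nat \<Rightarrow> nat) set" where
  "multi_indices n d = {\<alpha>. (\<forall>i\<ge>n. \<alpha> i = 0) \<and> (\<Sum>i<n. \<alpha> i) \<le> d}"

definition multinomial_coeff :: "nat \<Rightarrow> nat \<Rightarrow> (nat \<Rightarrow> nat) \<Rightarrow> real" where
  "multinomial_coeff n d \<alpha> = fact d / ((\<Prod>i<n. fact (\<alpha> i)) * fact (d - (\<Sum>i<n. \<alpha> i)))"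

definition poly_fun :: "nat \<Rightarrow> nat \<Rightarrow> ((nat \<Rightarrow> nat) \<Rightarrow> real) \<Rightarrow> (nat \<Rightarrow> real) \<Rightarrow> real" where
  "poly_fun n d c x = (\<Sum>\<alpha>\<in>multi_indices n d. c \<alpha> * (\<Prod>i<n. x i ^ \<alpha> i))"

definition local_minima :: "nat \<Rightarrow> ((nat \<Rightarrow> real) \<Rightarrow> real) \<Rightarrow> (nat \<Rightarrow> real) set" where
  "local_minima n f =
    {x. \<exists>U. openin (Euclidean_space n) U \<and> x \<in> U \<and> (\<forall>y\<in>U. f x \<le> f y)}"

text \<open>
  The joint law of the coefficients. The second argument of \<^const>\<open>normal_density\<close> is the standard
  deviation, hence the square root.
\<close>

definition coeff_measure :: "nat \<Rightarrow> nat \<Rightarrow> ((nat \<Rightarrow> nat) \<Rightarrow> real) measure" where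
  "coeff_measure n d =
    (\<Pi>\<^sub>M \<alpha>\<in>multi_indices n d.
      density lborel (\<lambda>t. ennreal (normal_density 0 (sqrt (multinomial_coeff n d \<alpha>)) t)))"

text \<open>
  The expectation takes values in \<^typ>\<open>ennreal\<close>, and \<^term>\<open>emeasure (count_space UNIV)\<close> gives an
  infinite set of minima the value \<open>\<infinity>\<close> rather than 0. The number of minima is a Borel
  function of the coefficients: the pairs \<open>(c, x)\<close> such that \<open>x\<close> minimises \<open>poly_fun n d c\<close> on a
  ball of given radius around \<open>x\<close> form a closed set, so the coefficients with at least \<open>k\<close> local
  minima form a sigma-compact set.
\<close>

definition expected_minima :: "nat \<Rightarrow> nat \<Rightarrow> ennreal" where
  "expected_minima d n =
    (\<integral>\<^sup>+c. emeasure (count_space UNIV) (local_minima n (poly_fun n d c)) \<partial>coeff_measure n d)"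

lemma finite_multi_indices: "finite (multi_indices n d)"
proof -
  have le: "\<alpha> i \<le> d" if "\<alpha> \<in> multi_indices n d" for \<alpha> i
  proof (cases "i < n")
    case True
    then have "\<alpha> i \<le> (\<Sum>i<n. \<alpha> i)"
      by (intro member_le_sum) auto
    then show ?thesis
      using that by (auto simp: multi_indices_def)
  next
    case False
    then show ?thesis
      using that by (auto simp: multi_indices_def)
  qed
  have "multi_indices n d \<subseteq> {\<alpha>. \<forall>i. (i \<in> {..<n} \<longrightarrow> \<alpha> i \<in> {..d}) \<and> (i \<notin> {..<n} \<longrightarrow> \<alpha> i = 0)}"
    using le by (auto simp: multi_indices_def)
  then show ?thesis
    by (rule finite_subset) (intro finite_set_of_finite_funs; simp)
qed

lemma multinomial_coeff_pos: "multinomial_coeff n d \<alpha> > 0"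
  by (auto simp: multinomial_coeff_def intro!: divide_pos_pos mult_pos_pos prod_pos)

lemma prob_space_coeff_measure: "prob_space (coeff_measure n d)"
  unfolding coeff_measure_def by (intro prob_space_PiM prob_space_normal_density) (simp add: multinomial_coeff_pos)

lemma distributed_coeff:
  assumes "\<alpha> \<in> multi_indices n d"
  shows "distributed (coeff_measure n d) lborel (\<lambda>c. c \<alpha>)
           (normal_density 0 (sqrt (multinomial_coeff n d \<alpha>)))"
proof -
  let ?N = "\<lambda>\<alpha>. density lborel (\<lambda>t. ennreal (normal_density 0 (sqrt (multinomial_coeff n d \<alpha>)) t))"
  have meas: "(\<lambda>c. c \<alpha>) \<in> coeff_measure n d \<rightarrow>\<^sub>M ?N \<alpha>"
    unfolding coeff_measure_def by (rule measurable_component_singleton[OF assms])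
  have "distr (coeff_measure n d) (?N \<alpha>) (\<lambda>c. c \<alpha>) = ?N \<alpha>"
    unfolding coeff_measure_def
    by (intro distr_PiM_component prob_space_normal_density assms) (simp add: multinomial_coeff_pos)
  moreover have "distr (coeff_measure n d) (?N \<alpha>) (\<lambda>c. c \<alpha>) =
      distr (coeff_measure n d) lborel (\<lambda>c. c \<alpha>)"
    by (rule distr_cong) auto
  ultimately show ?thesis
    using meas by (simp add: distributed_def)
qed

lemma indep_coeffs:
  "prob_space.indep_vars (coeff_measure n d) (\<lambda>_. borel) (\<lambda>\<alpha> c. c \<alpha>) (multi_indices n d)"
proof -
  let ?N = "\<lambda>\<alpha>. density lborel (\<lambda>t. ennreal (normal_density 0 (sqrt (multinomial_coeff n d \<alpha>)) t))"
  interpret prob_space "coeff_measure n d"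
    by (rule prob_space_coeff_measure)
  have rv: "random_variable borel (\<lambda>c. c \<alpha>)" if "\<alpha> \<in> multi_indices n d" for \<alpha>
    using distributed_measurable[OF distributed_coeff[OF that]] by simp
  have law: "distr (coeff_measure n d) borel (\<lambda>c. c \<alpha>) = ?N \<alpha>" if "\<alpha> \<in> multi_indices n d" for \<alpha>
  proof -
    have "distr (coeff_measure n d) borel (\<lambda>c. c \<alpha>) = distr (coeff_measure n d) lborel (\<lambda>c. c \<alpha>)"
      by (rule distr_cong) auto
    then show ?thesis
      using distributed_distr_eq_density[OF distributed_coeff[OF that]] by simp
  qed
  have "(\<lambda>_. 0) \<in> multi_indices n d"
    by (simp add: multi_indices_def)
  then have zero: "multi_indices n d \<noteq> {}"
    by blast
  have sets_eq: "sets (coeff_measure n d) = sets (\<Pi>\<^sub>M \<alpha>\<in>multi_indices n d. borel)"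
    unfolding coeff_measure_def by (intro sets_PiM_cong) auto
  have "distr (coeff_measure n d) (\<Pi>\<^sub>M \<alpha>\<in>multi_indices n d. borel) (\<lambda>c. \<lambda>\<alpha>\<in>multi_indices n d. c \<alpha>)
      = distr (coeff_measure n d) (coeff_measure n d) (\<lambda>c. c)"
    using sets_eq
    by (intro distr_cong) (auto simp: coeff_measure_def space_PiM PiE_def extensional_restrict)
  also have "\<dots> = (\<Pi>\<^sub>M \<alpha>\<in>multi_indices n d. distr (coeff_measure n d) borel (\<lambda>c. c \<alpha>))"
    using law by (simp add: distr_id coeff_measure_def cong: PiM_cong)
  finally show ?thesis
    using rv zero by (subst indep_vars_iff_distr_eq_PiM') auto
qed

end

theory Submission
  imports Defs "HOL-Combinatorics.Multiset_Permutations" "HOL-Real_Asymp.Real_Asymp"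
begin

text \<open>
  The number of minima is bounded by a discretised Kac-Rice argument. Homogenise \<open>f\<close> to a form \<open>F\<close>
  of degree \<open>d\<close> in \<open>n + 1\<close> variables; summing independent standard Gaussian coefficients over all
  words of length \<open>d\<close> in the variables gives the law of \<open>F\<close> and shows that it is invariant under
  rotations. For a cell of a fine grid with centre \<open>x\<close>, rotating \<open>(1, x)\<close> to the axis of the
  homogenising variable turns a local minimum in the cell into conditions on the 2-jet at 0 of a
  polynomial with the same law: the \<open>n\<close> gradient coordinates lie in short intervals, and the Hessian
  on a space of dimension \<open>n - 1\<close>, which is a matrix of the Gaussian orthogonal ensemble, is almost
  positive semidefinite. The interval lengths contribute
  \<open>(d - 1) powr (n / 2) * (1 + |x|\<^sup>2) powr (- (n + 1) / 2)\<close> times the volume of the cell, which is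
  summable, and positive semidefiniteness has probability \<open>exp (- m\<^sup>2 / 12 + o(m\<^sup>2))\<close> with
  \<open>m = n - 1\<close>. All other factors are at most exponential in \<open>n * ln n\<close>.
\<close>

section \<open>Orthogonal invariance of the standard Gaussian measure\<close>

text \<open>The Kac-Rice formula would need a change of variables in the count of critical points.
  Only an upper bound is wanted, so a cell is charged whenever one measurable event on the jet at
  its centre holds. The obstacle is that moving from the minimum to the centre costs terms that grow
  with the random coefficients. Terms of degree three and more are removed by truncating the
  coefficients and then refining the grid; the truncation level leaves no trace in the bound.
  Second-order terms enter the gradient at the order of the cell size, so its intervals have random
  widths proportional to \<open>1 + hess_sum\<close>. These widths depend on the Hessian, and
  Cauchy-Schwarz separates them from positive semidefiniteness at the price of halving the exponent
  from 1/12 to 1/24, still above the final value 1/100 of the constant beta. The Hessian loses one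
  row because the polynomial in the rotated chart carries a factor depending on \<open>z 0\<close>:
  along directions with \<open>w 0 = 0\<close> this factor is constant and minimality passes to the
  polynomial, while in the remaining direction only the first-order condition is kept.\<close>

abbreviation lborel_on :: "'a set \<Rightarrow> ('a \<Rightarrow> real) measure" where
  "lborel_on I \<equiv> PiM I (\<lambda>_. lborel)"

interpretation lborel_prod: product_sigma_finite "\<lambda>_. lborel :: real measure"
  by standard

lemma distr_PiM_lborel_translate:
  fixes t :: "'a \<Rightarrow> real"
  assumes I: "finite I"
  shows "distr (lborel_on I) (lborel_on I) (\<lambda>x. \<lambda>i\<in>I. t i + x i) = lborel_on I"
proof (rule lborel_prod.PiM_eqI[OF I])
  fix A :: "'a \<Rightarrow> real set" assume A: "\<And>i. i \<in> I \<Longrightarrow> A i \<in> sets lborel"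
  have pre: "(\<lambda>x. \<lambda>i\<in>I. t i + x i) -` (Pi\<^sub>E I A) \<inter> space (lborel_on I)
      = (\<Pi>\<^sub>E i\<in>I. (\<lambda>x. t i + x) -` A i)"
    by (auto simp: space_PiM PiE_iff)
  have "emeasure (distr (lborel_on I) (lborel_on I) (\<lambda>x. \<lambda>i\<in>I. t i + x i)) (Pi\<^sub>E I A)
      = emeasure (lborel_on I) (\<Pi>\<^sub>E i\<in>I. (\<lambda>x. t i + x) -` A i)"
  proof (subst emeasure_distr)
    show "(\<lambda>x. \<lambda>i\<in>I. t i + x i) \<in> lborel_on I \<rightarrow>\<^sub>M lborel_on I"
      by (rule measurable_restrict) measurable
    show "Pi\<^sub>E I A \<in> sets (lborel_on I)"
      using A I by (intro sets_PiM_I_finite) auto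
  qed (simp only: pre)
  also have "\<dots> = (\<Prod>i\<in>I. emeasure lborel ((\<lambda>x. t i + x) -` A i))"
  proof (intro lborel_prod.emeasure_PiM I)
    fix i assume "i \<in> I"
    have "(\<lambda>x. t i + x) \<in> borel \<rightarrow>\<^sub>M borel" by simp
    from measurable_sets[OF this, of "A i"] show "(\<lambda>x. t i + x) -` A i \<in> sets lborel"
      using A[OF \<open>i \<in> I\<close>] by simp
  qed
  also have "\<dots> = (\<Prod>i\<in>I. emeasure lborel (A i))"
  proof (rule prod.cong[OF refl])
    fix i assume "i \<in> I"
    have "emeasure lborel (A i) = emeasure (distr lborel borel ((+) (t i))) (A i)"
      by (simp add: lborel_distr_plus)
    also have "\<dots> = emeasure lborel ((\<lambda>x. t i + x) -` A i)"
      using A[OF \<open>i \<in> I\<close>] by (subst emeasure_distr) auto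
    finally show "emeasure lborel ((\<lambda>x. t i + x) -` A i) = emeasure lborel (A i)" ..
  qed
  finally show "emeasure (distr (lborel_on I) (lborel_on I) (\<lambda>x. \<lambda>i\<in>I. t i + x i)) (Pi\<^sub>E I A)
      = (\<Prod>i\<in>I. emeasure lborel (A i))" .
qed simp

lemma nn_integral_PiM_lborel_translate:
  fixes t :: "'a \<Rightarrow> real"
  assumes I: "finite I" and f: "f \<in> borel_measurable (lborel_on I)"
  shows "(\<integral>\<^sup>+x. f (\<lambda>i\<in>I. t i + x i) \<partial>lborel_on I) = (\<integral>\<^sup>+x. f x \<partial>lborel_on I)"
  using f by (subst (2) distr_PiM_lborel_translate[OF I, of t, symmetric], subst nn_integral_distr) auto

text \<open>No determinant is computed. Trading one coordinate \<open>k\<close> with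
  \<open>u k \<noteq> 0\<close> for the inner product \<open>b\<close> with \<open>u\<close>, a
  reflection becomes, for fixed \<open>b\<close>, a translation of the remaining coordinates
  together with the sign change of \<open>b\<close>; Fubini and translation invariance do the
  rest.\<close>

lemma nn_integral_PiM_lborel_reflection:
  fixes u :: "'a \<Rightarrow> real"
  assumes I: "finite I" and unit: "(\<Sum>j\<in>I. (u j)\<^sup>2) = 1"
    and f [measurable]: "f \<in> borel_measurable (lborel_on I)"
  shows "(\<integral>\<^sup>+g. f (\<lambda>i\<in>I. g i - 2 * (\<Sum>j\<in>I. u j * g j) * u i) \<partial>lborel_on I)
    = (\<integral>\<^sup>+g. f g \<partial>lborel_on I)"
proof -
  obtain k where k: "k \<in> I" "u k \<noteq> 0"
  proof -
    have "\<exists>k\<in>I. u k \<noteq> 0"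
    proof (rule ccontr)
      assume "\<not> (\<exists>k\<in>I. u k \<noteq> 0)"
      then have "(\<Sum>j\<in>I. (u j)\<^sup>2) = 0" by (intro sum.neutral) auto
      then show False using unit by simp
    qed
    then show ?thesis using that by blast
  qed
  define J where "J = I - {k}"
  have IJ: "I = insert k J" and kJ: "k \<notin> J" and J: "finite J"
    using k I by (auto simp: J_def)
  have fm [measurable]: "f \<in> borel_measurable (lborel_on (insert k J))"
    using f by (simp add: IJ)
  define S where "S h = (\<Sum>j\<in>J. u j * h j)" for h :: "'a \<Rightarrow> real"
  have S_meas [measurable]: "S \<in> borel_measurable (lborel_on J)"
    unfolding S_def by measurable
  have uJ: "(\<Sum>j\<in>J. (u j)\<^sup>2) = 1 - (u k)\<^sup>2"
    using unit IJ kJ J by simp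
  \<comment> \<open>\<open>G h b\<close> is the reflection of the vector with \<open>J\<close>-part
    \<open>h\<close> and inner product \<open>b\<close> with \<open>u\<close>; \<open>G' h b\<close>
    is the vector with \<open>J\<close>-part \<open>h\<close> and inner product \<open>- b\<close>.
    They agree after translating \<open>h\<close> by \<open>- 2 * b * u\<close>.\<close>
  define G where "G h b = (\<lambda>i\<in>insert k J. if i = k then (b - S h) / u k - 2 * b * u k else h i - 2 * b * u i)"
    for h b
  define G' where "G' h b = h(k := (- b - S h) / u k)" for h b
  have G'_eq: "G' h b = (\<lambda>i\<in>insert k J. if i = k then (- b - S h) / u k else h i)"
    if "h \<in> space (lborel_on J)" for h b
    using that by (auto simp: G'_def space_PiM fun_eq_iff PiE_def extensional_def)
  have proj [measurable]: "(\<lambda>x. fst x i) \<in> borel_measurable (lborel_on J \<Otimes>\<^sub>M lborel)"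
    if "i \<in> J" for i
    using that by measurable
  have G_comp: "(\<lambda>x. if i = k then (snd x - S (fst x)) / u k - 2 * snd x * u k else fst x i - 2 * snd x * u i)
      \<in> lborel_on J \<Otimes>\<^sub>M lborel \<rightarrow>\<^sub>M lborel"
    and G'_comp: "(\<lambda>x. if i = k then (- snd x - S (fst x)) / u k else fst x i)
      \<in> lborel_on J \<Otimes>\<^sub>M lborel \<rightarrow>\<^sub>M lborel" if "i \<in> insert k J" for i
    using that by (cases "i = k"; simp)+
  have G_meas: "(\<lambda>(h, b). G h b) \<in> lborel_on J \<Otimes>\<^sub>M lborel \<rightarrow>\<^sub>M lborel_on (insert k J)"
    unfolding G_def split_beta by (rule measurable_restrict) (rule G_comp, assumption)
  have G'_meas0: "(\<lambda>(h, b). (\<lambda>i\<in>insert k J. if i = k then (- b - S h) / u k else h i))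
      \<in> lborel_on J \<Otimes>\<^sub>M lborel \<rightarrow>\<^sub>M lborel_on (insert k J)"
    unfolding split_beta by (rule measurable_restrict) (rule G'_comp, assumption)
  have G'_meas: "(\<lambda>(h, b). G' h b) \<in> lborel_on J \<Otimes>\<^sub>M lborel \<rightarrow>\<^sub>M lborel_on (insert k J)"
    using G'_meas0 by (rule measurable_cong[THEN iffD1, rotated]) (auto simp: space_pair_measure G'_eq)
  have fG [measurable]: "(\<lambda>(h, b). f (G h b)) \<in> borel_measurable (lborel_on J \<Otimes>\<^sub>M lborel)"
    using measurable_compose[OF G_meas fm] by (simp add: split_beta)
  have fG' [measurable]: "(\<lambda>(h, b). f (G' h b)) \<in> borel_measurable (lborel_on J \<Otimes>\<^sub>M lborel)"
    using measurable_compose[OF G'_meas fm] by (simp add: split_beta)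
  interpret PJ: sigma_finite_measure "lborel_on J"
    by (rule lborel_prod.sigma_finite[OF J])
  interpret pr: pair_sigma_finite "lborel_on J" "lborel :: real measure" ..
  let ?refl = "\<lambda>g. \<lambda>i\<in>I. g i - 2 * (\<Sum>j\<in>I. u j * g j) * u i"
  have refl_meas: "?refl \<in> lborel_on I \<rightarrow>\<^sub>M lborel_on I"
    by (rule measurable_restrict) measurable
  have refl_eq: "?refl (h(k := a)) = G h (S h + u k * a)" if "h \<in> space (lborel_on J)" for h a
  proof -
    have "(\<Sum>j\<in>I. u j * (h(k := a)) j) = S h + u k * a"
      using kJ J by (simp add: IJ S_def) (auto intro!: sum.cong)
    then show ?thesis
      using kJ k by (auto simp: G_def IJ fun_eq_iff algebra_simps)
  qed
  have "(\<integral>\<^sup>+g. f (?refl g) \<partial>lborel_on I)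
      = (\<integral>\<^sup>+h. \<integral>\<^sup>+a. f (?refl (h(k := a))) \<partial>lborel \<partial>lborel_on J)"
    using measurable_compose[OF refl_meas f] unfolding IJ
    by (intro lborel_prod.product_nn_integral_insert[OF J kJ]) simp
  also have "\<dots> = (\<integral>\<^sup>+h. \<integral>\<^sup>+a. f (G h (S h + u k * a)) \<partial>lborel \<partial>lborel_on J)"
    by (intro nn_integral_cong) (simp only: refl_eq)
  \<comment> \<open>The Jacobian \<open>\<bar>u k\<bar>\<close> of
    \<open>a \<mapsto> S h + u k * a\<close> is multiplied in here and cancelled at the end, which
    avoids a division in \<open>ennreal\<close>.\<close>
  finally have "ennreal \<bar>u k\<bar> * (\<integral>\<^sup>+g. f (?refl g) \<partial>lborel_on I)
      = ennreal \<bar>u k\<bar> * (\<integral>\<^sup>+h. \<integral>\<^sup>+a. f (G h (S h + u k * a)) \<partial>lborel \<partial>lborel_on J)"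
    by simp
  also have "\<dots> = (\<integral>\<^sup>+h. ennreal \<bar>u k\<bar> * (\<integral>\<^sup>+a. f (G h (S h + u k * a)) \<partial>lborel) \<partial>lborel_on J)"
    by (subst nn_integral_cmult) auto
  also have "\<dots> = (\<integral>\<^sup>+h. \<integral>\<^sup>+b. f (G h b) \<partial>lborel \<partial>lborel_on J)"
    using k by (intro nn_integral_cong nn_integral_real_affine[symmetric]) auto
  also have "\<dots> = (\<integral>\<^sup>+b. \<integral>\<^sup>+h. f (G h b) \<partial>lborel_on J \<partial>lborel)"
    by (rule pr.Fubini'[symmetric]) (rule fG)
  also have "\<dots> = (\<integral>\<^sup>+b. \<integral>\<^sup>+h. f (G' h b) \<partial>lborel_on J \<partial>lborel)"
  proof (rule nn_integral_cong)
    fix b :: real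
    have "G h b = G' (\<lambda>i\<in>J. - (2 * b * u i) + h i) b" if "h \<in> space (lborel_on J)" for h
    proof -
      have "S (\<lambda>i\<in>J. - (2 * b * u i) + h i) = (\<Sum>i\<in>J. u i * h i - 2 * b * (u i)\<^sup>2)"
        unfolding S_def by (intro sum.cong) (auto simp: algebra_simps power2_eq_square)
      also have "\<dots> = S h - 2 * b * (1 - (u k)\<^sup>2)"
        unfolding S_def uJ[symmetric] by (simp add: sum_subtractf sum_distrib_left)
      finally have "S (\<lambda>i\<in>J. - (2 * b * u i) + h i) = S h - 2 * b * (1 - (u k)\<^sup>2)" .
      then show ?thesis
        using that k kJ by (auto simp: G_def G'_def fun_eq_iff space_PiM PiE_def extensional_def
            field_simps power2_eq_square)
    qed
    then have "(\<integral>\<^sup>+h. f (G h b) \<partial>lborel_on J)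
        = (\<integral>\<^sup>+h. f (G' (\<lambda>i\<in>J. - (2 * b * u i) + h i) b) \<partial>lborel_on J)"
      by (intro nn_integral_cong) auto
    also have "\<dots> = (\<integral>\<^sup>+h. f (G' h b) \<partial>lborel_on J)"
      by (rule nn_integral_PiM_lborel_translate[OF J, where f="\<lambda>h. f (G' h b)"]) measurable
    finally show "(\<integral>\<^sup>+h. f (G h b) \<partial>lborel_on J) = (\<integral>\<^sup>+h. f (G' h b) \<partial>lborel_on J)" .
  qed
  also have "\<dots> = (\<integral>\<^sup>+h. \<integral>\<^sup>+b. f (G' h b) \<partial>lborel \<partial>lborel_on J)"
    by (rule pr.Fubini') (rule fG')
  also have "\<dots> = (\<integral>\<^sup>+h. ennreal \<bar>u k\<bar> * (\<integral>\<^sup>+a. f (h(k := a)) \<partial>lborel) \<partial>lborel_on J)"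
  proof (rule nn_integral_cong)
    fix h assume h: "h \<in> space (lborel_on J)"
    have "(\<lambda>b. f (G' h b)) \<in> borel_measurable borel"
      using measurable_compose[OF measurable_Pair1'[OF h] fG'] by simp
    then have "(\<integral>\<^sup>+b. f (G' h b) \<partial>lborel) = ennreal \<bar>- u k\<bar> * (\<integral>\<^sup>+a. f (G' h (- S h + (- u k) * a)) \<partial>lborel)"
      using k by (intro nn_integral_real_affine) auto
    also have "(\<lambda>a. f (G' h (- S h + (- u k) * a))) = (\<lambda>a. f (h(k := a)))"
      using k by (simp add: G'_def field_simps)
    finally show "(\<integral>\<^sup>+b. f (G' h b) \<partial>lborel) = ennreal \<bar>u k\<bar> * (\<integral>\<^sup>+a. f (h(k := a)) \<partial>lborel)"
      by simp
  qed
  also have "\<dots> = ennreal \<bar>u k\<bar> * (\<integral>\<^sup>+h. \<integral>\<^sup>+a. f (h(k := a)) \<partial>lborel \<partial>lborel_on J)"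
  proof (subst nn_integral_cmult)
    have "(\<lambda>x. f ((fst x)(k := snd x))) \<in> borel_measurable (lborel_on J \<Otimes>\<^sub>M lborel)"
      using measurable_compose[OF measurable_add_dim[of k J "\<lambda>_. lborel"] fm] by (simp add: split_beta)
    then show "(\<lambda>h. \<integral>\<^sup>+a. f (h(k := a)) \<partial>lborel) \<in> borel_measurable (lborel_on J)"
      by (intro lborel.borel_measurable_nn_integral) (simp add: split_beta)
  qed simp
  also have "(\<integral>\<^sup>+h. \<integral>\<^sup>+a. f (h(k := a)) \<partial>lborel \<partial>lborel_on J) = (\<integral>\<^sup>+g. f g \<partial>lborel_on I)"
    unfolding IJ by (rule lborel_prod.product_nn_integral_insert[OF J kJ fm, symmetric])
  finally show ?thesis
    using k by (subst (asm) ennreal_mult_cancel_left) auto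
qed

section \<open>Standard Gaussian vectors under orthonormal changes of coordinates\<close>

abbreviation std_normal :: "real measure" where
  "std_normal \<equiv> density lborel (\<lambda>t. ennreal (std_normal_density t))"

abbreviation std_gauss :: "'a set \<Rightarrow> ('a \<Rightarrow> real) measure" where
  "std_gauss I \<equiv> PiM I (\<lambda>_. std_normal)"

lemma prob_space_std_normal: "prob_space std_normal"
  by (rule prob_space_normal_density) simp

interpretation std_normal_prod: product_sigma_finite "\<lambda>_. std_normal"
  by (simp add: product_sigma_finite_def prob_space_std_normal prob_space_imp_sigma_finite)

lemma PiM_std_normal_eq_density:
  assumes I: "finite I"
  shows "std_gauss I
    = density (lborel_on I) (\<lambda>x. ennreal (\<Prod>i\<in>I. std_normal_density (x i)))"
proof (rule std_normal_prod.PiM_eqI[OF I, symmetric])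
  show "sets (density (lborel_on I) (\<lambda>x. ennreal (\<Prod>i\<in>I. std_normal_density (x i))))
      = sets (std_gauss I)"
    by (simp cong: sets_PiM_cong)
next
  fix A :: "'a \<Rightarrow> real set" assume A: "\<And>i. i \<in> I \<Longrightarrow> A i \<in> sets std_normal"
  have "emeasure (density (lborel_on I) (\<lambda>x. ennreal (\<Prod>i\<in>I. std_normal_density (x i)))) (Pi\<^sub>E I A)
      = (\<integral>\<^sup>+x. ennreal (\<Prod>i\<in>I. std_normal_density (x i)) * indicator (Pi\<^sub>E I A) x \<partial>lborel_on I)"
    using I A by (subst emeasure_density) (auto intro!: sets_PiM_I_finite)
  also have "\<dots> = (\<integral>\<^sup>+x. (\<Prod>i\<in>I. ennreal (std_normal_density (x i)) * indicator (A i) (x i)) \<partial>lborel_on I)"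
  proof (rule nn_integral_cong)
    fix x assume x: "x \<in> space (lborel_on I)"
    have "indicator (Pi\<^sub>E I A) x = (\<Prod>i\<in>I. indicator (A i) (x i) :: ennreal)"
    proof (cases "\<forall>i\<in>I. x i \<in> A i")
      case True
      then show ?thesis using x by (auto simp: space_PiM PiE_iff)
    next
      case False
      then obtain i where "i \<in> I" "x i \<notin> A i" by auto
      then show ?thesis
        using I by (auto simp: PiE_iff indicator_def intro!: prod_zero[symmetric])
    qed
    then show "ennreal (\<Prod>i\<in>I. std_normal_density (x i)) * indicator (Pi\<^sub>E I A) x
        = (\<Prod>i\<in>I. ennreal (std_normal_density (x i)) * indicator (A i) (x i))"
      by (simp add: prod.distrib prod_ennreal)
  qed
  also have "\<dots> = (\<Prod>i\<in>I. \<integral>\<^sup>+x. ennreal (std_normal_density x) * indicator (A i) x \<partial>lborel)"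
    using I A by (intro lborel_prod.product_nn_integral_prod) auto
  also have "\<dots> = (\<Prod>i\<in>I. emeasure std_normal (A i))"
    using A by (intro prod.cong) (auto simp: emeasure_density)
  finally show "emeasure (density (lborel_on I) (\<lambda>x. ennreal (\<Prod>i\<in>I. std_normal_density (x i)))) (Pi\<^sub>E I A)
      = (\<Prod>i\<in>I. emeasure std_normal (A i))" .
qed

lemma prod_std_normal_density:
  "finite I \<Longrightarrow> (\<Prod>i\<in>I. std_normal_density (x i)) = (1 / sqrt (2 * pi)) ^ card I * exp (- (\<Sum>i\<in>I. (x i)\<^sup>2) / 2)"
  unfolding std_normal_density_def prod.distrib by (simp add: exp_sum[symmetric] sum_negf sum_divide_distrib)

lemma sum_power2_reflection:
  fixes u g :: "'a \<Rightarrow> real"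
  assumes "finite I" "(\<Sum>j\<in>I. (u j)\<^sup>2) = 1"
  shows "(\<Sum>i\<in>I. (g i - 2 * (\<Sum>j\<in>I. u j * g j) * u i)\<^sup>2) = (\<Sum>i\<in>I. (g i)\<^sup>2)"
proof -
  define c where "c = (\<Sum>j\<in>I. u j * g j)"
  have "(\<Sum>i\<in>I. (g i - 2 * c * u i)\<^sup>2) = (\<Sum>i\<in>I. (g i)\<^sup>2 - 4 * c * (u i * g i) + 4 * c\<^sup>2 * (u i)\<^sup>2)"
    by (intro sum.cong) (auto simp: power2_eq_square algebra_simps)
  also have "\<dots> = (\<Sum>i\<in>I. (g i)\<^sup>2) - 4 * c * c + 4 * c\<^sup>2 * 1"
    unfolding assms(2)[symmetric] c_def by (simp add: sum.distrib sum_subtractf sum_distrib_left)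
  finally show ?thesis by (simp add: c_def power2_eq_square)
qed

lemma nn_integral_std_normal_reflection:
  fixes u :: "'a \<Rightarrow> real"
  assumes I: "finite I" and unit: "(\<Sum>j\<in>I. (u j)\<^sup>2) = 1"
    and f: "f \<in> borel_measurable (std_gauss I)"
  shows "(\<integral>\<^sup>+g. f (\<lambda>i\<in>I. g i - 2 * (\<Sum>j\<in>I. u j * g j) * u i) \<partial>std_gauss I)
    = (\<integral>\<^sup>+g. f g \<partial>std_gauss I)"
proof -
  have f' [measurable]: "f \<in> borel_measurable (lborel_on I)"
    using f by (subst (asm) PiM_std_normal_eq_density[OF I]) simp
  let ?refl = "\<lambda>g. \<lambda>i\<in>I. g i - 2 * (\<Sum>j\<in>I. u j * g j) * u i"
  let ?p = "\<lambda>x. ennreal (\<Prod>i\<in>I. std_normal_density (x i))"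
  have refl_meas [measurable]: "?refl \<in> lborel_on I \<rightarrow>\<^sub>M lborel_on I"
    by (rule measurable_restrict) measurable
  have p_refl: "?p (?refl g) = ?p g" for g
    using sum_power2_reflection[OF I unit, of g] by (simp add: prod_std_normal_density[OF I])
  have "(\<integral>\<^sup>+g. f (?refl g) \<partial>std_gauss I)
      = (\<integral>\<^sup>+g. ?p (?refl g) * f (?refl g) \<partial>lborel_on I)"
    unfolding p_refl PiM_std_normal_eq_density[OF I]
    by (subst nn_integral_density) (auto intro!: measurable_compose[OF refl_meas])
  also have "\<dots> = (\<integral>\<^sup>+g. ?p g * f g \<partial>lborel_on I)"
    by (rule nn_integral_PiM_lborel_reflection[OF I unit]) measurable
  also have "\<dots> = (\<integral>\<^sup>+g. f g \<partial>std_gauss I)"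
    unfolding PiM_std_normal_eq_density[OF I] by (subst nn_integral_density) auto
  finally show ?thesis .
qed


text \<open>Induction on the number of rows that differ from the standard basis: the reflection exchanging
  \<open>v k\<close> and the \<open>k\<close>-th basis vector fixes all basis vectors orthogonal to both.\<close>

lemma nn_integral_std_normal_orthonormal:
  fixes v :: "'a \<Rightarrow> 'a \<Rightarrow> real"
  assumes I: "finite I"
    and orth: "\<And>i j. i \<in> I \<Longrightarrow> j \<in> I \<Longrightarrow> (\<Sum>l\<in>I. v i l * v j l) = (if i = j then 1 else 0)"
    and f: "f \<in> borel_measurable (std_gauss I)"
  shows "(\<integral>\<^sup>+g. f (\<lambda>i\<in>I. \<Sum>l\<in>I. v i l * g l) \<partial>std_gauss I)
    = (\<integral>\<^sup>+g. f g \<partial>std_gauss I)"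
proof -
  define e :: "'a \<Rightarrow> 'a \<Rightarrow> real" where "e k l = (if k = l then 1 else 0)" for k l
  have e_sum: "(\<Sum>l\<in>I. e k l * g l) = g k" "(\<Sum>l\<in>I. g l * e k l) = g k" if "k \<in> I" for k g
    using that I by (simp_all add: e_def if_distrib[where f="\<lambda>x. x * _"] if_distrib[where f="\<lambda>x. _ * x"] cong: if_cong)
  have "(\<integral>\<^sup>+g. f (\<lambda>i\<in>I. \<Sum>l\<in>I. v i l * g l) \<partial>std_gauss I)
      = (\<integral>\<^sup>+g. f g \<partial>std_gauss I)"
    if "finite J" "J \<subseteq> I" "\<And>i j. i \<in> I \<Longrightarrow> j \<in> I \<Longrightarrow> (\<Sum>l\<in>I. v i l * v j l) = e i j"
      "\<And>i l. i \<in> I - J \<Longrightarrow> l \<in> I \<Longrightarrow> v i l = e i l" for J v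
    using that
  proof (induction J arbitrary: v)
    case empty
    show ?case
    proof (rule nn_integral_cong)
      fix g assume g: "g \<in> space (std_gauss I)"
      have "(\<Sum>l\<in>I. v i l * g l) = g i" if "i \<in> I" for i
        using empty.prems(3)[of i] that by (simp add: e_sum[OF that, symmetric])
      then have "(\<lambda>i\<in>I. \<Sum>l\<in>I. v i l * g l) = g"
        using g by (auto simp: fun_eq_iff space_PiM PiE_def extensional_def)
      then show "f (\<lambda>i\<in>I. \<Sum>l\<in>I. v i l * g l) = f g" by simp
    qed
  next
    case (insert k J)
    have k: "k \<in> I" using insert.prems by auto
    define q where "q = (\<Sum>l\<in>I. (v k l - e k l)\<^sup>2)"
    show ?case
    proof (cases "q = 0")
      case True
      then have "v k l = e k l" if "l \<in> I" for l
        using that I by (simp add: q_def sum_nonneg_eq_0_iff)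
      then have "v i l = e i l" if "i \<in> I - J" "l \<in> I" for i l
        using that insert.prems(3)[of i l] by (cases "i = k") auto
      then show ?thesis
        using insert.prems(1,2) by (intro insert.IH) auto
    next
      case False
      then have q: "q > 0" unfolding q_def by (simp add: less_le sum_nonneg)
      define u where "u l = (v k l - e k l) / sqrt q" for l
      have unit: "(\<Sum>l\<in>I. (u l)\<^sup>2) = 1"
        using q by (simp add: u_def power_divide flip: sum_divide_distrib q_def)
      define v' where "v' i l = v i l - 2 * (\<Sum>m\<in>I. u m * v i m) * u l" for i l
      have q_eq: "q = 2 - 2 * v k k"
      proof -
        have "q = (\<Sum>l\<in>I. v k l * v k l - 2 * (e k l * v k l) + e k l * e k l)"
          unfolding q_def by (intro sum.cong) (auto simp: power2_eq_square algebra_simps)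
        also have "\<dots> = 1 - 2 * v k k + 1"
          using insert.prems(2)[OF k k] k
          by (simp add: sum.distrib sum_subtractf e_sum flip: sum_distrib_left) (simp add: e_def)
        finally show ?thesis by simp
      qed
      have uv: "(\<Sum>m\<in>I. u m * v i m) = (e k i - v i k) / sqrt q" if "i \<in> I" for i
      proof -
        have "(\<Sum>m\<in>I. u m * v i m) = ((\<Sum>m\<in>I. v k m * v i m) - (\<Sum>m\<in>I. e k m * v i m)) / sqrt q"
          unfolding u_def by (simp add: sum_subtractf[symmetric] sum_divide_distrib algebra_simps)
        then show ?thesis
          using insert.prems(2)[OF k that] k by (simp add: e_sum)
      qed
      have orth': "(\<Sum>l\<in>I. v' i l * v' j l) = e i j" if ij: "i \<in> I" "j \<in> I" for i j
      proof -
        define a b where "a = (\<Sum>m\<in>I. u m * v i m)" and "b = (\<Sum>m\<in>I. u m * v j m)"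
        have "(\<Sum>l\<in>I. v' i l * v' j l)
            = (\<Sum>l\<in>I. v i l * v j l - 2 * b * (u l * v i l) - 2 * a * (u l * v j l) + 4 * a * b * (u l)\<^sup>2)"
          unfolding v'_def a_def[symmetric] b_def[symmetric]
          by (intro sum.cong) (auto simp: power2_eq_square algebra_simps)
        also have "\<dots> = (\<Sum>l\<in>I. v i l * v j l) - 2 * b * a - 2 * a * b + 4 * a * b * 1"
          unfolding unit[symmetric] a_def b_def by (simp add: sum.distrib sum_subtractf sum_distrib_left)
        finally show ?thesis
          using insert.prems(2)[OF ij] by simp
      qed
      have v'_J: "v' i l = e i l" if il: "i \<in> I - J" "l \<in> I" for i l
      proof (cases "i = k")
        case True
        have "v' i l = v k l - 2 * ((1 - v k k) / q) * (v k l - e k l)"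
          using uv[OF k] q True by (simp add: v'_def u_def e_def)
        also have "2 * ((1 - v k k) / q) = 1"
          using q q_eq by (simp add: field_simps)
        finally show ?thesis using True by simp
      next
        case False
        then have i: "i \<in> I" "i \<in> I - insert k J" using il by auto
        have "v i k = 0" using insert.prems(3)[OF i(2) k] False by (simp add: e_def)
        then show ?thesis
          using insert.prems(3)[OF i(2) il(2)] uv[OF i(1)] False by (simp add: v'_def e_def)
      qed
      let ?refl = "\<lambda>g. \<lambda>i\<in>I. g i - 2 * (\<Sum>j\<in>I. u j * g j) * u i"
      \<comment> \<open>A reflection is symmetric, so applying it to the argument \<open>g\<close>
        amounts to applying it to every row of \<open>v\<close>.\<close>
      have adjoint: "(\<Sum>l\<in>I. v i l * ?refl g l) = (\<Sum>l\<in>I. v' i l * g l)" for i g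
      proof -
        define a b where "a = (\<Sum>m\<in>I. u m * v i m)" and "b = (\<Sum>j\<in>I. u j * g j)"
        have "(\<Sum>l\<in>I. v i l * ?refl g l) = (\<Sum>l\<in>I. v i l * g l - 2 * b * (u l * v i l))"
          unfolding b_def[symmetric] by (intro sum.cong) (auto simp: algebra_simps)
        also have "\<dots> = (\<Sum>l\<in>I. v i l * g l) - 2 * b * a"
          by (simp add: a_def sum_subtractf sum_distrib_left)
        also have "\<dots> = (\<Sum>l\<in>I. v i l * g l) - 2 * a * (\<Sum>l\<in>I. u l * g l)"
          by (simp add: b_def)
        also have "\<dots> = (\<Sum>l\<in>I. v i l * g l - 2 * a * (u l * g l))"
          by (simp add: sum_subtractf sum_distrib_left)
        also have "\<dots> = (\<Sum>l\<in>I. v' i l * g l)"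
          unfolding v'_def a_def[symmetric] by (intro sum.cong) (auto simp: algebra_simps)
        finally show ?thesis .
      qed
      have lin: "(\<lambda>g. \<lambda>i\<in>I. \<Sum>l\<in>I. v i l * g l) \<in> std_gauss I \<rightarrow>\<^sub>M std_gauss I"
        by (rule measurable_restrict) simp
      have "(\<integral>\<^sup>+g. f (\<lambda>i\<in>I. \<Sum>l\<in>I. v i l * g l) \<partial>std_gauss I)
          = (\<integral>\<^sup>+g. f (\<lambda>i\<in>I. \<Sum>l\<in>I. v i l * ?refl g l) \<partial>std_gauss I)"
        by (rule nn_integral_std_normal_reflection[OF I unit, symmetric]) (rule measurable_compose[OF lin f])
      also have "\<dots> = (\<integral>\<^sup>+g. f (\<lambda>i\<in>I. \<Sum>l\<in>I. v' i l * g l) \<partial>std_gauss I)"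
        by (simp only: adjoint)
      also have "\<dots> = (\<integral>\<^sup>+g. f g \<partial>std_gauss I)"
        using insert.prems(1) by (intro insert.IH orth' v'_J) auto
      finally show ?thesis .
    qed
  qed
  from this[of I v] show ?thesis
    using I orth by (simp add: e_def)
qed

section \<open>Tensor coefficients and rotations of the variables\<close>

text \<open>Words index the coordinates of a \<open>d\<close>-fold tensor over the
  \<open>n + 1\<close> homogeneous variables. The tensor is not symmetrised: its entries can then be
  independent with equal variances, and a rotation of the variables acts on them by an orthogonal
  matrix.\<close>

definition hom_words :: "nat \<Rightarrow> nat \<Rightarrow> nat list set" where
  "hom_words n d = {w. set w \<subseteq> {..n} \<and> length w = d}"

definition word_poly :: "nat \<Rightarrow> nat \<Rightarrow> (nat list \<Rightarrow> real) \<Rightarrow> (nat \<Rightarrow> real) \<Rightarrow> real" where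
  "word_poly n d T y = (\<Sum>w\<in>hom_words n d. T w * (\<Prod>j<d. y (w ! j)))"

text \<open>The letter 0 stands for the homogenising variable.\<close>

definition word_type :: "nat list \<Rightarrow> nat \<Rightarrow> nat" where
  "word_type w = (\<lambda>i. count_list w (Suc i))"

text \<open>The restriction to \<open>multi_indices\<close> makes the value a point of the product
  space that carries \<open>coeff_measure\<close>.\<close>

definition word_coeff :: "nat \<Rightarrow> nat \<Rightarrow> (nat list \<Rightarrow> real) \<Rightarrow> (nat \<Rightarrow> nat) \<Rightarrow> real" where
  "word_coeff n d T = (\<lambda>\<alpha>\<in>multi_indices n d. \<Sum>w\<in>{w \<in> hom_words n d. word_type w = \<alpha>}. T w)"

lemma finite_hom_words [simp]: "finite (hom_words n d)"
  unfolding hom_words_def by (rule finite_lists_length_eq) simp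

lemma hom_words_nth_le: "w \<in> hom_words n d \<Longrightarrow> j < d \<Longrightarrow> w ! j \<le> n"
  by (auto simp: hom_words_def subset_iff)

lemma hom_words_Suc: "hom_words n (Suc d) = (\<lambda>(w, k). k # w) ` (hom_words n d \<times> {..n})"
  unfolding hom_words_def by (rule lists_length_Suc_eq)

lemma sum_hom_words_prod:
  fixes f :: "nat \<Rightarrow> nat \<Rightarrow> real"
  shows "(\<Sum>w\<in>hom_words n d. \<Prod>j<d. f j (w ! j)) = (\<Prod>j<d. \<Sum>k\<le>n. f j k)"
proof (induction d arbitrary: f)
  case 0
  have "hom_words n 0 = {[]}" by (auto simp: hom_words_def)
  then show ?case by simp
next
  case (Suc d)
  have inj: "inj_on (\<lambda>(w, k). k # w) (hom_words n d \<times> {..n})"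
    by (auto simp: inj_on_def)
  have "(\<Sum>w\<in>hom_words n (Suc d). \<Prod>j<Suc d. f j (w ! j))
      = (\<Sum>(w, k)\<in>hom_words n d \<times> {..n}. f 0 k * (\<Prod>j<d. f (Suc j) (w ! j)))"
    unfolding hom_words_Suc by (subst sum.reindex[OF inj]) (simp add: split_beta prod.lessThan_Suc_shift del: prod.lessThan_Suc)
  also have "\<dots> = (\<Sum>k\<le>n. f 0 k) * (\<Sum>w\<in>hom_words n d. \<Prod>j<d. f (Suc j) (w ! j))"
    by (simp add: sum.cartesian_product[symmetric] sum_product sum.swap[of _ "hom_words n d"])
  also have "\<dots> = (\<Prod>j<Suc d. \<Sum>k\<le>n. f j k)"
    by (simp only: Suc.IH[of "\<lambda>j. f (Suc j)"] prod.lessThan_Suc_shift)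
  finally show ?case .
qed

lemma word_type_multi_indices:
  assumes "w \<in> hom_words n d"
  shows "word_type w \<in> multi_indices n d" "count_list w 0 = d - (\<Sum>i<n. word_type w i)"
proof -
  have w: "set w \<subseteq> {..n}" "length w = d" using assms by (auto simp: hom_words_def)
  have "(\<Sum>k\<le>n. count_list w k) = d"
    using sum_count_set[OF w(1)] w(2) by simp
  then have *: "count_list w 0 + (\<Sum>i<n. word_type w i) = d"
    by (simp add: word_type_def sum.atMost_shift)
  then show "count_list w 0 = d - (\<Sum>i<n. word_type w i)" by simp
  have "word_type w i = 0" if "i \<ge> n" for i
    using w(1) that by (auto simp: word_type_def count_list_0_iff)
  then show "word_type w \<in> multi_indices n d"
    using * by (simp add: multi_indices_def)
qed

lemma prod_word:
  fixes y :: "nat \<Rightarrow> real"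
  assumes "set w \<subseteq> {..n}"
  shows "(\<Prod>j<length w. y (w ! j)) = y 0 ^ count_list w 0 * (\<Prod>i<n. y (Suc i) ^ word_type w i)"
proof -
  have "(\<Prod>j<length w. y (w ! j)) = (\<Prod>k\<le>n. y k ^ count_list w k)"
    using assms
  proof (induction w)
    case (Cons a w)
    have "(\<Prod>k\<le>n. y k ^ count_list (a # w) k) = (\<Prod>k\<le>n. (if k = a then y k else 1) * y k ^ count_list w k)"
      by (intro prod.cong) auto
    also have "\<dots> = (\<Prod>k\<le>n. if k = a then y k else 1) * (\<Prod>k\<le>n. y k ^ count_list w k)"
      by (rule prod.distrib)
    also have "(\<Prod>k\<le>n. if k = a then y k else 1) = y a"
      using Cons.prems by (subst prod.delta) auto
    finally show ?case
      using Cons by (simp add: prod.lessThan_Suc_shift del: prod.lessThan_Suc)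
  qed simp
  then show ?thesis
    by (simp add: word_type_def prod.atMost_shift)
qed

text \<open>Stated for an arbitrary \<open>y 0\<close>, because in the rotated chart the
  homogenising coordinate is \<open>sqrt s / (1 + r * z 0)\<close> and not 1; its
  \<open>d\<close>-th power is the factor that separates the chart polynomial from the original
  one.\<close>

lemma word_poly_eq_poly_fun:
  assumes z: "\<And>i. i < n \<Longrightarrow> y (Suc i) = y 0 * z i"
  shows "word_poly n d T y = y 0 ^ d * poly_fun n d (word_coeff n d T) z"
proof -
  let ?h = "\<lambda>\<alpha>. \<Prod>i<n. z i ^ \<alpha> i"
  have *: "(\<Prod>j<d. y (w ! j)) = y 0 ^ d * ?h (word_type w)" if w: "w \<in> hom_words n d" for w
  proof -
    have "(\<Prod>j<d. y (w ! j)) = y 0 ^ count_list w 0 * (\<Prod>i<n. (y 0 * z i) ^ word_type w i)"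
      using w prod_word[of w n y] by (simp add: hom_words_def z)
    also have "\<dots> = y 0 ^ (count_list w 0 + (\<Sum>i<n. word_type w i)) * ?h (word_type w)"
      by (simp add: power_mult_distrib prod.distrib power_add power_sum)
    also have "count_list w 0 + (\<Sum>i<n. word_type w i) = d"
      using word_type_multi_indices[OF w] by (simp add: multi_indices_def)
    finally show ?thesis .
  qed
  have "word_poly n d T y = (\<Sum>w\<in>hom_words n d. T w * (y 0 ^ d * ?h (word_type w)))"
    unfolding word_poly_def by (intro sum.cong refl) (simp only: *)
  also have "\<dots> = (\<Sum>\<alpha>\<in>multi_indices n d. \<Sum>w\<in>{w \<in> hom_words n d. word_type w = \<alpha>}. T w * (y 0 ^ d * ?h (word_type w)))"
    by (rule sum.group[symmetric]) (auto simp: finite_multi_indices word_type_multi_indices)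
  also have "\<dots> = (\<Sum>\<alpha>\<in>multi_indices n d. y 0 ^ d * (word_coeff n d T \<alpha> * ?h \<alpha>))"
  proof (intro sum.cong refl)
    fix \<alpha> assume "\<alpha> \<in> multi_indices n d"
    then have "y 0 ^ d * (word_coeff n d T \<alpha> * ?h \<alpha>)
        = (\<Sum>w\<in>{w \<in> hom_words n d. word_type w = \<alpha>}. T w) * (y 0 ^ d * ?h \<alpha>)"
      by (simp add: word_coeff_def)
    then show "(\<Sum>w\<in>{w \<in> hom_words n d. word_type w = \<alpha>}. T w * (y 0 ^ d * ?h (word_type w)))
        = y 0 ^ d * (word_coeff n d T \<alpha> * ?h \<alpha>)"
      by (simp add: sum_distrib_right)
  qed
  finally show ?thesis
    by (simp add: poly_fun_def sum_distrib_left)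
qed

text \<open>A sum of independent standard normal entries has variance equal to the number of
  summands, so this count is what reproduces the prescribed variances. The words of a given type are
  the permutations of one multiset.\<close>

lemma card_word_type:
  assumes \<alpha>: "\<alpha> \<in> multi_indices n d"
  shows "real (card {w \<in> hom_words n d. word_type w = \<alpha>}) = multinomial_coeff n d \<alpha>"
proof -
  define m where "m k = (case k of 0 \<Rightarrow> d - (\<Sum>i<n. \<alpha> i) | Suc i \<Rightarrow> \<alpha> i)" for k
  define M where "M = (\<Sum>k\<le>n. replicate_mset (m k) k)"
  have m_gt: "m k = 0" if "k > n" for k
    using \<alpha> that by (auto simp: m_def multi_indices_def split: nat.splits)
  have count_M: "count M k = m k" for k
    by (cases "k \<le> n") (auto simp: M_def count_sum m_gt)
  have "size (\<Sum>k\<in>A. replicate_mset (m k) k) = (\<Sum>k\<in>A. m k)" for A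
    by (induction A rule: infinite_finite_induct) auto
  then have size_M: "size M = d"
    using \<alpha> by (simp add: M_def m_def sum.atMost_shift multi_indices_def)
  have set_M: "set_mset M \<subseteq> {..n}"
  proof
    fix k assume "k \<in># M"
    then have "m k \<noteq> 0" by (simp add: count_M[symmetric])
    then show "k \<in> {..n}" using m_gt[of k] by (cases "k > n") auto
  qed
  have "{w \<in> hom_words n d. word_type w = \<alpha>} = permutations_of_multiset M"
  proof (intro set_eqI iffI)
    fix w assume w: "w \<in> {w \<in> hom_words n d. word_type w = \<alpha>}"
    have "count_list w k = m k" for k
      using w word_type_multi_indices(2)[of w n d]
      by (cases k) (auto simp: m_def word_type_def fun_eq_iff)
    then show "w \<in> permutations_of_multiset M"
      by (auto simp: permutations_of_multiset_def multiset_eq_iff count_M count_mset)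
  next
    fix w assume w: "w \<in> permutations_of_multiset M"
    then have M: "mset w = M" by (simp add: permutations_of_multiset_def)
    have "set w \<subseteq> {..n}" "length w = d"
      using M set_M size_M by (metis set_mset_mset, metis size_mset)
    moreover have "count_list w k = m k" for k
      using M count_M by (metis count_mset)
    ultimately show "w \<in> {w \<in> hom_words n d. word_type w = \<alpha>}"
      by (auto simp: hom_words_def word_type_def m_def)
  qed
  then have "real (card {w \<in> hom_words n d. word_type w = \<alpha>}) = fact d / real (\<Prod>x\<in>set_mset M. fact (count M x))"
    using card_permutations_of_multiset[of M] by (simp add: real_of_nat_div size_M)
  also have "(\<Prod>x\<in>set_mset M. fact (count M x) :: nat) = (\<Prod>k\<le>n. fact (m k))"
  proof (rule prod.mono_neutral_cong_left)
    show "\<forall>k\<in>{..n} - set_mset M. fact (m k) = (1::nat)"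
      by (simp add: count_M[symmetric] not_in_iff)
  qed (use set_M in \<open>auto simp: count_M\<close>)
  also have "real \<dots> = (\<Prod>i<n. fact (\<alpha> i)) * fact (d - (\<Sum>i<n. \<alpha> i))"
    by (simp add: prod.atMost_shift m_def)
  finally show ?thesis by (simp add: multinomial_coeff_def)
qed

section \<open>The law of the coefficients of a Gaussian tensor\<close>

lemma indep_vars_PiM_std_normal:
  assumes "finite I" "I \<noteq> {}"
  shows "prob_space.indep_vars (std_gauss I) (\<lambda>_. borel) (\<lambda>i g. g i) I"
    and "\<And>i. i \<in> I \<Longrightarrow> distributed (std_gauss I) lborel (\<lambda>g. g i) (normal_density 0 1)"
proof -
  interpret prob_space "std_gauss I"
    by (intro prob_space_PiM prob_space_std_normal)
  have law: "distr (std_gauss I) lborel (\<lambda>g. g i) = std_normal" if "i \<in> I" for i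
  proof -
    have "distr (std_gauss I) lborel (\<lambda>g. g i) = distr (std_gauss I) std_normal (\<lambda>g. g i)"
      by (rule distr_cong) auto
    also have "\<dots> = std_normal"
      using assms that by (intro distr_PiM_component prob_space_std_normal)
    finally show ?thesis .
  qed
  then show "distributed (std_gauss I) lborel (\<lambda>g. g i) (normal_density 0 1)" if "i \<in> I" for i
    using that by (auto simp: distributed_def)
  have rv: "random_variable borel (\<lambda>g. g i)" if "i \<in> I" for i
    using measurable_component_singleton[OF that, of "\<lambda>_. std_normal"] by simp
  have law': "distr (std_gauss I) borel (\<lambda>g. g i) = std_normal" if "i \<in> I" for i
    by (rule trans[OF _ law[OF that]]) (rule distr_cong, auto)
  have "distr (std_gauss I) (\<Pi>\<^sub>M i\<in>I. borel) (\<lambda>g. \<lambda>i\<in>I. g i)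
      = distr (std_gauss I) (std_gauss I) (\<lambda>g. g)"
    by (intro distr_cong sets_PiM_cong) (auto simp: space_PiM PiE_def extensional_restrict)
  also have "\<dots> = (\<Pi>\<^sub>M i\<in>I. distr (std_gauss I) borel (\<lambda>g. g i))"
    using law' by (simp add: distr_id cong: PiM_cong)
  finally show "indep_vars (\<lambda>_. borel) (\<lambda>i g. g i) I"
    using rv assms by (subst indep_vars_iff_distr_eq_PiM') auto
qed

lemma word_coeff_measurable [measurable]:
  "word_coeff n d \<in> std_gauss (hom_words n d) \<rightarrow>\<^sub>M coeff_measure n d"
  unfolding word_coeff_def[abs_def] coeff_measure_def by (rule measurable_restrict) measurable

text \<open>Different multi-indices collect disjoint blocks of words, which gives independence; each
  block sum is centered normal with variance the size of the block.\<close>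

lemma distr_word_coeff:
  "distr (std_gauss (hom_words n d)) (coeff_measure n d) (word_coeff n d) = coeff_measure n d"
proof -
  let ?G = "std_gauss (hom_words n d)"
  let ?fib = "\<lambda>\<alpha>. {w \<in> hom_words n d. word_type w = \<alpha>}"
  let ?N = "\<lambda>\<alpha>. density lborel (\<lambda>t. ennreal (normal_density 0 (sqrt (multinomial_coeff n d \<alpha>)) t))"
  interpret prob_space ?G
    by (intro prob_space_PiM prob_space_std_normal)
  \<comment> \<open>Blocks are nonempty, as required for a sum of independent normals, because their
    cardinality is the positive number \<open>multinomial_coeff n d \<alpha>\<close>.\<close>
  have fib: "finite (?fib \<alpha>)" "?fib \<alpha> \<noteq> {}" if "\<alpha> \<in> multi_indices n d" for \<alpha>
    using card_word_type[OF that] multinomial_coeff_pos[of n d \<alpha>] by (auto simp del: Collect_empty_eq)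
  have "replicate d 0 \<in> hom_words n d" by (auto simp: hom_words_def)
  then have ne: "hom_words n d \<noteq> {}" by blast
  note ind = indep_vars_PiM_std_normal(1)[OF finite_hom_words ne]
  have indY: "indep_vars (\<lambda>_. borel) (\<lambda>\<alpha> T. \<Sum>w\<in>?fib \<alpha>. T w) (multi_indices n d)"
  proof -
    have "indep_vars (\<lambda>\<alpha>. PiM (?fib \<alpha>) (\<lambda>_. borel)) (\<lambda>\<alpha> T. \<lambda>w\<in>?fib \<alpha>. T w) (multi_indices n d)"
      by (rule indep_vars_restrict[OF ind]) (auto simp: disjoint_family_on_def)
    then have "indep_vars (\<lambda>_. borel) (\<lambda>\<alpha> T. \<Sum>w\<in>?fib \<alpha>. (\<lambda>w\<in>?fib \<alpha>. T w) w) (multi_indices n d)"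
      by (rule indep_vars_compose2[where Y="\<lambda>\<alpha> g. \<Sum>w\<in>?fib \<alpha>. g w"]) measurable
    then show ?thesis by simp
  qed
  have dist: "distributed ?G lborel (\<lambda>T. \<Sum>w\<in>?fib \<alpha>. T w) (normal_density 0 (sqrt (multinomial_coeff n d \<alpha>)))"
    if \<alpha>: "\<alpha> \<in> multi_indices n d" for \<alpha>
  proof -
    have "distributed ?G lborel (\<lambda>T. \<Sum>w\<in>?fib \<alpha>. T w) (normal_density (\<Sum>w\<in>?fib \<alpha>. 0) (sqrt (\<Sum>w\<in>?fib \<alpha>. 1\<^sup>2)))"
      using indep_vars_PiM_std_normal(2)[OF finite_hom_words ne]
      by (intro sum_indep_normal fib[OF \<alpha>] indep_vars_subset[OF ind]) auto
    then show ?thesis using card_word_type[OF \<alpha>] by simp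
  qed
  have law: "distr ?G borel (\<lambda>T. \<Sum>w\<in>?fib \<alpha>. T w) = ?N \<alpha>" if \<alpha>: "\<alpha> \<in> multi_indices n d" for \<alpha>
  proof -
    have "distr ?G borel (\<lambda>T. \<Sum>w\<in>?fib \<alpha>. T w) = distr ?G lborel (\<lambda>T. \<Sum>w\<in>?fib \<alpha>. T w)"
      by (rule distr_cong) auto
    then show ?thesis
      using distributed_distr_eq_density[OF dist[OF \<alpha>]] by simp
  qed
  have "(\<lambda>_. 0) \<in> multi_indices n d"
    by (simp add: multi_indices_def)
  then have "multi_indices n d \<noteq> {}" by blast
  then have "distr ?G (\<Pi>\<^sub>M \<alpha>\<in>multi_indices n d. borel) (\<lambda>T. \<lambda>\<alpha>\<in>multi_indices n d. \<Sum>w\<in>?fib \<alpha>. T w)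
      = (\<Pi>\<^sub>M \<alpha>\<in>multi_indices n d. distr ?G borel (\<lambda>T. \<Sum>w\<in>?fib \<alpha>. T w))"
    using indY by (subst indep_vars_iff_distr_eq_PiM'[symmetric]) (auto simp: indep_vars_def)
  also have "\<dots> = coeff_measure n d"
    unfolding coeff_measure_def using law by (intro PiM_cong) auto
  finally show ?thesis
    unfolding word_coeff_def[abs_def]
    by (subst distr_cong[OF refl _ refl, of _ "\<Pi>\<^sub>M \<alpha>\<in>multi_indices n d. borel"])
      (auto simp: coeff_measure_def intro!: sets_PiM_cong)
qed

section \<open>Kronecker powers of symmetric orthogonal matrices acting on tensors\<close>

definition word_rot :: "nat \<Rightarrow> nat \<Rightarrow> (nat \<Rightarrow> nat \<Rightarrow> real) \<Rightarrow> (nat list \<Rightarrow> real) \<Rightarrow> nat list \<Rightarrow> real" where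
  "word_rot n d R T = (\<lambda>w\<in>hom_words n d. \<Sum>v\<in>hom_words n d. (\<Prod>j<d. R (w ! j) (v ! j)) * T v)"

text \<open>Every rotation in use is the identity or a reflection. Symmetry makes such a matrix its
  own inverse and removes the distinction between the action on tensors and the one on
  points.\<close>

definition sym_orth :: "nat \<Rightarrow> (nat \<Rightarrow> nat \<Rightarrow> real) \<Rightarrow> bool" where
  "sym_orth n R \<longleftrightarrow> (\<forall>i j. R i j = R j i) \<and>
    (\<forall>i\<le>n. \<forall>j\<le>n. (\<Sum>k\<le>n. R i k * R j k) = (if i = j then 1 else 0))"

lemma sym_orthD:
  assumes "sym_orth n R"
  shows "R i j = R j i"
    and "i \<le> n \<Longrightarrow> j \<le> n \<Longrightarrow> (\<Sum>k\<le>n. R i k * R j k) = (if i = j then 1 else 0)"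
  using assms unfolding sym_orth_def by blast+

lemma word_poly_word_rot:
  assumes "sym_orth n R"
  shows "word_poly n d (word_rot n d R T) y = word_poly n d T (\<lambda>i. \<Sum>k\<le>n. R i k * y k)"
proof -
  have "word_poly n d (word_rot n d R T) y
      = (\<Sum>w\<in>hom_words n d. \<Sum>v\<in>hom_words n d. T v * (\<Prod>j<d. R (w ! j) (v ! j) * y (w ! j)))"
    by (simp add: word_poly_def word_rot_def sum_distrib_left sum_distrib_right prod.distrib mult_ac)
  also have "\<dots> = (\<Sum>v\<in>hom_words n d. T v * (\<Sum>w\<in>hom_words n d. \<Prod>j<d. R (w ! j) (v ! j) * y (w ! j)))"
    by (subst sum.swap) (simp add: sum_distrib_left)
  also have "\<dots> = (\<Sum>v\<in>hom_words n d. T v * (\<Prod>j<d. \<Sum>k\<le>n. R k (v ! j) * y k))"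
    by (simp only: sum_hom_words_prod[where f="\<lambda>j k. R k (_ ! j) * y k"])
  finally show ?thesis
    using assms by (simp add: word_poly_def sym_orth_def)
qed

lemma sym_orth_involution:
  assumes "sym_orth n R" "i \<le> n"
  shows "(\<Sum>k\<le>n. R i k * (\<Sum>l\<le>n. R k l * y l)) = y i"
proof -
  have orth: "(\<Sum>k\<le>n. R i k * R l k) = (if i = l then 1 else 0)" if "l \<le> n" for l
    using assms that unfolding sym_orth_def by blast
  have sym: "R k l = R l k" for k l
    using assms unfolding sym_orth_def by blast
  have "(\<Sum>k\<le>n. R i k * (\<Sum>l\<le>n. R k l * y l)) = (\<Sum>k\<le>n. \<Sum>l\<le>n. R i k * R l k * y l)"
    unfolding sum_distrib_left by (intro sum.cong refl) (metis sym mult.assoc)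
  also have "\<dots> = (\<Sum>l\<le>n. (\<Sum>k\<le>n. R i k * R l k) * y l)"
    by (subst sum.swap) (simp add: sum_distrib_right)
  also have "\<dots> = (\<Sum>l\<le>n. if l = i then y l else 0)"
    by (intro sum.cong) (auto simp: orth)
  finally show ?thesis using assms(2) by simp
qed

lemma sym_orth_abs_le:
  assumes "sym_orth n R" "i \<le> n" "j \<le> n"
  shows "\<bar>R i j\<bar> \<le> 1"
proof -
  have "(R i j)\<^sup>2 \<le> (\<Sum>k\<le>n. R i k * R i k)"
    using assms by (subst power2_eq_square, intro member_le_sum) auto
  also have "\<dots> = 1" using sym_orthD(2)[OF assms(1,2,2)] by simp
  finally show ?thesis by (simp add: abs_square_le_1)
qed

text \<open>The inner product of two rows of a Kronecker power factors over the \<open>d\<close>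
  positions, so the rows indexed by words are again orthonormal.\<close>

lemma nn_integral_word_rot:
  assumes R: "sym_orth n R"
    and f: "f \<in> borel_measurable (std_gauss (hom_words n d))"
  shows "(\<integral>\<^sup>+T. f (word_rot n d R T) \<partial>std_gauss (hom_words n d))
    = (\<integral>\<^sup>+T. f T \<partial>std_gauss (hom_words n d))"
  unfolding word_rot_def
proof (rule nn_integral_std_normal_orthonormal[OF finite_hom_words _ f])
  fix w v assume w: "w \<in> hom_words n d" and v: "v \<in> hom_words n d"
  have "(\<Sum>l\<in>hom_words n d. (\<Prod>j<d. R (w ! j) (l ! j)) * (\<Prod>j<d. R (v ! j) (l ! j)))
      = (\<Prod>j<d. \<Sum>k\<le>n. R (w ! j) k * R (v ! j) k)"
    by (simp only: prod.distrib[symmetric] sum_hom_words_prod[where f="\<lambda>j k. R (w ! j) k * R (v ! j) k"])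
  also have "\<dots> = (\<Prod>j<d. if w ! j = v ! j then 1 else 0)"
  proof (intro prod.cong refl)
    fix j assume "j \<in> {..<d}"
    then have "w ! j \<le> n" "v ! j \<le> n"
      using w v by (auto intro: hom_words_nth_le)
    then show "(\<Sum>k\<le>n. R (w ! j) k * R (v ! j) k) = (if w ! j = v ! j then 1 else 0)"
      using sym_orthD(2)[OF R] by simp
  qed
  also have "\<dots> = (if w = v then 1 else 0)"
  proof (cases "w = v")
    case False
    then obtain j where "j < d" "w ! j \<noteq> v ! j"
      using w v by (auto simp: hom_words_def list_eq_iff_nth_eq)
    then show ?thesis using False by (auto intro!: prod_zero)
  qed simp
  finally show "(\<Sum>l\<in>hom_words n d. (\<Prod>j<d. R (w ! j) (l ! j)) * (\<Prod>j<d. R (v ! j) (l ! j)))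
      = (if w = v then 1 else 0)" .
qed

lemma word_rot_measurable [measurable]:
  "word_rot n d R \<in> std_gauss (hom_words n d) \<rightarrow>\<^sub>M std_gauss (hom_words n d)"
  unfolding word_rot_def[abs_def] by (rule measurable_restrict) measurable

text \<open>Crude on purpose: the bound only determines how fine the grid has to be, and the grid
  size cancels from the final estimate.\<close>

lemma sum_abs_word_rot_le:
  assumes R: "sym_orth n R"
  shows "(\<Sum>w\<in>hom_words n d. \<bar>word_rot n d R T w\<bar>)
    \<le> real (card (hom_words n d)) * (\<Sum>w\<in>hom_words n d. \<bar>T w\<bar>)"
proof -
  have "\<bar>word_rot n d R T w\<bar> \<le> (\<Sum>v\<in>hom_words n d. \<bar>T v\<bar>)" if w: "w \<in> hom_words n d" for w
  proof -
    have "\<bar>word_rot n d R T w\<bar> \<le> (\<Sum>v\<in>hom_words n d. (\<Prod>j<d. \<bar>R (w ! j) (v ! j)\<bar>) * \<bar>T v\<bar>)"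
      using w by (auto simp: word_rot_def abs_mult abs_prod intro!: sum_abs[THEN order_trans])
    also have "\<dots> \<le> (\<Sum>v\<in>hom_words n d. 1 * \<bar>T v\<bar>)"
      using w by (intro sum_mono mult_right_mono prod_le_1 conjI sym_orth_abs_le[OF R])
        (auto intro: hom_words_nth_le)
    finally show ?thesis by simp
  qed
  from sum_mono[OF this] show ?thesis by (simp add: mult.commute)
qed

lemma sum_abs_word_coeff_le:
  "(\<Sum>\<alpha>\<in>multi_indices n d. \<bar>word_coeff n d T \<alpha>\<bar>) \<le> (\<Sum>w\<in>hom_words n d. \<bar>T w\<bar>)"
proof -
  have "(\<Sum>\<alpha>\<in>multi_indices n d. \<bar>word_coeff n d T \<alpha>\<bar>)
      \<le> (\<Sum>\<alpha>\<in>multi_indices n d. \<Sum>w\<in>{w \<in> hom_words n d. word_type w = \<alpha>}. \<bar>T w\<bar>)"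
    by (intro sum_mono) (simp add: word_coeff_def sum_abs)
  also have "\<dots> = (\<Sum>w\<in>hom_words n d. \<bar>T w\<bar>)"
    by (rule sum.group) (auto simp: finite_multi_indices word_type_multi_indices)
  finally show ?thesis .
qed

section \<open>The probability that a Gaussian symmetric matrix is positive semidefinite\<close>

text \<open>A necessary condition for positive semidefiniteness, by iterated Schur complements. Unlike
  positive semidefiniteness itself it is visibly measurable in the entries. A vanishing pivot ends
  the test.\<close>

fun psd_rec :: "nat \<Rightarrow> (nat \<Rightarrow> nat \<Rightarrow> real) \<Rightarrow> bool" where
  "psd_rec 0 A = True"
| "psd_rec (Suc m) A =
    (A m m \<ge> 0 \<and> (A m m > 0 \<longrightarrow> psd_rec m (\<lambda>i j. A i j - A i m * A j m / A m m)))"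

lemma psd_rec_cong:
  "(\<And>i j. i < m \<Longrightarrow> j < m \<Longrightarrow> A i j = B i j) \<Longrightarrow> psd_rec m A = psd_rec m B"
proof (induction m arbitrary: A B)
  case (Suc m)
  have "psd_rec m (\<lambda>i j. A i j - A i m * A j m / A m m) = psd_rec m (\<lambda>i j. B i j - B i m * B j m / B m m)"
    using Suc.prems by (intro Suc.IH) auto
  then show ?case using Suc.prems[of m m] by simp
qed simp

lemma psd_imp_psd_rec:
  assumes "\<And>i j. i < m \<Longrightarrow> j < m \<Longrightarrow> A i j = A j i"
    and "\<And>v. (\<Sum>i<m. \<Sum>j<m. A i j * v i * v j) \<ge> 0"
  shows "psd_rec m A"
  using assms
proof (induction m arbitrary: A)
  case (Suc m)
  have ext: "(\<Sum>i<Suc m. \<Sum>j<Suc m. A i j * v i * v j)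
      = (\<Sum>i<m. \<Sum>j<m. A i j * v i * v j) + 2 * v m * (\<Sum>i<m. A i m * v i) + A m m * (v m)\<^sup>2" for v
  proof -
    have row: "(\<Sum>j<m. A m j * v m * v j) = v m * (\<Sum>i<m. A i m * v i)"
      unfolding sum_distrib_left
    proof (intro sum.cong refl)
      fix j assume "j \<in> {..<m}"
      then have "A m j = A j m" by (intro Suc.prems(1)) auto
      then show "A m j * v m * v j = v m * (A j m * v j)" by simp
    qed
    have col: "(\<Sum>i<m. A i m * v i * v m) = v m * (\<Sum>i<m. A i m * v i)"
      unfolding sum_distrib_left by (intro sum.cong) auto
    show ?thesis
      by (simp add: sum.distrib row col power2_eq_square)
  qed
  have "(\<Sum>i<Suc m. \<Sum>j<Suc m. A i j * (if i = m then 1 else 0) * (if j = m then 1 else 0)) = A m m"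
    unfolding ext by simp
  then have nonneg: "A m m \<ge> 0"
    using Suc.prems(2)[of "\<lambda>i. if i = m then 1 else 0"] by simp
  moreover have "psd_rec m (\<lambda>i j. A i j - A i m * A j m / A m m)" if pos: "A m m > 0"
  proof (rule Suc.IH)
    show "A i j - A i m * A j m / A m m = A j i - A j m * A i m / A m m" if "i < m" "j < m" for i j
      using Suc.prems(1)[of i j] that by simp
  next
    fix v :: "nat \<Rightarrow> real"
    define S where "S = (\<Sum>i<m. A i m * v i)"
    \<comment> \<open>The last coordinate minimises the form for given first \<open>m\<close>
      coordinates; the minimal value is the form of the Schur complement.\<close>
    define w where "w = v(m := - S / A m m)"
    have w: "(\<Sum>i<m. \<Sum>j<m. A i j * w i * w j) = (\<Sum>i<m. \<Sum>j<m. A i j * v i * v j)"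
      "(\<Sum>i<m. A i m * w i) = S"
      by (simp_all add: w_def S_def)
    have "0 \<le> (\<Sum>i<Suc m. \<Sum>j<Suc m. A i j * w i * w j)"
      by (rule Suc.prems(2))
    also have "\<dots> = (\<Sum>i<m. \<Sum>j<m. A i j * v i * v j) - S * S / A m m"
      unfolding ext w using pos by (simp add: w_def power2_eq_square field_simps)
    also have "S * S / A m m = (\<Sum>i<m. \<Sum>j<m. (A i m * A j m / A m m) * v i * v j)"
      unfolding S_def sum_product sum_divide_distrib by (intro sum.cong) auto
    finally show "0 \<le> (\<Sum>i<m. \<Sum>j<m. (A i j - A i m * A j m / A m m) * v i * v j)"
      by (simp add: sum_subtractf left_diff_distrib)
  qed
  ultimately show ?case by simp
qed simp

lemma measurable_psd_rec [measurable (raw)]: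
  assumes "\<And>i j. i < m \<Longrightarrow> j < m \<Longrightarrow> (\<lambda>x. A x i j) \<in> borel_measurable M"
  shows "Measurable.pred M (\<lambda>x. psd_rec m (A x))"
  using assms
proof (induction m arbitrary: A)
  case (Suc m)
  have [measurable]: "(\<lambda>x. A x m m) \<in> borel_measurable M"
    by (rule Suc.prems) auto
  have "Measurable.pred M (\<lambda>x. psd_rec m (\<lambda>i j. A x i j - A x i m * A x j m / A x m m))"
    using Suc.prems by (intro Suc.IH borel_measurable_diff borel_measurable_divide borel_measurable_times) auto
  note [measurable] = this
  show ?case by simp
qed simp

section \<open>Gaussian symmetric matrices and the Laplace transform of the semidefinite
  cone\<close>

definition tri :: "nat \<Rightarrow> (nat \<times> nat) set" where
  "tri m = {(i, j). i \<le> j \<and> j < m}"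

definition tri_col :: "nat \<Rightarrow> (nat \<times> nat) set" where
  "tri_col m = (\<lambda>i. (i, m)) ` {..<m}"

lemma tri_Suc: "tri (Suc m) = insert (m, m) (tri_col m) \<union> tri m"
  by (auto simp: tri_def tri_col_def)

lemma finite_tri [simp]: "finite (tri m)"
  by (rule finite_subset[of _ "{..<m} \<times> {..<m}"]) (auto simp: tri_def)

lemma finite_tri_col [simp]: "finite (tri_col m)"
  by (simp add: tri_col_def)

lemma card_tri_col: "card (tri_col m) = m"
  unfolding tri_col_def by (subst card_image) (auto simp: inj_on_def)

lemma card_tri_Suc: "card (tri (Suc m)) = card (tri m) + m + 1"
proof -
  have "(m, m) \<notin> tri_col m" "insert (m, m) (tri_col m) \<inter> tri m = {}"
    by (auto simp: tri_col_def tri_def)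
  then show ?thesis
    unfolding tri_Suc by (subst card_Un_disjoint) (auto simp: card_tri_col)
qed

text \<open>With independent standard normal entries this is a matrix of the Gaussian orthogonal ensemble.\<close>

definition goe_mat :: "(nat \<times> nat \<Rightarrow> real) \<Rightarrow> nat \<Rightarrow> nat \<Rightarrow> real" where
  "goe_mat g i j = (if i = j then sqrt 2 * g (i, i) else g (min i j, max i j))"

lemma nn_integral_gauss:
  assumes "c > 0"
  shows "(\<integral>\<^sup>+x. ennreal (exp (- c * x\<^sup>2)) \<partial>lborel) = ennreal (sqrt (pi / c))"
proof -
  define s where "s = sqrt (1 / (2 * c))"
  have s: "s > 0" "s\<^sup>2 = 1 / (2 * c)" using assms by (simp_all add: s_def)
  interpret prob_space "density lborel (\<lambda>x. ennreal (normal_density 0 s x))"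
    using s by (intro prob_space_normal_density)
  have "exp (- c * x\<^sup>2) = sqrt (pi / c) * normal_density 0 s x" for x
    using assms by (simp add: normal_density_def s field_simps)
  then have "(\<integral>\<^sup>+x. ennreal (exp (- c * x\<^sup>2)) \<partial>lborel)
      = (\<integral>\<^sup>+x. ennreal (sqrt (pi / c)) * ennreal (normal_density 0 s x) \<partial>lborel)"
    using assms by (simp add: ennreal_mult)
  also have "\<dots> = ennreal (sqrt (pi / c)) * emeasure (density lborel (\<lambda>x. ennreal (normal_density 0 s x))) UNIV"
    by (subst nn_integral_cmult) (auto simp: emeasure_density)
  also have "\<dots> = ennreal (sqrt (pi / c))"
    using emeasure_space_1 by simp
  finally show ?thesis .
qed

text \<open>Up to normalisation and a null set, the multivariate gamma integral: the Laplace
  transform of the cone of positive semidefinite matrices at \<open>l\<close> times the identity.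
  The exponent is the trace of \<open>goe_mat g\<close>.\<close>

definition cone_integral :: "nat \<Rightarrow> real \<Rightarrow> ennreal" where
  "cone_integral m l = (\<integral>\<^sup>+g. indicator {g. psd_rec m (goe_mat g)} g
     * ennreal (exp (- l * (\<Sum>i<m. sqrt 2 * g (i, i)))) \<partial>lborel_on (tri m))"

lemma goe_mat_measurable [measurable]:
  assumes "i < m" "j < m" "tri m \<subseteq> I" "\<And>i. i \<in> I \<Longrightarrow> sets (M i) = sets borel"
  shows "(\<lambda>g. goe_mat g i j) \<in> borel_measurable (PiM I M)"
proof -
  have "(i, i) \<in> I" "(min i j, max i j) \<in> I"
    using assms by (auto simp: tri_def min_def max_def subset_iff)
  then have "(\<lambda>g. g (i, i)) \<in> borel_measurable (PiM I M)"
    "(\<lambda>g. g (min i j, max i j)) \<in> borel_measurable (PiM I M)"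
    using assms(4) measurable_component_singleton[of _ I M] by (auto cong: measurable_cong_sets)
  then show ?thesis unfolding goe_mat_def by simp
qed

lemma trace_measurable [measurable]:
  "(\<lambda>g. \<Sum>i<m. sqrt 2 * g (i, i)) \<in> borel_measurable (lborel_on (tri m))"
proof -
  have "(i, i) \<in> tri m" if "i < m" for i using that by (simp add: tri_def)
  then show ?thesis
    by (intro borel_measurable_sum borel_measurable_times measurable_const)
      (use measurable_component_singleton[of _ "tri m" "\<lambda>_. lborel"] in auto)
qed

lemma cone_integrand_measurable [measurable]:
  "(\<lambda>g. indicator {g. psd_rec m (goe_mat g)} g * ennreal (exp (- l * (\<Sum>i<m. sqrt 2 * g (i, i)))))
    \<in> borel_measurable (lborel_on (tri m))"
proof -
  have [measurable]: "Measurable.pred (lborel_on (tri m)) (\<lambda>g. psd_rec m (goe_mat g))"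
    by (intro measurable_psd_rec goe_mat_measurable) auto
  show ?thesis by (simp add: indicator_def) measurable
qed

text \<open>Subtracting the rank one matrix of the Schur complement is a translation of the remaining
  entries, hence preserves Lebesgue measure; the trace changes by the squared norm of the removed
  column divided by the pivot, which leaves a Gaussian integral over that column.\<close>

lemma cone_integral_Suc:
  assumes l: "l > 0"
  shows "cone_integral (Suc m) l
    \<le> (\<integral>\<^sup>+b. indicator {0<..} b * ennreal (exp (- l * (sqrt 2 * b)) * sqrt (pi * (sqrt 2 * b) / l) ^ m) \<partial>lborel)
      * cone_integral m l"
proof -
  let ?f = "\<lambda>g. indicator {g. psd_rec (Suc m) (goe_mat g)} g
     * ennreal (exp (- l * (\<Sum>i<Suc m. sqrt 2 * g (i, i))))"
  let ?C = "insert (m, m) (tri_col m)"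
  let ?mg = "\<lambda>x y. merge ?C (tri m) (x, y)"
  have disj: "?C \<inter> tri m = {}" and mm: "(m, m) \<notin> tri_col m"
    by (auto simp: tri_col_def tri_def)
  have f_meas: "?f \<in> borel_measurable (lborel_on (?C \<union> tri m))"
    using cone_integrand_measurable[of "Suc m" l] by (simp only: tri_Suc)
  interpret T: sigma_finite_measure "lborel_on (tri m)"
    by (rule lborel_prod.sigma_finite) simp
  define F where "F x = (\<integral>\<^sup>+y. ?f (?mg x y) \<partial>lborel_on (tri m))" for x
  have fm: "(\<lambda>p. ?f (merge ?C (tri m) p)) \<in> borel_measurable (lborel_on ?C \<Otimes>\<^sub>M lborel_on (tri m))"
    by (rule measurable_compose[OF measurable_merge f_meas])
  have F_meas: "F \<in> borel_measurable (lborel_on ?C)"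
    unfolding F_def by (rule T.borel_measurable_nn_integral) (use fm in \<open>simp add: split_beta'\<close>)
  have inner: "F x = ennreal (exp (- l * (sqrt 2 * x (m, m)))) * (\<Prod>p\<in>tri_col m. ennreal (exp (- (l / (sqrt 2 * x (m, m))) * (x p)\<^sup>2)))
      * cone_integral m l" (is "_ = ?R") if pos: "x (m, m) > 0" for x
  proof -
    define a where "a = sqrt 2 * x (m, m)"
    have a: "a > 0" using pos by (simp add: a_def)
    define v where "v i = x (i, m)" for i
    \<comment> \<open>The rank one matrix with entries \<open>v i * v j / a\<close> in the
      coordinates of \<open>goe_mat\<close>; the division by \<open>sqrt 2\<close> compensates the
      factor on its diagonal.\<close>
    define t where "t = (\<lambda>(i, j). if i = j then (v i)\<^sup>2 / (sqrt 2 * a) else v i * v j / a)"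
    have entries: "?mg x y (i, j) = y (i, j)" if "i \<le> j" "j < m" for y i j
      using that by (auto simp: merge_def tri_def tri_col_def)
    have entries': "?mg x y (i, m) = v i" if "i \<le> m" for y i
      using that by (auto simp: merge_def tri_def tri_col_def v_def)
    have mat: "goe_mat (?mg x y) i j = goe_mat y i j" if "i < m" "j < m" for y i j
      using that by (auto simp: goe_mat_def entries min_def max_def)
    have mat': "goe_mat (?mg x y) i m = v i" if "i < m" for y i
      using that by (auto simp: goe_mat_def entries')
    have mat'': "goe_mat (?mg x y) m m = a" for y
      by (auto simp: goe_mat_def entries' a_def v_def)
    have psd: "psd_rec (Suc m) (goe_mat (?mg x y)) \<longleftrightarrow> psd_rec m (\<lambda>i j. goe_mat y i j - v i * v j / a)" for y
    proof -
      have "psd_rec (Suc m) (goe_mat (?mg x y))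
          \<longleftrightarrow> psd_rec m (\<lambda>i j. goe_mat (?mg x y) i j - goe_mat (?mg x y) i m * goe_mat (?mg x y) j m / a)"
        using a by (simp add: mat'')
      also have "\<dots> \<longleftrightarrow> psd_rec m (\<lambda>i j. goe_mat y i j - v i * v j / a)"
        by (rule psd_rec_cong) (simp add: mat mat')
      finally show ?thesis .
    qed
    have tr: "(\<Sum>i<Suc m. sqrt 2 * ?mg x y (i, i)) = (\<Sum>i<m. sqrt 2 * y (i, i)) + a" for y
      by (simp add: entries entries' a_def v_def)
    let ?h = "\<lambda>y. indicator {y. psd_rec m (\<lambda>i j. goe_mat y i j - v i * v j / a)} y
        * ennreal (exp (- l * ((\<Sum>i<m. sqrt 2 * y (i, i)) + a)))"
    have h_meas: "?h \<in> borel_measurable (lborel_on (tri m))"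
    proof -
      have [measurable]: "Measurable.pred (lborel_on (tri m)) (\<lambda>g. psd_rec m (\<lambda>i j. goe_mat g i j - v i * v j / a))"
        by (intro measurable_psd_rec borel_measurable_diff goe_mat_measurable) auto
      show ?thesis by (simp add: indicator_def) measurable
    qed
    have "F x = (\<integral>\<^sup>+y. ?h y \<partial>lborel_on (tri m))"
      unfolding F_def by (simp only: psd tr mem_Collect_eq indicator_def)
    also have "\<dots> = (\<integral>\<^sup>+y. ?h (\<lambda>p\<in>tri m. t p + y p) \<partial>lborel_on (tri m))"
      by (rule nn_integral_PiM_lborel_translate[symmetric, OF finite_tri h_meas])
    also have "\<dots> = (\<integral>\<^sup>+y. ennreal (exp (- l * (a + (\<Sum>i<m. (v i)\<^sup>2 / a)))) *
        (indicator {g. psd_rec m (goe_mat g)} y * ennreal (exp (- l * (\<Sum>i<m. sqrt 2 * y (i, i))))) \<partial>lborel_on (tri m))"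
    proof (rule nn_integral_cong)
      fix y :: "nat \<times> nat \<Rightarrow> real"
      let ?y = "\<lambda>p\<in>tri m. t p + y p"
      have "goe_mat ?y i j - v i * v j / a = goe_mat y i j" if "i < m" "j < m" for i j
      proof (cases "i = j")
        case True
        have "sqrt 2 * ((v i)\<^sup>2 / (sqrt 2 * a)) = v i * v i / a"
          by (simp add: power2_eq_square)
        with True that show ?thesis by (simp add: goe_mat_def tri_def t_def distrib_left)
      next
        case False
        then show ?thesis using that by (auto simp: goe_mat_def tri_def t_def min_def max_def)
      qed
      then have 1: "psd_rec m (\<lambda>i j. goe_mat ?y i j - v i * v j / a) = psd_rec m (goe_mat y)"
        by (rule psd_rec_cong)
      have "(\<Sum>i<m. sqrt 2 * ?y (i, i)) = (\<Sum>i<m. (v i)\<^sup>2 / a + sqrt 2 * y (i, i))"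
        by (intro sum.cong) (auto simp: tri_def t_def distrib_left)
      then have 2: "- l * ((\<Sum>i<m. sqrt 2 * ?y (i, i)) + a)
          = - l * (a + (\<Sum>i<m. (v i)\<^sup>2 / a)) + - l * (\<Sum>i<m. sqrt 2 * y (i, i))"
        by (simp add: sum.distrib algebra_simps)
      show "?h ?y = ennreal (exp (- l * (a + (\<Sum>i<m. (v i)\<^sup>2 / a)))) *
        (indicator {g. psd_rec m (goe_mat g)} y * ennreal (exp (- l * (\<Sum>i<m. sqrt 2 * y (i, i)))))"
        unfolding 2 exp_add using 1 by (simp add: indicator_def ennreal_mult)
    qed
    also have "\<dots> = ennreal (exp (- l * (a + (\<Sum>i<m. (v i)\<^sup>2 / a)))) * cone_integral m l"
      unfolding cone_integral_def by (rule nn_integral_cmult) measurable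
    also have "exp (- l * (a + (\<Sum>i<m. (v i)\<^sup>2 / a))) = exp (- l * a) * (\<Prod>i<m. exp (- (l / a) * (v i)\<^sup>2))"
      by (simp add: exp_sum[symmetric] exp_add[symmetric] sum_distrib_left algebra_simps flip: sum_negf)
    also have "(\<Prod>i<m. exp (- (l / a) * (v i)\<^sup>2)) = (\<Prod>p\<in>tri_col m. exp (- (l / a) * (x p)\<^sup>2))"
      unfolding tri_col_def v_def by (subst prod.reindex) (auto simp: inj_on_def)
    finally show ?thesis
      by (simp add: a_def ennreal_mult prod_ennreal prod_nonneg)
  qed
  have neg: "F x = 0" if "x (m, m) < 0" for x
  proof -
    have "goe_mat (?mg x y) m m < 0" for y
      using that by (simp add: goe_mat_def merge_def mult_pos_neg)
    then have "?f (?mg x y) = 0" for y by (simp add: not_le[symmetric])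
    then show ?thesis unfolding F_def by simp
  qed
  have "cone_integral (Suc m) l = (\<integral>\<^sup>+x. F x \<partial>lborel_on ?C)"
    unfolding cone_integral_def F_def tri_Suc
    by (rule lborel_prod.product_nn_integral_fold[OF disj _ _ f_meas]) simp_all
  also have "\<dots> = (\<integral>\<^sup>+b. \<integral>\<^sup>+x. F (x((m, m) := b)) \<partial>lborel_on (tri_col m) \<partial>lborel)"
    by (rule lborel_prod.product_nn_integral_insert_rev[OF _ mm F_meas]) simp
  also have "\<dots> \<le> (\<integral>\<^sup>+b. indicator {0<..} b * ennreal (exp (- l * (sqrt 2 * b)) * sqrt (pi * (sqrt 2 * b) / l) ^ m)
      * cone_integral m l \<partial>lborel)"
  proof (rule nn_integral_mono_AE)
    \<comment> \<open>At pivot 0 the test \<open>psd_rec\<close> ends with success while the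
      right-hand side vanishes, so this single value is discarded as a null set.\<close>
    have "AE b in lborel. b \<noteq> (0::real)" by (rule AE_lborel_singleton)
    then show "AE b in lborel. (\<integral>\<^sup>+x. F (x((m, m) := b)) \<partial>lborel_on (tri_col m))
      \<le> indicator {0<..} b * ennreal (exp (- l * (sqrt 2 * b)) * sqrt (pi * (sqrt 2 * b) / l) ^ m) * cone_integral m l"
    proof eventually_elim
      case (elim b)
      show ?case
      proof (cases "b > 0")
        case True
        have "(\<integral>\<^sup>+x. F (x((m, m) := b)) \<partial>lborel_on (tri_col m))
            = (\<integral>\<^sup>+x. ennreal (exp (- l * (sqrt 2 * b))) * cone_integral m l *
                (\<Prod>p\<in>tri_col m. ennreal (exp (- (l / (sqrt 2 * b)) * (x p)\<^sup>2))) \<partial>lborel_on (tri_col m))"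
          using True mm by (intro nn_integral_cong) (auto simp: inner mult_ac intro!: prod.cong arg_cong2[where f="(*)"])
        also have "\<dots> = ennreal (exp (- l * (sqrt 2 * b))) * cone_integral m l *
            (\<integral>\<^sup>+x. (\<Prod>p\<in>tri_col m. ennreal (exp (- (l / (sqrt 2 * b)) * (x p)\<^sup>2))) \<partial>lborel_on (tri_col m))"
          by (rule nn_integral_cmult) measurable
        also have "(\<integral>\<^sup>+x. (\<Prod>p\<in>tri_col m. ennreal (exp (- (l / (sqrt 2 * b)) * (x p)\<^sup>2))) \<partial>lborel_on (tri_col m))
            = (\<Prod>p\<in>tri_col m. \<integral>\<^sup>+y. ennreal (exp (- (l / (sqrt 2 * b)) * y\<^sup>2)) \<partial>lborel)"
          by (rule lborel_prod.product_nn_integral_prod) auto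
        also have "\<dots> = ennreal (sqrt (pi * (sqrt 2 * b) / l)) ^ m"
          using nn_integral_gauss[of "l / (sqrt 2 * b)"] True l by (simp add: card_tri_col)
        also have "ennreal (exp (- l * (sqrt 2 * b))) * cone_integral m l * ennreal (sqrt (pi * (sqrt 2 * b) / l)) ^ m
            = indicator {0<..} b * ennreal (exp (- l * (sqrt 2 * b)) * sqrt (pi * (sqrt 2 * b) / l) ^ m) * cone_integral m l"
          using True l by (simp add: ennreal_mult ennreal_power mult_ac)
        finally show ?thesis by (rule eq_refl)
      next
        case False
        then have "b < 0" using elim by simp
        then show ?thesis by (simp add: neg)
      qed
    qed
  qed
  also have "\<dots> = (\<integral>\<^sup>+b. indicator {0<..} b * ennreal (exp (- l * (sqrt 2 * b)) * sqrt (pi * (sqrt 2 * b) / l) ^ m) \<partial>lborel)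
      * cone_integral m l"
    by (rule nn_integral_multc) measurable
  finally show ?thesis .
qed


text \<open>A bound for a gamma integral. The part \<open>exp (- (l - 1) * u)\<close> of the decay
  pays for the maximum of the power of \<open>u\<close>, and the remaining \<open>exp (- u)\<close>
  keeps the integral at most 1; this uses \<open>l > 1\<close>.\<close>

lemma pivot_integral_le:
  assumes l: "l > 1"
  shows "(\<integral>\<^sup>+b. indicator {0<..} b * ennreal (exp (- l * (sqrt 2 * b)) * sqrt (pi * (sqrt 2 * b) / l) ^ k) \<partial>lborel)
    \<le> ennreal (sqrt (pi * real k / (2 * exp 1 * l * (l - 1))) ^ k)"
proof -
  \<comment> \<open>The maximum over \<open>u > 0\<close> of
    \<open>sqrt (pi * u / l) * exp (- (l - 1) * u / k)\<close>, attained at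
    \<open>u = k / (2 * (l - 1))\<close>.\<close>
  define D where "D = sqrt (pi * real k / (2 * exp 1 * l * (l - 1)))"
  have D: "D \<ge> 0" using l by (simp add: D_def)
  have pointwise: "exp (- l * u) * sqrt (pi * u / l) ^ k \<le> D ^ k * exp (- u)" if u: "u > 0" for u
  proof (cases "k = 0")
    case True
    then show ?thesis using l u by simp
  next
    case False
    \<comment> \<open>Normalises \<open>u\<close> so that the maximum lies at \<open>y = 1\<close>,
      where \<open>y \<le> exp (y - 1)\<close> is an equality.\<close>
    define y where "y = 2 * (l - 1) * u / k"
    have y: "y \<le> exp (y - 1)" using exp_ge_add_one_self[of "y - 1"] by simp
    have "pi * u / l = pi * real k / (2 * l * (l - 1)) * y"
      using False l by (simp add: y_def field_simps)
    also have "\<dots> \<le> pi * real k / (2 * l * (l - 1)) * exp (y - 1)"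
      using l by (intro mult_left_mono y) simp
    also have "\<dots> = pi * real k / (2 * exp 1 * l * (l - 1)) * (exp (y / 2))\<^sup>2"
      by (simp add: exp_diff power2_eq_square field_simps flip: exp_add)
    finally have "sqrt (pi * u / l) \<le> D * exp (y / 2)"
      unfolding D_def using l by (metis abs_exp_cancel real_sqrt_abs real_sqrt_le_mono real_sqrt_mult)
    then have "sqrt (pi * u / l) ^ k \<le> (D * exp (y / 2)) ^ k"
      using l u by (intro power_mono) auto
    also have "\<dots> = D ^ k * exp ((l - 1) * u)"
      using False by (simp add: power_mult_distrib y_def flip: exp_of_nat_mult)
    finally have "exp (- l * u) * sqrt (pi * u / l) ^ k \<le> exp (- l * u) * (D ^ k * exp ((l - 1) * u))"
      by (intro mult_left_mono) auto
    also have "\<dots> = D ^ k * exp (- u)"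
      by (simp add: algebra_simps flip: exp_add)
    finally show ?thesis .
  qed
  have "(\<integral>\<^sup>+b. indicator {0<..} b * ennreal (exp (- l * (sqrt 2 * b)) * sqrt (pi * (sqrt 2 * b) / l) ^ k) \<partial>lborel)
      \<le> (\<integral>\<^sup>+b. ennreal (D ^ k) * (ennreal (exponential_density 1 b) * indicator {0..} b) \<partial>lborel)"
  proof (rule nn_integral_mono)
    fix b :: real
    show "indicator {0<..} b * ennreal (exp (- l * (sqrt 2 * b)) * sqrt (pi * (sqrt 2 * b) / l) ^ k)
        \<le> ennreal (D ^ k) * (ennreal (exponential_density 1 b) * indicator {0..} b)"
    proof (cases "b > 0")
      case True
      have "exp (- l * (sqrt 2 * b)) * sqrt (pi * (sqrt 2 * b) / l) ^ k \<le> D ^ k * exp (- (sqrt 2 * b))"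
        using True by (intro pointwise) simp
      also have "\<dots> \<le> D ^ k * exp (- b)"
        using True D by (intro mult_left_mono) (auto simp: mult_le_cancel_right1)
      finally show ?thesis
        using True D by (simp add: exponential_density_def flip: ennreal_mult)
    qed simp
  qed
  also have "\<dots> = ennreal (D ^ k) * (\<integral>\<^sup>+b. ennreal (exponential_density 1 b) * indicator {0..} b \<partial>lborel)"
    by (rule nn_integral_cmult) measurable
  also have "\<dots> \<le> ennreal (D ^ k) * 1"
  proof (rule mult_left_mono)
    interpret E: prob_space "density lborel (\<lambda>b. ennreal (exponential_density 1 b))"
      by (rule prob_space_exponential_density) simp
    have "(\<integral>\<^sup>+b. ennreal (exponential_density 1 b) * indicator {0..} b \<partial>lborel)
        = emeasure (density lborel (\<lambda>b. ennreal (exponential_density 1 b))) {0..}"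
      by (subst emeasure_density) auto
    also have "\<dots> \<le> 1" by (rule E.emeasure_le_1)
    finally show "(\<integral>\<^sup>+b. ennreal (exponential_density 1 b) * indicator {0..} b \<partial>lborel) \<le> 1" .
  qed simp
  finally show ?thesis by (simp add: D_def)
qed

text \<open>Each new row contributes one pivot integral. The relation between \<open>l\<close> and
  \<open>m\<close> makes the normalised factor \<open>D / sqrt (2 * pi)\<close> equal to
  \<open>sqrt (k / (exp 1 * m))\<close>, and \<open>x \<le> exp (x - 1)\<close> at
  \<open>x = k / m\<close> turns its \<open>k\<close>-th power into the exponential of a polynomial
  in \<open>k\<close>.\<close>

lemma normalised_cone_integral_le:
  assumes m: "m > 0" and l: "l > 1" "4 * l * (l - 1) = real m"
  shows "ennreal ((1 / sqrt (2 * pi)) ^ card (tri k)) * cone_integral k l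
    \<le> ennreal (exp (\<Sum>j<k. real j * (real j / real m - 2) / 2))"
proof (induction k)
  case 0
  have "tri 0 = {}" by (auto simp: tri_def)
  then have "cone_integral 0 l = 1"
    unfolding cone_integral_def by (simp add: lborel_prod.nn_integral_empty PiM_empty)
  then show ?case using \<open>tri 0 = {}\<close> by simp
next
  case (Suc k)
  let ?c = "1 / sqrt (2 * pi)"
  define D where "D = sqrt (pi * real k / (2 * exp 1 * l * (l - 1)))"
  have D: "D \<ge> 0" using l by (simp add: D_def)
  have c: "0 \<le> ?c" "?c \<le> 1" using pi_ge_two by auto
  have step: "?c ^ (k + 1) * D ^ k \<le> exp (real k * (real k / real m - 2) / 2)"
  proof -
    have "real k / m \<le> exp (real k / m - 1)" using exp_ge_add_one_self[of "real k / m - 1"] by simp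
    then have "real k / m / exp 1 \<le> exp (real k / m - 1) / exp 1" by (intro divide_right_mono) auto
    also have "\<dots> = exp (real k / m - 2)" by (simp flip: exp_diff)
    finally have 1: "real k / (exp 1 * m) \<le> exp (real k / m - 2)" by (simp add: mult.commute)
    have "?c * D = sqrt (real k / (exp 1 * m))"
      using l(1) unfolding D_def l(2)[symmetric] by (simp add: real_sqrt_divide[symmetric] real_sqrt_mult[symmetric] field_simps)
    also have "\<dots> \<le> sqrt ((exp ((real k / m - 2) / 2))\<^sup>2)"
      using 1 by (intro real_sqrt_le_mono) (simp add: power2_eq_square flip: exp_add)
    finally have 2: "?c * D \<le> exp ((real k / m - 2) / 2)" by simp
    \<comment> \<open>Row \<open>k\<close> brings \<open>k + 1\<close> normalising factors but only
      \<open>k\<close> Gaussian integrals; the one left over belongs to the diagonal entry and is at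
      most 1.\<close>
    have "?c ^ (k + 1) * D ^ k = ?c * (?c * D) ^ k" by (simp only: power_mult_distrib power_add power_one_right mult_ac)
    also have "\<dots> \<le> 1 * exp ((real k / m - 2) / 2) ^ k"
      using 2 c D by (intro mult_mono power_mono) auto
    finally show ?thesis by (simp flip: exp_of_nat_mult)
  qed
  have "cone_integral (Suc k) l \<le> ennreal (D ^ k) * cone_integral k l"
    unfolding D_def using l(1)
    by (intro order_trans[OF cone_integral_Suc mult_right_mono[OF pivot_integral_le]]) auto
  then have "ennreal (?c ^ card (tri (Suc k))) * cone_integral (Suc k) l
      \<le> ennreal (?c ^ card (tri (Suc k))) * (ennreal (D ^ k) * cone_integral k l)"
    by (rule mult_left_mono) simp
  also have "\<dots> = ennreal (?c ^ (k + 1) * D ^ k) * (ennreal (?c ^ card (tri k)) * cone_integral k l)"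
  proof -
    have "?c ^ card (tri (Suc k)) = ?c ^ (k + 1) * ?c ^ card (tri k)"
      by (simp add: card_tri_Suc power_add mult_ac)
    then have "ennreal (?c ^ card (tri (Suc k))) = ennreal (?c ^ (k + 1)) * ennreal (?c ^ card (tri k))"
      using c by (simp only: ennreal_mult zero_le_power)
    moreover have "ennreal (?c ^ (k + 1) * D ^ k) = ennreal (?c ^ (k + 1)) * ennreal (D ^ k)"
      using c D by (simp only: ennreal_mult zero_le_power)
    ultimately show ?thesis by (simp only: mult_ac)
  qed
  also have "\<dots> \<le> ennreal (exp (real k * (real k / real m - 2) / 2))
      * ennreal (exp (\<Sum>j<k. real j * (real j / real m - 2) / 2))"
    using step by (intro mult_mono Suc.IH ennreal_leI) auto
  also have "\<dots> = ennreal (exp (\<Sum>j<Suc k. real j * (real j / real m - 2) / 2))"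
    by (simp add: exp_add mult.commute flip: ennreal_mult)
  finally show ?case .
qed

text \<open>The diagonal entries are linearised by completing the square,
  \<open>g\<^sup>2 / 2 \<ge> sqrt 2 * l * g - l\<^sup>2\<close>; the choice of \<open>l\<close> is nearly optimal.\<close>

lemma goe_psd_prob:
  "(\<integral>\<^sup>+g. indicator {g. psd_rec m (\<lambda>i j. goe_mat g i j + (if i = j then 1 else 0))} g \<partial>std_gauss (tri m))
    \<le> ennreal (exp (- (real m)\<^sup>2 / 12 + 3 * real m / 2 + real m * sqrt (1 + real m)))"
proof (cases "m = 0")
  case True
  interpret prob_space "std_gauss (tri 0)"
    by (intro prob_space_PiM prob_space_std_normal)
  have "(\<integral>\<^sup>+g. indicator {g. psd_rec 0 (\<lambda>i j. goe_mat g i j + (if i = j then 1 else 0))} g \<partial>std_gauss (tri 0))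
      \<le> (\<integral>\<^sup>+g. 1 \<partial>std_gauss (tri 0))"
    by (intro nn_integral_mono) (simp add: indicator_def)
  also have "\<dots> = 1" using emeasure_space_1 by simp
  finally show ?thesis using True by simp
next
  case False
  \<comment> \<open>The positive root of \<open>4 * l * (l - 1) = real m\<close>.\<close>
  define l where "l = (1 + sqrt (1 + real m)) / 2"
  have l: "l > 1" "4 * l * (l - 1) = real m" "l\<^sup>2 = l + real m / 4"
  proof -
    have "sqrt (1 + real m) > sqrt 1" using False by (intro real_sqrt_less_mono) simp
    then show "l > 1" by (simp add: l_def)
    show "4 * l * (l - 1) = real m" by (simp add: l_def field_simps power2_eq_square[symmetric])
    then show "l\<^sup>2 = l + real m / 4" by (simp add: power2_eq_square algebra_simps)
  qed
  let ?c = "1 / sqrt (2 * pi)"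
  let ?P = "\<lambda>g. indicator {g. psd_rec m (\<lambda>i j. goe_mat g i j + (if i = j then 1 else 0))} g :: ennreal"
  let ?K = "\<lambda>g. indicator {g. psd_rec m (goe_mat g)} g * ennreal (exp (- l * (\<Sum>i<m. sqrt 2 * g (i, i))))"
  \<comment> \<open>Shifting each diagonal coordinate by \<open>1 / sqrt 2\<close> adds the identity
    to \<open>goe_mat\<close>.\<close>
  define t where "t = (\<lambda>(i, j). if i = (j :: nat) then 1 / sqrt 2 else 0 :: real)" 
  have t_diag: "sqrt 2 * t (i, i) = 1" and t_off: "i \<noteq> j \<Longrightarrow> t (i, j) = 0" for i j
    by (simp_all add: t_def)
  have diag: "(i, i) \<in> tri m" if "i < m" for i using that by (simp add: tri_def)
  have P_meas: "?P \<in> borel_measurable (lborel_on (tri m))"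
  proof -
    have [measurable]: "Measurable.pred (lborel_on (tri m)) (\<lambda>g. psd_rec m (\<lambda>i j. goe_mat g i j + (if i = j then 1 else 0)))"
      by (intro measurable_psd_rec borel_measurable_add goe_mat_measurable measurable_const) auto
    show ?thesis by (simp add: indicator_def)
  qed
  \<comment> \<open>The Gaussian decay of the off-diagonal entries is given up, since the cone and
    the trace weight already make the integral finite. The summand \<open>l\<close> in
    \<open>l\<^sup>2 + l\<close> offsets the increase by \<open>m\<close> of the shifted
    trace.\<close>
  have dens: "(\<Prod>p\<in>tri m. std_normal_density (g p))
      \<le> ?c ^ card (tri m) * exp (real m * (l\<^sup>2 + l)) * exp (- l * (\<Sum>i<m. sqrt 2 * (t (i, i) + g (i, i))))" for g
  proof -
    have "(\<Sum>i<m. (g (i, i))\<^sup>2) \<le> (\<Sum>p\<in>tri m. (g p)\<^sup>2)"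
    proof -
      have "(\<Sum>i<m. (g (i, i))\<^sup>2) = (\<Sum>p\<in>(\<lambda>i. (i, i)) ` {..<m}. (g p)\<^sup>2)"
        by (subst sum.reindex) (auto simp: inj_on_def)
      also have "\<dots> \<le> (\<Sum>p\<in>tri m. (g p)\<^sup>2)"
        using diag by (intro sum_mono2) auto
      finally show ?thesis .
    qed
    moreover have "(\<Sum>i<m. 2 * sqrt 2 * l * g (i, i) - 2 * l\<^sup>2) \<le> (\<Sum>i<m. (g (i, i))\<^sup>2)"
    proof (rule sum_mono)
      fix i
      have "0 \<le> (g (i, i) - sqrt 2 * l)\<^sup>2" by simp
      then show "2 * sqrt 2 * l * g (i, i) - 2 * l\<^sup>2 \<le> (g (i, i))\<^sup>2"
        by (simp add: power2_eq_square algebra_simps)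
    qed
    ultimately have "- (\<Sum>p\<in>tri m. (g p)\<^sup>2) / 2 \<le> - (\<Sum>i<m. 2 * sqrt 2 * l * g (i, i) - 2 * l\<^sup>2) / 2"
      by simp
    also have "\<dots> = real m * (l\<^sup>2 + l) + (- l * (\<Sum>i<m. sqrt 2 * (t (i, i) + g (i, i))))"
      by (simp add: distrib_left t_diag sum.distrib sum_subtractf algebra_simps flip: sum_distrib_left sum_distrib_right) (simp add: field_simps)
    finally have "exp (- (\<Sum>p\<in>tri m. (g p)\<^sup>2) / 2)
        \<le> exp (real m * (l\<^sup>2 + l)) * exp (- l * (\<Sum>i<m. sqrt 2 * (t (i, i) + g (i, i))))"
      by (simp flip: exp_add)
    then show ?thesis
      unfolding prod_std_normal_density[OF finite_tri] mult.assoc by (rule mult_left_mono) simp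
  qed
  have "(\<integral>\<^sup>+g. ?P g \<partial>std_gauss (tri m))
      = (\<integral>\<^sup>+g. ennreal (\<Prod>p\<in>tri m. std_normal_density (g p)) * ?P g \<partial>lborel_on (tri m))"
    unfolding PiM_std_normal_eq_density[OF finite_tri]
    by (rule nn_integral_density) (use P_meas in auto)
  also have "\<dots> \<le> (\<integral>\<^sup>+g. ennreal (?c ^ card (tri m) * exp (real m * (l\<^sup>2 + l))) * ?K (\<lambda>p\<in>tri m. t p + g p) \<partial>lborel_on (tri m))"
  proof (rule nn_integral_mono)
    fix g :: "nat \<times> nat \<Rightarrow> real"
    let ?g = "\<lambda>p\<in>tri m. t p + g p"
    have "goe_mat ?g i j = goe_mat g i j + (if i = j then 1 else 0)" if "i < m" "j < m" for i j
    proof (cases "i = j")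
      case True
      then show ?thesis using that diag by (simp add: goe_mat_def distrib_left t_diag)
    next
      case False
      then have "(min i j, max i j) \<in> tri m" "min i j \<noteq> max i j"
        using that by (auto simp: tri_def min_def max_def)
      then show ?thesis using False by (simp add: goe_mat_def t_off)
    qed
    then have psd: "psd_rec m (goe_mat ?g) = psd_rec m (\<lambda>i j. goe_mat g i j + (if i = j then 1 else 0))"
      by (rule psd_rec_cong)
    have tr: "(\<Sum>i<m. sqrt 2 * ?g (i, i)) = (\<Sum>i<m. sqrt 2 * (t (i, i) + g (i, i)))"
      using diag by (intro sum.cong) auto
    show "ennreal (\<Prod>p\<in>tri m. std_normal_density (g p)) * ?P g
        \<le> ennreal (?c ^ card (tri m) * exp (real m * (l\<^sup>2 + l))) * ?K ?g"
      unfolding tr using dens[of g] psd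
      by (auto simp: indicator_def intro!: ennreal_leI simp flip: ennreal_mult)
  qed
  also have "\<dots> = (\<integral>\<^sup>+g. ennreal (?c ^ card (tri m) * exp (real m * (l\<^sup>2 + l))) * ?K g \<partial>lborel_on (tri m))"
    by (rule nn_integral_PiM_lborel_translate[OF finite_tri]) measurable
  also have "\<dots> = ennreal (?c ^ card (tri m) * exp (real m * (l\<^sup>2 + l))) * cone_integral m l"
    unfolding cone_integral_def by (rule nn_integral_cmult) measurable
  also have "\<dots> = ennreal (exp (real m * (l\<^sup>2 + l))) * (ennreal (?c ^ card (tri m)) * cone_integral m l)"
    by (subst ennreal_mult) (auto simp: mult_ac)
  also have "\<dots> \<le> ennreal (exp (real m * (l\<^sup>2 + l))) * ennreal (exp (\<Sum>j<m. real j * (real j / real m - 2) / 2))"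
    using False l by (intro mult_left_mono normalised_cone_integral_le) auto
  also have "\<dots> = ennreal (exp (real m * (l\<^sup>2 + l) + (\<Sum>j<m. real j * (real j / real m - 2) / 2)))"
    by (simp add: exp_add ennreal_mult)
  also have "\<dots> \<le> ennreal (exp (- (real m)\<^sup>2 / 12 + 3 * real m / 2 + real m * sqrt (1 + real m)))"
  proof -
    have sum1: "(\<Sum>j<m. real j) = real m * (real m - 1) / 2"
      by (induction m) (auto simp: field_simps)
    have sum2: "(\<Sum>j<m. (real j)\<^sup>2) \<le> real m ^ 3 / 3"
    proof (induction m)
      case (Suc m)
      have "real m ^ 3 / 3 + (real m)\<^sup>2 \<le> real (Suc m) ^ 3 / 3"
        by (simp add: power3_eq_cube power2_eq_square field_simps)
      then show ?case using Suc by simp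
    qed simp
    have "(\<Sum>j<m. real j * (real j / real m - 2) / 2) = (\<Sum>j<m. (real j)\<^sup>2) / (2 * real m) - (\<Sum>j<m. real j)"
      using False by (simp add: sum_divide_distrib sum_subtractf[symmetric] power2_eq_square field_simps)
    also have "\<dots> \<le> real m ^ 3 / 3 / (2 * real m) - real m * (real m - 1) / 2"
      unfolding sum1 by (intro diff_right_mono divide_right_mono sum2) simp
    also have "\<dots> = - (real m)\<^sup>2 / 3 + real m / 2"
      using False by (simp add: power3_eq_cube power2_eq_square field_simps)
    finally have "real m * (l\<^sup>2 + l) + (\<Sum>j<m. real j * (real j / real m - 2) / 2)
        \<le> real m * (real m / 4 + 2 * l) - (real m)\<^sup>2 / 3 + real m / 2"
      unfolding l(3) by (simp add: distrib_left)
    \<comment> \<open>The leading coefficient is 1/4, from linearising the diagonal, minus 1/3, from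
      the pivots.\<close>
    also have "\<dots> = - (real m)\<^sup>2 / 12 + 3 * real m / 2 + real m * sqrt (1 + real m)"
      by (simp add: l_def power2_eq_square field_simps)
    finally show ?thesis by (simp add: ennreal_leI)
  qed
  finally show ?thesis .
qed

section \<open>The second jet of a polynomial\<close>

text \<open>The restriction to the line through \<open>z\<close> in direction \<open>w\<close>, as a
  polynomial in one variable. Its coefficients 1 and 2 are the directional derivative and half the
  second one, which replaces multivariate calculus by algebra.\<close>

definition line_poly :: "nat \<Rightarrow> nat \<Rightarrow> ((nat \<Rightarrow> nat) \<Rightarrow> real) \<Rightarrow> (nat \<Rightarrow> real) \<Rightarrow> (nat \<Rightarrow> real) \<Rightarrow> real poly" where
  "line_poly n d c z w = (\<Sum>\<alpha>\<in>multi_indices n d. smult (c \<alpha>) (\<Prod>i<n. [:z i, w i:] ^ \<alpha> i))"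

lemma poly_line_poly: "poly (line_poly n d c z w) t = poly_fun n d c (\<lambda>i. z i + t * w i)"
  by (simp add: line_poly_def poly_fun_def poly_sum poly_prod)

lemma poly_local_min_coeffs:
  fixes p :: "real poly"
  assumes ev: "eventually (\<lambda>t. poly p 0 \<le> poly p t) (at 0)"
  shows "coeff p 1 = 0" "coeff p 2 \<ge> 0"
proof -
  obtain e where e: "e > 0" "\<And>t. t \<noteq> 0 \<Longrightarrow> \<bar>t\<bar> < e \<Longrightarrow> poly p 0 \<le> poly p t"
    using ev by (auto simp: eventually_at dist_real_def)
  have "poly (pderiv p) 0 = 0"
  proof (rule DERIV_local_min[OF poly_DERIV e(1)])
    show "\<forall>y. \<bar>0 - y\<bar> < e \<longrightarrow> poly p 0 \<le> poly p y"
      using e(2) by (metis abs_minus_commute diff_zero order_refl)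
  qed
  then show c1: "coeff p 1 = 0"
    by (simp add: poly_0_coeff_0 coeff_pderiv)
  \<comment> \<open>With the linear term gone, \<open>p\<close> is a constant plus
    \<open>t\<^sup>2 * q\<close>; nonnegativity of \<open>q\<close> near 0 then passes to the
    limit.\<close>
  obtain a b q where p: "p = pCons a (pCons b q)"
    by (metis pCons_cases)
  have b: "b = 0" using c1 by (simp add: p)
  have "poly q t \<ge> 0" if "t \<noteq> 0" "\<bar>t\<bar> < e" for t
  proof -
    have "0 \<le> t * (t * poly q t)" using e(2)[OF that] by (simp add: p b)
    then show ?thesis using that(1)
      by (metis mult.assoc mult_pos_neg not_le not_square_less_zero mult_eq_0_iff linorder_neqE_linordered_idom)
  qed
  then have "eventually (\<lambda>t. 0 \<le> poly q t) (at 0)"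
    using e(1) by (auto simp: eventually_at dist_real_def intro!: exI[of _ e])
  moreover have "((\<lambda>t. poly q t) \<longlongrightarrow> poly q 0) (at 0)"
    using isCont_def poly_isCont by blast
  ultimately have "0 \<le> poly q 0"
    by (intro tendsto_lowerbound) auto
  then show "coeff p 2 \<ge> 0"
    by (simp add: p poly_0_coeff_0 numeral_2_eq_2)
qed

text \<open>Coefficientwise domination by \<open>(D + K * t) ^ N\<close>. For \<open>k > N\<close>
  the binomial coefficient vanishes, so the truncated \<open>N - k\<close> does no harm.\<close>

definition coeffs_le :: "real \<Rightarrow> real \<Rightarrow> nat \<Rightarrow> real poly \<Rightarrow> bool" where
  "coeffs_le D K N p \<longleftrightarrow> (\<forall>k. \<bar>coeff p k\<bar> \<le> real (N choose k) * D ^ (N - k) * K ^ k)"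

lemma coeffs_le_linear_mult:
  assumes p: "coeffs_le D K N p" and a: "\<bar>a\<bar> \<le> D" and b: "\<bar>b\<bar> \<le> K"
  shows "coeffs_le D K (Suc N) ([:a, b:] * p)"
  unfolding coeffs_le_def
proof
  fix k
  have D: "D \<ge> 0" and K: "K \<ge> 0" using a b by auto
  have pk: "\<bar>coeff p k\<bar> \<le> real (N choose k) * D ^ (N - k) * K ^ k" for k
    using p by (simp add: coeffs_le_def)
  show "\<bar>coeff ([:a, b:] * p) k\<bar> \<le> real (Suc N choose k) * D ^ (Suc N - k) * K ^ k"
  proof (cases k)
    case 0
    have "\<bar>a * coeff p 0\<bar> \<le> D * (real (N choose 0) * D ^ (N - 0) * K ^ 0)"
      unfolding abs_mult using D by (intro mult_mono a pk) auto
    then show ?thesis using 0 by simp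
  next
    case (Suc j)
    have "\<bar>a * coeff p (Suc j)\<bar> \<le> D * (real (N choose Suc j) * D ^ (N - Suc j) * K ^ Suc j)"
      unfolding abs_mult using D by (intro mult_mono a pk) auto
    also have "\<dots> = real (N choose Suc j) * D ^ (N - j) * K ^ Suc j"
    proof (cases "Suc j \<le> N")
      case True
      then have "N - j = Suc (N - Suc j)" by simp
      then show ?thesis by simp
    qed simp
    finally have 1: "\<bar>a * coeff p (Suc j)\<bar> \<le> real (N choose Suc j) * D ^ (N - j) * K ^ Suc j" .
    have "\<bar>b * coeff p j\<bar> \<le> K * (real (N choose j) * D ^ (N - j) * K ^ j)"
      unfolding abs_mult using K by (intro mult_mono b pk) auto
    then have 2: "\<bar>b * coeff p j\<bar> \<le> real (N choose j) * D ^ (N - j) * K ^ Suc j"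
      by (simp add: mult_ac)
    have "coeff ([:a, b:] * p) k = a * coeff p (Suc j) + b * coeff p j"
      using Suc by simp
    then have "\<bar>coeff ([:a, b:] * p) k\<bar> \<le> \<bar>a * coeff p (Suc j)\<bar> + \<bar>b * coeff p j\<bar>"
      by simp
    also have "\<dots> \<le> real (Suc N choose k) * D ^ (Suc N - k) * K ^ k"
      using 1 2 Suc by (simp add: algebra_simps)
    finally show ?thesis .
  qed
qed

lemma coeffs_le_monomial:
  fixes z w :: "nat \<Rightarrow> real"
  assumes "\<And>i. i < n \<Longrightarrow> \<bar>z i\<bar> \<le> D" "\<And>i. i < n \<Longrightarrow> \<bar>w i\<bar> \<le> K"
  shows "coeffs_le D K (\<Sum>i<n. \<alpha> i) (\<Prod>i<n. [:z i, w i:] ^ \<alpha> i)"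
  using assms
proof (induction n)
  case 0
  then show ?case by (simp add: coeffs_le_def binomial_eq_0)
next
  case (Suc n)
  have "coeffs_le D K (k + (\<Sum>i<n. \<alpha> i)) ([:z n, w n:] ^ k * (\<Prod>i<n. [:z i, w i:] ^ \<alpha> i))" for k
  proof (induction k)
    case 0
    then show ?case using Suc by simp
  next
    case (Suc k)
    then have "coeffs_le D K (Suc (k + (\<Sum>i<n. \<alpha> i))) ([:z n, w n:] * ([:z n, w n:] ^ k * (\<Prod>i<n. [:z i, w i:] ^ \<alpha> i)))"
      by (rule coeffs_le_linear_mult) (use \<open>\<And>i. i < Suc n \<Longrightarrow> \<bar>z i\<bar> \<le> D\<close> \<open>\<And>i. i < Suc n \<Longrightarrow> \<bar>w i\<bar> \<le> K\<close> in auto)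
    then show ?case by (simp only: power_Suc mult.assoc add_Suc)
  qed
  from this[of "\<alpha> n"] show ?case by (simp add: mult.commute add.commute)
qed

text \<open>The pair \<open>(i, k)\<close> stands for the quadratic monomial \<open>y\<^sub>i y\<^sub>k\<close> in the homogeneous coordinates
  \<open>y\<^sub>0 = 1\<close>, \<open>y\<^sub>l\<^sub>+\<^sub>1 = x\<^sub>l\<close>.\<close>

definition jet_index :: "nat \<times> nat \<Rightarrow> nat \<Rightarrow> nat" where
  "jet_index p = (\<lambda>l. (if fst p = Suc l then 1 else 0) + (if snd p = Suc l then 1 else 0))"

lemma sum_jet_index:
  assumes "p \<in> tri (Suc n)"
  shows "(\<Sum>l<n. jet_index p l) = (if fst p = 0 then 0 else 1) + (if snd p = 0 then 0 else 1)"
proof -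
  have "(\<Sum>l<n. if i = Suc l then 1 else 0) = (if i = 0 then 0 else 1 :: nat)" if "i \<le> n" for i
    using that by (cases i) auto
  then show ?thesis
    using assms by (auto simp: jet_index_def sum.distrib tri_def)
qed

lemma inj_jet_index: "inj_on jet_index (tri (Suc n))"
proof (rule inj_onI)
  fix p q assume pq: "p \<in> tri (Suc n)" "q \<in> tri (Suc n)" "jet_index p = jet_index q"
  obtain i k where p: "p = (i, k)" by (cases p)
  obtain i' k' where q: "q = (i', k')" by (cases q)
  have le: "i \<le> k" "i' \<le> k'" "k \<le> n" "k' \<le> n" using pq by (auto simp: p q tri_def)
  have s: "(if i = 0 then 0 else 1) + (if k = 0 then 0 else 1 :: nat) = (if i' = 0 then 0 else 1) + (if k' = 0 then 0 else 1)"
    using sum_jet_index[OF pq(1)] sum_jet_index[OF pq(2)] pq(3) by (simp add: p q)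
  have eq: "(if i = Suc l then 1 else 0) + (if k = Suc l then 1 else 0 :: nat)
      = (if i' = Suc l then 1 else 0) + (if k' = Suc l then 1 else 0)" for l
    using fun_cong[OF pq(3), of l] by (simp add: jet_index_def p q)
  show "p = q"
  proof (cases "k = 0")
    case True
    then show ?thesis using s le by (auto simp: p q split: if_splits)
  next
    case False
    then obtain l where l: "k = Suc l" by (cases k) auto
    have k': "k' \<noteq> 0" using s l le by (auto split: if_splits)
    then obtain l' where l': "k' = Suc l'" by (cases k') auto
    show ?thesis
    proof (cases "i = 0")
      case True
      then show ?thesis using s k' eq[of l] by (auto simp: p q l split: if_splits)
    next
      case False
      then obtain a where a: "i = Suc a" by (cases i) auto
      have "i' \<noteq> 0" using s False l k' le by (auto split: if_splits)
      then obtain a' where a': "i' = Suc a'" by (cases i') auto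
      have "l \<le> l'" using eq[of l] le by (simp add: l l' a a' split: if_splits)
      moreover have "l' \<le> l" using eq[of l'] le by (simp add: l l' a a' split: if_splits)
      ultimately have ll: "l = l'" by simp
      have "a = a'" using eq[of a] by (simp add: l l' a a' ll split: if_splits)
      then show ?thesis by (simp add: p q l l' a a' ll)
    qed
  qed
qed

lemma jet_index_image:
  assumes d: "d \<ge> 2"
  shows "jet_index ` tri (Suc n) = {\<alpha> \<in> multi_indices n d. (\<Sum>l<n. \<alpha> l) \<le> 2}"
proof (intro equalityI subsetI)
  fix \<alpha> assume "\<alpha> \<in> jet_index ` tri (Suc n)"
  then obtain p where p: "p \<in> tri (Suc n)" "\<alpha> = jet_index p" by blast
  have "(\<Sum>l<n. \<alpha> l) \<le> 2" using sum_jet_index[OF p(1)] p(2) by auto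
  then show "\<alpha> \<in> {\<alpha> \<in> multi_indices n d. (\<Sum>l<n. \<alpha> l) \<le> 2}"
    using p d by (auto simp: multi_indices_def jet_index_def tri_def)
next
  fix \<alpha> assume "\<alpha> \<in> {\<alpha> \<in> multi_indices n d. (\<Sum>l<n. \<alpha> l) \<le> 2}"
  then have \<alpha>: "\<And>l. l \<ge> n \<Longrightarrow> \<alpha> l = 0" "(\<Sum>l<n. \<alpha> l) \<le> 2"
    by (auto simp: multi_indices_def)
  \<comment> \<open>Peels one unit off a multi-index of positive weight; weight two is peeled
    twice.\<close>
  have pick: "\<exists>a<n. \<exists>\<gamma>. \<beta> = (\<lambda>l. (if a = l then 1 else 0) + \<gamma> l) \<and> (\<forall>l\<ge>n. \<gamma> l = 0) \<and> (\<Sum>l<n. \<gamma> l) = s"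
    if "\<And>l. l \<ge> n \<Longrightarrow> \<beta> l = 0" "(\<Sum>l<n. \<beta> l) = Suc s" for \<beta> :: "nat \<Rightarrow> nat" and s
  proof -
    have "\<exists>a<n. \<beta> a \<noteq> 0"
    proof (rule ccontr)
      assume "\<not> (\<exists>a<n. \<beta> a \<noteq> 0)"
      then have "(\<Sum>l<n. \<beta> l) = 0" by simp
      with that(2) show False by simp
    qed
    then obtain a where a: "a < n" "\<beta> a \<noteq> 0" by blast
    define \<gamma> where "\<gamma> = \<beta>(a := \<beta> a - 1)"
    have eq: "\<beta> = (\<lambda>l. (if a = l then 1 else 0) + \<gamma> l)" using a by (auto simp: \<gamma>_def)
    have "(\<Sum>l<n. \<beta> l) = 1 + (\<Sum>l<n. \<gamma> l)"
      using a by (subst eq) (simp add: sum.distrib)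
    then have sum: "(\<Sum>l<n. \<gamma> l) = s" using that(2) by simp
    have "\<forall>l\<ge>n. \<gamma> l = 0" using a(1) that(1) by (simp add: \<gamma>_def)
    then show ?thesis using eq a(1) sum by blast
  qed
  have zero: "\<gamma> = (\<lambda>_. 0)" if "\<forall>l\<ge>n. \<gamma> l = 0" "(\<Sum>l<n. \<gamma> l) = 0" for \<gamma> :: "nat \<Rightarrow> nat"
  proof
    fix l show "\<gamma> l = 0" using that by (cases "l < n") auto
  qed
  consider "(\<Sum>l<n. \<alpha> l) = 0" | "(\<Sum>l<n. \<alpha> l) = Suc 0" | "(\<Sum>l<n. \<alpha> l) = Suc (Suc 0)"
    using \<alpha>(2) by linarith
  then show "\<alpha> \<in> jet_index ` tri (Suc n)"
  proof cases
    case 1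
    then have "\<alpha> = jet_index (0, 0)" using zero[of \<alpha>] \<alpha>(1) by (auto simp: jet_index_def)
    then show ?thesis by (auto simp: tri_def)
  next
    case 2
    from pick[OF \<alpha>(1) 2] obtain a \<gamma> where a: "a < n" "\<alpha> = (\<lambda>l. (if a = l then 1 else 0) + \<gamma> l)"
      "\<forall>l\<ge>n. \<gamma> l = 0" "(\<Sum>l<n. \<gamma> l) = 0" by blast
    then have "\<alpha> = jet_index (0, Suc a)" using zero[of \<gamma>] by (auto simp: jet_index_def)
    then show ?thesis using a(1) by (auto simp: tri_def)
  next
    case 3
    from pick[OF \<alpha>(1) 3] obtain a \<gamma> where a: "a < n" "\<alpha> = (\<lambda>l. (if a = l then 1 else 0) + \<gamma> l)"
      "\<forall>l\<ge>n. \<gamma> l = 0" "(\<Sum>l<n. \<gamma> l) = Suc 0" by blast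
    have "\<And>l. l \<ge> n \<Longrightarrow> \<gamma> l = 0" using a(3) by blast
    from pick[OF this a(4)] obtain b \<eta> where b: "b < n" "\<gamma> = (\<lambda>l. (if b = l then 1 else 0) + \<eta> l)"
      "\<forall>l\<ge>n. \<eta> l = 0" "(\<Sum>l<n. \<eta> l) = 0" by blast
    then have "\<alpha> = jet_index (Suc (min a b), Suc (max a b))"
      using zero[of \<eta>] a(2) by (auto simp: jet_index_def fun_eq_iff min_def max_def)
    then show ?thesis using a(1) b(1) by (auto simp: tri_def)
  qed
qed

text \<open>Homogeneous coordinates, with \<open>a = 1\<close> for points of the chart and
  \<open>a = 0\<close> for directions.\<close>

definition hcoord :: "real \<Rightarrow> (nat \<Rightarrow> real) \<Rightarrow> nat \<Rightarrow> real" where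
  "hcoord a z i = (case i of 0 \<Rightarrow> a | Suc l \<Rightarrow> z l)"

lemma hcoord_simps [simp]: "hcoord a z 0 = a" "hcoord a z (Suc l) = z l"
  by (simp_all add: hcoord_def)

lemma monomial_jet_index:
  assumes "p \<in> tri (Suc n)"
  shows "(\<Prod>l<n. [:z l, w l:] ^ jet_index p l)
    = [:hcoord 1 z (fst p), hcoord 0 w (fst p):] * [:hcoord 1 z (snd p), hcoord 0 w (snd p):]"
proof -
  have "(\<Prod>l<n. [:z l, w l:] ^ (if i = Suc l then 1 else 0)) = [:hcoord 1 z i, hcoord 0 w i:]" if "i \<le> n" for i
  proof (cases i)
    case 0
    then show ?thesis by (simp flip: one_pCons)
  next
    case (Suc j)
    have "(\<Prod>l<n. [:z l, w l:] ^ (if i = Suc l then 1 else 0)) = (\<Prod>l<n. if l = j then [:z l, w l:] else 1)"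
      using Suc by (intro prod.cong) auto
    also have "\<dots> = [:z j, w j:]" using Suc that by simp
    finally show ?thesis using Suc by simp
  qed
  then show ?thesis
    using assms by (auto simp: jet_index_def power_add prod.distrib tri_def)
qed

text \<open>A monomial of degree \<open>N \<ge> 3\<close> is dominated by
  \<open>(D + K * t) ^ N\<close>, and since \<open>D \<le> 1\<close> the power of \<open>D\<close>
  is largest at \<open>N = 3\<close>. The quadratic part is kept exactly.\<close>

lemma coeff_line_poly_jet:
  assumes d: "d \<ge> 2" and D: "0 \<le> D" "D \<le> 1" and k: "k \<le> 2"
    and z: "\<And>i. i < n \<Longrightarrow> \<bar>z i\<bar> \<le> D" and w: "\<And>i. i < n \<Longrightarrow> \<bar>w i\<bar> \<le> K" and K: "K \<ge> 0"
    and M: "(\<Sum>\<alpha>\<in>multi_indices n d. \<bar>c \<alpha>\<bar>) \<le> M"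
  shows "\<bar>coeff (line_poly n d c z w) k - (\<Sum>p\<in>tri (Suc n). c (jet_index p) *
      coeff ([:hcoord 1 z (fst p), hcoord 0 w (fst p):] * [:hcoord 1 z (snd p), hcoord 0 w (snd p):]) k)\<bar>
    \<le> 2 ^ d * M * D ^ (3 - k) * K ^ k"
proof -
  let ?m = "\<lambda>\<alpha>. \<Prod>i<n. [:z i, w i:] ^ \<alpha> i"
  let ?J = "{\<alpha> \<in> multi_indices n d. (\<Sum>l<n. \<alpha> l) \<le> 2}"
  have "(\<Sum>p\<in>tri (Suc n). c (jet_index p) *
      coeff ([:hcoord 1 z (fst p), hcoord 0 w (fst p):] * [:hcoord 1 z (snd p), hcoord 0 w (snd p):]) k)
    = (\<Sum>p\<in>tri (Suc n). c (jet_index p) * coeff (?m (jet_index p)) k)"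
    by (intro sum.cong refl) (simp only: monomial_jet_index)
  also have "\<dots> = (\<Sum>\<alpha>\<in>?J. c \<alpha> * coeff (?m \<alpha>) k)"
    unfolding jet_index_image[OF d, symmetric] by (subst sum.reindex[OF inj_jet_index]) simp
  finally have jet: "(\<Sum>p\<in>tri (Suc n). c (jet_index p) *
      coeff ([:hcoord 1 z (fst p), hcoord 0 w (fst p):] * [:hcoord 1 z (snd p), hcoord 0 w (snd p):]) k)
    = (\<Sum>\<alpha>\<in>?J. c \<alpha> * coeff (?m \<alpha>) k)" .
  have "coeff (line_poly n d c z w) k = (\<Sum>\<alpha>\<in>multi_indices n d. c \<alpha> * coeff (?m \<alpha>) k)"
    by (simp add: line_poly_def coeff_sum)
  also have "\<dots> = (\<Sum>\<alpha>\<in>?J. c \<alpha> * coeff (?m \<alpha>) k) + (\<Sum>\<alpha>\<in>multi_indices n d - ?J. c \<alpha> * coeff (?m \<alpha>) k)"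
    by (subst sum.subset_diff[of ?J]) (auto simp: finite_multi_indices)
  finally have "\<bar>coeff (line_poly n d c z w) k - (\<Sum>\<alpha>\<in>?J. c \<alpha> * coeff (?m \<alpha>) k)\<bar>
      \<le> (\<Sum>\<alpha>\<in>multi_indices n d - ?J. \<bar>c \<alpha> * coeff (?m \<alpha>) k\<bar>)"
    by (simp add: sum_abs)
  also have "\<dots> \<le> (\<Sum>\<alpha>\<in>multi_indices n d - ?J. \<bar>c \<alpha>\<bar> * (2 ^ d * D ^ (3 - k) * K ^ k))"
  proof (rule sum_mono)
    fix \<alpha> assume \<alpha>: "\<alpha> \<in> multi_indices n d - ?J"
    define N where "N = (\<Sum>l<n. \<alpha> l)"
    have N: "3 \<le> N" "N \<le> d" using \<alpha> by (auto simp: N_def multi_indices_def)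
    have "coeffs_le D K N (?m \<alpha>)"
      unfolding N_def by (rule coeffs_le_monomial) (auto intro: z w)
    then have "\<bar>coeff (?m \<alpha>) k\<bar> \<le> real (N choose k) * D ^ (N - k) * K ^ k"
      by (simp add: coeffs_le_def)
    also have "\<dots> \<le> 2 ^ d * D ^ (3 - k) * K ^ k"
    proof (intro mult_right_mono mult_mono)
      have "N choose k \<le> 2 ^ N" by (rule binomial_le_pow2)
      also have "\<dots> \<le> (2 :: nat) ^ d" using N by (intro power_increasing) auto
      finally show "real (N choose k) \<le> 2 ^ d" by (metis of_nat_le_iff of_nat_numeral of_nat_power)
      show "D ^ (N - k) \<le> D ^ (3 - k)" using N D by (intro power_decreasing) auto
    qed (use D K in auto)
    finally show "\<bar>c \<alpha> * coeff (?m \<alpha>) k\<bar> \<le> \<bar>c \<alpha>\<bar> * (2 ^ d * D ^ (3 - k) * K ^ k)"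
      unfolding abs_mult by (rule mult_left_mono) simp
  qed
  also have "\<dots> \<le> (\<Sum>\<alpha>\<in>multi_indices n d. \<bar>c \<alpha>\<bar> * (2 ^ d * D ^ (3 - k) * K ^ k))"
    using D K by (intro sum_mono2) (auto simp: finite_multi_indices)
  also have "\<dots> \<le> M * (2 ^ d * D ^ (3 - k) * K ^ k)"
    unfolding sum_distrib_right[symmetric] using D K by (intro mult_right_mono M) auto
  finally show ?thesis unfolding jet by (simp add: mult_ac)
qed

lemma coeff_quadratic:
  "coeff ([:a, b:] * [:a', b':]) 0 = a * a'"
  "coeff ([:a, b:] * [:a', b':]) 1 = a * b' + b * a'"
  "coeff ([:a, b:] * [:a', b':]) 2 = b * (b' :: real)"
  by (simp_all add: numeral_2_eq_2)

text \<open>The indices of the value, of the gradient and of the Hessian in the jet.\<close>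

lemma tri_split:
  "tri (Suc n) = insert (0, 0) ((\<lambda>k. (0, Suc k)) ` {..<n} \<union> {p \<in> tri (Suc n). fst p > 0})"
proof (intro equalityI subsetI)
  fix p assume p: "p \<in> tri (Suc n)"
  obtain i k where "p = (i, k)" by (cases p)
  then show "p \<in> insert (0, 0) ((\<lambda>k. (0, Suc k)) ` {..<n} \<union> {p \<in> tri (Suc n). fst p > 0})"
    using p by (cases i; cases k) (auto simp: tri_def)
qed (auto simp: tri_def)

lemma sum_tri_split:
  fixes f :: "nat \<times> nat \<Rightarrow> real"
  shows "(\<Sum>p\<in>tri (Suc n). f p) = f (0, 0) + (\<Sum>k<n. f (0, Suc k)) + (\<Sum>p\<in>{p \<in> tri (Suc n). fst p > 0}. f p)"
proof -
  let ?A = "(\<lambda>k. (0, Suc k)) ` {..<n}" and ?B = "{p \<in> tri (Suc n). fst p > 0}"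
  have "(\<Sum>p\<in>tri (Suc n). f p) = f (0, 0) + (\<Sum>p\<in>?A \<union> ?B. f p)"
    by (subst tri_split, subst sum.insert) auto
  also have "(\<Sum>p\<in>?A \<union> ?B. f p) = (\<Sum>p\<in>?A. f p) + (\<Sum>p\<in>?B. f p)"
    by (rule sum.union_disjoint) auto
  also have "(\<Sum>p\<in>?A. f p) = (\<Sum>k<n. f (0, Suc k))"
    by (subst sum.reindex) (auto simp: inj_on_def)
  finally show ?thesis by simp
qed

text \<open>Only second-order entries occur, so the sum does not change when value or gradient
  entries are varied; this allows those entries to be integrated out first.\<close>

definition hess_sum :: "nat \<Rightarrow> (nat \<times> nat \<Rightarrow> real) \<Rightarrow> real" where
  "hess_sum n g = (\<Sum>p\<in>{p \<in> tri (Suc n). fst p > 0}. \<bar>g p\<bar>)"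

lemma hess_sum_nonneg: "hess_sum n g \<ge> 0"
  unfolding hess_sum_def by (rule sum_nonneg) simp

lemma hcoord_abs_le:
  assumes "\<And>l. l < n \<Longrightarrow> \<bar>z l\<bar> \<le> D" "0 < i" "i \<le> n"
  shows "\<bar>hcoord a z i\<bar> \<le> D"
  using assms by (cases i) auto

text \<open>Between 0 and \<open>z\<close> the gradient changes by the Hessian applied to
  \<open>z\<close>, the source of \<open>D * hess_sum\<close>, and by terms of degree at least
  three.\<close>

lemma gradient_jet:
  assumes d: "d \<ge> 2" and D: "0 \<le> D" "D \<le> 1" and j: "j < n"
    and z: "\<And>i. i < n \<Longrightarrow> \<bar>z i\<bar> \<le> D"
    and M: "(\<Sum>\<alpha>\<in>multi_indices n d. \<bar>c \<alpha>\<bar>) \<le> M"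
  shows "\<bar>coeff (line_poly n d c z (\<lambda>i. if i = j then 1 else 0)) 1 - c (jet_index (0, Suc j))\<bar>
    \<le> 2 * D * hess_sum n (\<lambda>p. c (jet_index p)) + 2 ^ d * M * D\<^sup>2"
proof -
  let ?w = "\<lambda>i. if i = j then 1 else 0 :: real"
  let ?q = "\<lambda>p. [:hcoord 1 z (fst p), hcoord 0 ?w (fst p):] * [:hcoord 1 z (snd p), hcoord 0 ?w (snd p):]"
  let ?B = "{p \<in> tri (Suc n). fst p > 0}"
  have "(\<Sum>k<n. c (jet_index (0, Suc k)) * coeff (?q (0, Suc k)) 1) = (\<Sum>k<n. if k = j then c (jet_index (0, Suc k)) else 0)"
    by (intro sum.cong) (auto simp: coeff_quadratic)
  also have "\<dots> = c (jet_index (0, Suc j))" using j by simp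
  finally have lin: "(\<Sum>k<n. c (jet_index (0, Suc k)) * coeff (?q (0, Suc k)) 1) = c (jet_index (0, Suc j))" .
  have "\<bar>\<Sum>p\<in>?B. c (jet_index p) * coeff (?q p) 1\<bar> \<le> (\<Sum>p\<in>?B. \<bar>c (jet_index p)\<bar> * (2 * D))"
  proof (rule order_trans[OF sum_abs sum_mono])
    fix p assume p: "p \<in> ?B"
    obtain i k where ik: "p = (i, k)" "0 < i" "i \<le> n" "0 < k" "k \<le> n"
      using p by (cases p) (auto simp: tri_def)
    have hz: "\<bar>hcoord 1 z i\<bar> \<le> D" "\<bar>hcoord 1 z k\<bar> \<le> D"
      using ik by (auto intro!: hcoord_abs_le[where n=n] z)
    have hw: "\<bar>hcoord 0 ?w i\<bar> \<le> 1" "\<bar>hcoord 0 ?w k\<bar> \<le> 1"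
      using ik by (auto intro!: hcoord_abs_le[where n=n])
    have "\<bar>hcoord 1 z i * hcoord 0 ?w k\<bar> \<le> D * 1" "\<bar>hcoord 0 ?w i * hcoord 1 z k\<bar> \<le> 1 * D"
      unfolding abs_mult using D hz hw by (intro mult_mono; simp)+
    then have "\<bar>hcoord 1 z i * hcoord 0 ?w k + hcoord 0 ?w i * hcoord 1 z k\<bar> \<le> D + D"
      by linarith
    then show "\<bar>c (jet_index p) * coeff (?q p) 1\<bar> \<le> \<bar>c (jet_index p)\<bar> * (2 * D)"
      unfolding abs_mult coeff_quadratic ik(1) fst_conv snd_conv by (intro mult_left_mono) auto
  qed
  then have hess: "\<bar>\<Sum>p\<in>?B. c (jet_index p) * coeff (?q p) 1\<bar> \<le> 2 * D * hess_sum n (\<lambda>p. c (jet_index p))"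
    by (simp add: hess_sum_def sum_distrib_left mult_ac)
  have "\<bar>coeff (line_poly n d c z ?w) 1 - (\<Sum>p\<in>tri (Suc n). c (jet_index p) * coeff (?q p) 1)\<bar>
      \<le> 2 ^ d * M * D ^ (3 - 1) * 1 ^ 1"
    by (rule coeff_line_poly_jet[OF d D _ z _ _ M]) auto
  moreover have "c (jet_index (0, 0)) * coeff (?q (0, 0)) 1 = 0"
    by (simp add: coeff_quadratic)
  moreover have "2 ^ d * M * D ^ (3 - 1) * 1 ^ 1 = 2 ^ d * M * D\<^sup>2"
    by simp
  ultimately show ?thesis
    using hess unfolding sum_tri_split lin by linarith
qed

text \<open>Only the \<open>z 0\<close> part of the linear term is kept. The other gradient entries
  are already known to be small at a minimum, while the radial one need not be.\<close>

lemma value_jet: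
  assumes d: "d \<ge> 2" and n: "n \<ge> 1" and D: "0 \<le> D" "D \<le> 1"
    and z: "\<And>i. i < n \<Longrightarrow> \<bar>z i\<bar> \<le> D"
    and M: "(\<Sum>\<alpha>\<in>multi_indices n d. \<bar>c \<alpha>\<bar>) \<le> M"
    and G: "\<And>k. 0 < k \<Longrightarrow> k < n \<Longrightarrow> \<bar>c (jet_index (0, Suc k))\<bar> \<le> G" "G \<ge> 0"
  shows "\<bar>coeff (line_poly n d c z w) 0 - (c (jet_index (0, 0)) + c (jet_index (0, Suc 0)) * z 0)\<bar>
    \<le> real n * G * D + D\<^sup>2 * hess_sum n (\<lambda>p. c (jet_index p)) + 2 ^ d * M * D ^ 3"
proof -
  have *: "coeff (line_poly n d c z w) 0 = coeff (line_poly n d c z (\<lambda>_. 0)) 0" for w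
    using poly_line_poly[of n d c z w 0] poly_line_poly[of n d c z "\<lambda>_. 0" 0]
    by (simp add: poly_0_coeff_0)
  let ?q = "\<lambda>p. [:hcoord 1 z (fst p), hcoord 0 (\<lambda>_. 0) (fst p):] * [:hcoord 1 z (snd p), hcoord 0 (\<lambda>_. 0) (snd p):]"
  let ?B = "{p \<in> tri (Suc n). fst p > 0}"
  have "(\<Sum>k<n. c (jet_index (0, Suc k)) * coeff (?q (0, Suc k)) 0) = (\<Sum>k<n. c (jet_index (0, Suc k)) * z k)"
    by (intro sum.cong) (auto simp: coeff_quadratic)
  also have "\<dots> = c (jet_index (0, Suc 0)) * z 0 + (\<Sum>k\<in>{..<n} - {0}. c (jet_index (0, Suc k)) * z k)"
    using n by (subst sum.remove[of _ 0]) auto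
  finally have lin: "(\<Sum>k<n. c (jet_index (0, Suc k)) * coeff (?q (0, Suc k)) 0)
      = c (jet_index (0, Suc 0)) * z 0 + (\<Sum>k\<in>{..<n} - {0}. c (jet_index (0, Suc k)) * z k)" .
  have "\<bar>\<Sum>k\<in>{..<n} - {0}. c (jet_index (0, Suc k)) * z k\<bar> \<le> (\<Sum>k\<in>{..<n} - {0}. G * D)"
    using z G D by (intro order_trans[OF sum_abs sum_mono]) (auto simp: abs_mult intro!: mult_mono)
  also have "\<dots> \<le> (\<Sum>k<n. G * D)"
    using G D by (intro sum_mono2) auto
  finally have rest: "\<bar>\<Sum>k\<in>{..<n} - {0}. c (jet_index (0, Suc k)) * z k\<bar> \<le> real n * G * D"
    by simp
  have "\<bar>\<Sum>p\<in>?B. c (jet_index p) * coeff (?q p) 0\<bar> \<le> (\<Sum>p\<in>?B. \<bar>c (jet_index p)\<bar> * D\<^sup>2)"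
  proof (rule order_trans[OF sum_abs sum_mono])
    fix p assume p: "p \<in> ?B"
    obtain i k where ik: "p = (i, k)" "0 < i" "i \<le> n" "0 < k" "k \<le> n"
      using p by (cases p) (auto simp: tri_def)
    have "\<bar>hcoord 1 z i * hcoord 1 z k\<bar> \<le> D\<^sup>2"
      unfolding abs_mult power2_eq_square using D ik by (intro mult_mono hcoord_abs_le[where n=n] z) auto
    then show "\<bar>c (jet_index p) * coeff (?q p) 0\<bar> \<le> \<bar>c (jet_index p)\<bar> * D\<^sup>2"
      unfolding abs_mult coeff_quadratic ik(1) fst_conv snd_conv by (intro mult_left_mono) auto
  qed
  then have hess: "\<bar>\<Sum>p\<in>?B. c (jet_index p) * coeff (?q p) 0\<bar> \<le> D\<^sup>2 * hess_sum n (\<lambda>p. c (jet_index p))"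
    by (simp add: hess_sum_def sum_distrib_left mult_ac)
  have "\<bar>coeff (line_poly n d c z (\<lambda>_. 0)) 0 - (\<Sum>p\<in>tri (Suc n). c (jet_index p) * coeff (?q p) 0)\<bar>
      \<le> 2 ^ d * M * D ^ (3 - 0) * 1 ^ 0"
    by (rule coeff_line_poly_jet[OF d D _ z _ _ M]) auto
  moreover have "c (jet_index (0, 0)) * coeff (?q (0, 0)) 0 = c (jet_index (0, 0))"
    by (simp add: coeff_quadratic)
  moreover have "2 ^ d * M * D ^ (3 - 0) * 1 ^ 0 = 2 ^ d * M * D ^ 3"
    by simp
  ultimately show ?thesis
    using hess rest unfolding sum_tri_split lin *[of w] by linarith
qed

lemma hessian_jet:
  assumes d: "d \<ge> 2" and D: "0 \<le> D" "D \<le> 1" and w0: "K \<ge> 0" "\<And>i. i < n \<Longrightarrow> \<bar>w i\<bar> \<le> K"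
    and z: "\<And>i. i < n \<Longrightarrow> \<bar>z i\<bar> \<le> D"
    and M: "(\<Sum>\<alpha>\<in>multi_indices n d. \<bar>c \<alpha>\<bar>) \<le> M"
  shows "\<bar>coeff (line_poly n d c z w) 2
      - (\<Sum>p\<in>{p \<in> tri (Suc n). fst p > 0}. c (jet_index p) * (hcoord 0 w (fst p) * hcoord 0 w (snd p)))\<bar>
    \<le> 2 ^ d * M * D * K\<^sup>2"
proof -
  let ?q = "\<lambda>p. [:hcoord 1 z (fst p), hcoord 0 w (fst p):] * [:hcoord 1 z (snd p), hcoord 0 w (snd p):]"
  have "\<bar>coeff (line_poly n d c z w) 2 - (\<Sum>p\<in>tri (Suc n). c (jet_index p) * coeff (?q p) 2)\<bar>
      \<le> 2 ^ d * M * D ^ (3 - 2) * K ^ 2"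
    by (rule coeff_line_poly_jet[OF d D _ z w0(2,1) M]) auto
  then show ?thesis
    unfolding sum_tri_split coeff_quadratic by simp
qed

section \<open>Local minima in a rotated affine chart\<close>

definition reflection_mat :: "(nat \<Rightarrow> real) \<Rightarrow> nat \<Rightarrow> nat \<Rightarrow> real" where
  "reflection_mat u i j = (if i = j then 1 else 0) - 2 * u i * u j"

lemma reflection_mat_apply:
  assumes "i \<le> n"
  shows "(\<Sum>k\<le>n. reflection_mat u i k * y k) = y i - 2 * (\<Sum>k\<le>n. u k * y k) * u i"
proof -
  have "(\<Sum>k\<le>n. reflection_mat u i k * y k) = (\<Sum>k\<le>n. (if k = i then y k else 0) - 2 * u i * (u k * y k))"
    by (intro sum.cong) (auto simp: reflection_mat_def algebra_simps)
  also have "\<dots> = y i - 2 * u i * (\<Sum>k\<le>n. u k * y k)"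
    using assms by (simp add: sum_subtractf sum_distrib_left)
  finally show ?thesis by simp
qed

lemma sym_orth_reflection_mat:
  assumes unit: "(\<Sum>k\<le>n. (u k)\<^sup>2) = 1"
  shows "sym_orth n (reflection_mat u)"
  unfolding sym_orth_def
proof (intro conjI allI impI)
  fix i j assume i: "i \<le> n" and j: "j \<le> n"
  have "(\<Sum>k\<le>n. u k * reflection_mat u j k) = (\<Sum>k\<le>n. reflection_mat u j k * u k)"
    by (simp add: mult.commute)
  also have "\<dots> = u j - 2 * (\<Sum>k\<le>n. u k * u k) * u j"
    by (rule reflection_mat_apply[OF j])
  also have "\<dots> = - u j" using unit by (simp add: power2_eq_square)
  finally have "(\<Sum>k\<le>n. u k * reflection_mat u j k) = - u j" .
  then show "(\<Sum>k\<le>n. reflection_mat u i k * reflection_mat u j k) = (if i = j then 1 else 0)"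
    unfolding reflection_mat_apply[OF i] by (simp add: reflection_mat_def)
qed (simp add: reflection_mat_def)

lemma sum_hcoord:
  "(\<Sum>k\<le>n. f k) = f 0 + (\<Sum>i<n. f (Suc i) :: real)"
  by (rule sum.atMost_shift)

text \<open>The reflection along the difference of two vectors of equal length exchanges them. The
  construction degenerates if \<open>x\<close> already lies on the positive first axis, where the
  identity is taken.\<close>

lemma ex_rotation_to_axis:
  assumes r: "r = sqrt (\<Sum>i<n. (x i)\<^sup>2)" and n: "n \<ge> 1"
  obtains R where "sym_orth n R" "\<And>i. i \<le> n \<Longrightarrow> R i 0 = (if i = 0 then 1 else 0)"
    "\<And>i. i \<le> n \<Longrightarrow> (\<Sum>k\<le>n. R i k * hcoord 1 x k) = hcoord 1 (\<lambda>i. if i = 0 then r else 0) i"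
proof -
  define v where "v i = x i - (if i = 0 then r else 0)" for i
  define q where "q = sqrt (\<Sum>i<n. (v i)\<^sup>2)"
  \<comment> \<open>The vanishing component 0 lets the reflection act on the affine coordinates
    alone.\<close>
  define u where "u = hcoord 0 (\<lambda>i. v i / q)"
  have r2: "(\<Sum>i<n. (x i)\<^sup>2) = r\<^sup>2" using r by (simp add: sum_nonneg)
  have q2: "(\<Sum>i<n. (v i)\<^sup>2) = q\<^sup>2" by (simp add: q_def sum_nonneg)
  show ?thesis
  proof (cases "q = 0")
    case True
    then have v0: "v i = 0" if "i < n" for i
      using q2 that by (simp add: sum_nonneg_eq_0_iff)
    define R where "R i j = (if i = j then 1 else 0 :: real)" for i j :: nat
    have app: "(\<Sum>k\<le>n. R i k * y k) = y i" if "i \<le> n" for i y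
    proof -
      have "(\<Sum>k\<le>n. R i k * y k) = (\<Sum>k\<le>n. if k = i then y k else 0)"
        by (intro sum.cong) (auto simp: R_def)
      then show ?thesis using that by simp
    qed
    show ?thesis
    proof (rule that)
      show "sym_orth n R" unfolding sym_orth_def by (auto simp: app) (auto simp: R_def)
      show "R i 0 = (if i = 0 then 1 else 0)" for i by (simp add: R_def)
      fix i assume i: "i \<le> n"
      show "(\<Sum>k\<le>n. R i k * hcoord 1 x k) = hcoord 1 (\<lambda>i. if i = 0 then r else 0) i"
        unfolding app[OF i] using i v0[of "i - 1"] by (cases i) (auto simp: v_def)
    qed
  next
    case False
    have q: "q > 0" using False by (simp add: q_def less_le sum_nonneg)
    have unit: "(\<Sum>k\<le>n. (u k)\<^sup>2) = 1"
      using q by (simp add: sum_hcoord u_def power_divide q2 flip: sum_divide_distrib)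
    have vx: "(\<Sum>i<n. v i * x i) = r\<^sup>2 - r * x 0"
    proof -
      have "(\<Sum>i<n. v i * x i) = (\<Sum>i<n. (x i)\<^sup>2 - (if i = 0 then r * x i else 0))"
        by (intro sum.cong) (auto simp: v_def power2_eq_square algebra_simps)
      then show ?thesis using n by (simp add: sum_subtractf r2)
    qed
    have "q\<^sup>2 = (\<Sum>i<n. v i * x i - (if i = 0 then r * v i else 0))"
      unfolding q2[symmetric] by (intro sum.cong) (auto simp: v_def power2_eq_square algebra_simps)
    also have "\<dots> = 2 * (r\<^sup>2 - r * x 0)"
      using n by (simp add: sum_subtractf vx) (simp add: v_def power2_eq_square algebra_simps)
    finally have q_eq: "q\<^sup>2 = 2 * (r\<^sup>2 - r * x 0)" .
    have ux: "(\<Sum>k\<le>n. u k * hcoord 1 x k) = q / 2"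
      using q q_eq by (simp add: sum_hcoord u_def vx power2_eq_square field_simps flip: sum_divide_distrib)
    show ?thesis
    proof (rule that)
      show "sym_orth n (reflection_mat u)" by (rule sym_orth_reflection_mat[OF unit])
      show "reflection_mat u i 0 = (if i = 0 then 1 else 0)" for i
        by (simp add: reflection_mat_def u_def)
      fix i assume i: "i \<le> n"
      show "(\<Sum>k\<le>n. reflection_mat u i k * hcoord 1 x k) = hcoord 1 (\<lambda>i. if i = 0 then r else 0) i"
        unfolding reflection_mat_apply[OF i] ux using q by (cases i) (auto simp: u_def v_def)
    qed
  qed
qed

text \<open>The mirror normal is \<open>(sin (t / 2), - cos (t / 2))\<close> with
  \<open>tan t = r\<close>, written out by the half-angle formulas.\<close>

definition axis_reflection :: "real \<Rightarrow> nat \<Rightarrow> nat \<Rightarrow> real" where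
  "axis_reflection r = reflection_mat (\<lambda>i. if i = 0 then sqrt ((1 - 1 / sqrt (1 + r\<^sup>2)) / 2)
     else if i = 1 then - sqrt ((1 + 1 / sqrt (1 + r\<^sup>2)) / 2) else 0)"

text \<open>The reflection exchanging the unit vectors in directions \<open>(1, r, 0, \<dots>)\<close> and \<open>(1, 0, \<dots>)\<close>.\<close>

lemma axis_reflection:
  assumes n: "n \<ge> 1" and r: "r \<ge> 0"
  defines "s \<equiv> 1 + r\<^sup>2"
  shows "sym_orth n (axis_reflection r)"
    and "i \<le> n \<Longrightarrow> (\<Sum>k\<le>n. axis_reflection r i k * y k)
      = (if i = 0 then (y 0 + r * y 1) / sqrt s else if i = 1 then (r * y 0 - y 1) / sqrt s else y i)"
proof -
  define a b where "a = sqrt ((1 - 1 / sqrt s) / 2)" and "b = sqrt ((1 + 1 / sqrt s) / 2)"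
  let ?u = "\<lambda>i :: nat. if i = 0 then a else if i = 1 then - b else 0"
  have s: "s \<ge> 1" "sqrt s \<ge> 1" by (simp_all add: s_def)
  then have a2: "a\<^sup>2 = (1 - 1 / sqrt s) / 2" and b2: "b\<^sup>2 = (1 + 1 / sqrt s) / 2"
    by (simp_all add: a_def b_def)
  have "2 * a * b = r / sqrt s"
  proof -
    have "(1 - 1 / q) / 2 * ((1 + 1 / q) / 2) = (1 - 1 / (q * q)) / 4" for q :: real
      by (simp add: algebra_simps)
    from this[of "sqrt s"] have "a * b = sqrt ((1 - 1 / (sqrt s * sqrt s)) / 4)"
      unfolding a_def b_def real_sqrt_mult[symmetric] by (rule arg_cong)
    also have "(1 - 1 / (sqrt s * sqrt s)) / 4 = r\<^sup>2 / (4 * s)"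
      using s by (simp add: field_simps) (simp add: s_def)
    finally have "a * b = sqrt (r\<^sup>2 / (4 * s))" .
    also have "\<dots> = r / (2 * sqrt s)"
      using r by (simp add: real_sqrt_divide real_sqrt_mult)
    finally show ?thesis by simp
  qed
  then have ab: "2 * (a * b) = r / sqrt s" by simp
  have split: "(\<Sum>k\<le>n. f k) = f 0 + f 1 + (\<Sum>k\<in>{2..n}. f k)" for f :: "nat \<Rightarrow> real"
  proof -
    have "{..n} = insert 0 (insert 1 {2..n})" using n by auto
    then show ?thesis by simp
  qed
  have def': "axis_reflection r = reflection_mat ?u"
    unfolding axis_reflection_def a_def b_def s_def ..
  have "(\<Sum>k\<le>n. (?u k)\<^sup>2) = 1"
    unfolding split using a2 b2 by simp
  then show "sym_orth n (axis_reflection r)"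
    unfolding def' by (rule sym_orth_reflection_mat)
  show "(\<Sum>k\<le>n. axis_reflection r i k * y k)
      = (if i = 0 then (y 0 + r * y 1) / sqrt s else if i = 1 then (r * y 0 - y 1) / sqrt s else y i)" if "i \<le> n"
  proof -
    have "(\<Sum>k\<le>n. ?u k * y k) = a * y 0 - b * y 1" unfolding split by simp
    then have *: "(\<Sum>k\<le>n. axis_reflection r i k * y k) = y i - 2 * (a * y 0 - b * y 1) * ?u i"
      unfolding def' reflection_mat_apply[OF that] by simp
    have "y 0 - 2 * (a * y 0 - b * y 1) * a = y 0 * (1 - 2 * a\<^sup>2) + 2 * (a * b) * y 1"
      by (simp add: power2_eq_square algebra_simps)
    also have "\<dots> = (y 0 + r * y 1) / sqrt s"
      unfolding ab by (simp add: a2 add_divide_distrib diff_divide_distrib)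
    finally have 0: "y 0 - 2 * (a * y 0 - b * y 1) * a = (y 0 + r * y 1) / sqrt s" .
    have "y 1 - 2 * (a * y 0 - b * y 1) * (- b) = y 1 * (1 - 2 * b\<^sup>2) + 2 * (a * b) * y 0"
      by (simp add: power2_eq_square algebra_simps)
    also have "\<dots> = (r * y 0 - y 1) / sqrt s"
      unfolding ab by (simp add: b2 add_divide_distrib diff_divide_distrib)
    finally have 1: "y 1 - 2 * (a * y 0 - b * y 1) * (- b) = (r * y 0 - y 1) / sqrt s" .
    show ?thesis unfolding * using 0 1 by auto
  qed
qed

lemma word_poly_cong:
  "(\<And>i. i \<le> n \<Longrightarrow> y i = y' i) \<Longrightarrow> word_poly n d T y = word_poly n d T y'"
  unfolding word_poly_def by (intro sum.cong prod.cong arg_cong2[where f="(*)"] refl) (auto intro: hom_words_nth_le)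

lemma local_min_along_curve:
  assumes x: "x \<in> local_minima n f" and S: "open S" "t0 \<in> S"
    and cont: "\<And>i. i < n \<Longrightarrow> continuous_on S (\<lambda>t. g t i)"
    and zero: "\<And>t i. i \<ge> n \<Longrightarrow> g t i = 0" and g0: "g t0 = x"
  shows "eventually (\<lambda>t :: real. f x \<le> f (g t)) (at t0)"
proof -
  obtain U where U: "openin (Euclidean_space n) U" "x \<in> U" "\<And>y. y \<in> U \<Longrightarrow> f x \<le> f y"
    using x by (auto simp: local_minima_def)
  have comp: "continuous_map (top_of_set S) euclideanreal (\<lambda>t. g t i)" for i
    using cont[of i] zero[of i] by (cases "i < n") (auto simp: continuous_map_iff_continuous2 simp flip: continuous_map_iff_continuous)
  have "continuous_map (top_of_set S) (Euclidean_space n) g"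
    unfolding Euclidean_space_def using comp zero
    by (auto simp: continuous_map_in_subtopology continuous_map_componentwise_UNIV)
  then have "openin (top_of_set S) {t \<in> S. g t \<in> U}"
    using U(1) by (auto simp: continuous_map)
  then have "open {t \<in> S. g t \<in> U}"
    using S(1) by (simp add: openin_open_eq)
  moreover have "t0 \<in> {t \<in> S. g t \<in> U}" using S g0 U by simp
  ultimately have "eventually (\<lambda>t. t \<in> {t \<in> S. g t \<in> U}) (at t0)"
    by (rule eventually_at_in_open')
  then show ?thesis by eventually_elim (use U(3) in auto)
qed

text \<open>In the coordinates \<open>z\<close> of the rotated affine chart the polynomial \<open>f\<close> becomes
  \<open>(1 + r * z\<^sub>0)\<^sup>-\<^sup>d\<close> times a polynomial \<open>poly_fun n d c z\<close> with the same law.\<close>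

lemma local_min_in_chart:
  assumes n: "n \<ge> 1" and r: "r = sqrt (\<Sum>i<n. (x0 i)\<^sup>2)"
    and R: "sym_orth n R" "\<And>i. i \<le> n \<Longrightarrow> R i 0 = (if i = 0 then 1 else 0)"
      "\<And>i. i \<le> n \<Longrightarrow> (\<Sum>k\<le>n. R i k * hcoord 1 x0 k) = hcoord 1 (\<lambda>i. if i = 0 then r else 0) i"
    and x: "x \<in> local_minima n (poly_fun n d (word_coeff n d T))"
    and near: "\<And>i. i < n \<Longrightarrow> \<bar>x i - x0 i\<bar> \<le> e" and e: "real n * e \<le> 1"
  defines "c \<equiv> word_coeff n d (word_rot n d (axis_reflection r) (word_rot n d R T))"
    and "s \<equiv> 1 + r\<^sup>2"
  obtains z where "\<bar>z 0\<bar> \<le> 2 * (real n * e) / s" "\<And>i. i < n \<Longrightarrow> \<bar>z i\<bar> \<le> 2 * (real n * e) / sqrt s"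
    "\<And>w. w 0 = 0 \<Longrightarrow> coeff (line_poly n d c z w) 1 = 0"
    "\<And>w. w 0 = 0 \<Longrightarrow> coeff (line_poly n d c z w) 2 \<ge> 0"
    "(1 + r * z 0) * coeff (line_poly n d c z (\<lambda>i. if i = 0 then 1 else 0)) 1
      = real d * r * coeff (line_poly n d c z (\<lambda>i. if i = 0 then 1 else 0)) 0"
proof -
  let ?f = "poly_fun n d (word_coeff n d T)"
  have r0: "r \<ge> 0" by (simp add: r sum_nonneg)
  have s: "s \<ge> 1" "sqrt s \<ge> 1" "sqrt s * sqrt s = s" by (simp_all add: s_def)
  \<comment> \<open>The image of \<open>(1, z)\<close> under \<open>axis_reflection r\<close>,
    divided by its homogenising coordinate; \<open>z = 0\<close> goes to the point at distance
    \<open>r\<close> on the first axis. \<open>X\<close> then undoes \<open>R\<close> as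
    well.\<close>
  define ch where "ch z = (\<lambda>i :: nat. if i = 0 then (r - z 0) / (1 + r * z 0) else sqrt s * z i / (1 + r * z 0))"
    for z :: "nat \<Rightarrow> real"
  define X where "X z = (\<lambda>i. if i < n then \<Sum>k\<le>n. R (Suc i) k * hcoord 1 (ch z) k else 0)" for z
  have R0: "(\<Sum>k\<le>n. R 0 k * y k) = y 0" for y
  proof -
    have "(\<Sum>k\<le>n. R 0 k * y k) = (\<Sum>k\<le>n. if k = 0 then y k else 0)"
      using R(2) sym_orthD(1)[OF R(1), of 0] by (intro sum.cong) auto
    then show ?thesis by simp
  qed
  have chart: "?f (X z) = (sqrt s / (1 + r * z 0)) ^ d * poly_fun n d c z" if nz: "1 + r * z 0 \<noteq> 0" for z
  proof -
    \<comment> \<open>The scale at which the reflected point has homogenising coordinate 1.\<close>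
    define Y where "Y = sqrt s / (1 + r * z 0)"
    let ?y = "\<lambda>i. Y * hcoord 1 z i"
    have "word_poly n d (word_rot n d (axis_reflection r) (word_rot n d R T)) ?y = ?y 0 ^ d * poly_fun n d c z"
      unfolding c_def by (rule word_poly_eq_poly_fun) simp
    moreover have "word_poly n d (word_rot n d (axis_reflection r) (word_rot n d R T)) ?y
        = word_poly n d (word_rot n d R T) (hcoord 1 (ch z))"
      unfolding word_poly_word_rot[OF axis_reflection(1)[OF n r0]]
    proof (rule word_poly_cong)
      fix i assume i: "i \<le> n"
      have "Y * (1 + r * z 0) = sqrt s" using nz by (simp add: Y_def)
      then have "Y * 1 + r * (Y * z 0) = sqrt s" by (simp add: algebra_simps)
      then have 0: "(Y * 1 + r * (Y * z 0)) / sqrt s = 1" using s by simp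
      have "r * (Y * 1) - Y * z 0 = sqrt s * ((r - z 0) / (1 + r * z 0))"
        by (simp add: Y_def algebra_simps diff_divide_distrib)
      then have 1: "(r * (Y * 1) - Y * z 0) / sqrt s = (r - z 0) / (1 + r * z 0)"
        using s by simp
      show "(\<Sum>k\<le>n. axis_reflection r i k * ?y k) = hcoord 1 (ch z) i"
        unfolding axis_reflection(2)[OF n r0 i] s_def[symmetric] using 0 1
        by (cases i; cases "i - 1") (auto simp: ch_def Y_def)
    qed
    moreover have "word_poly n d (word_rot n d R T) (hcoord 1 (ch z)) = word_poly n d T (hcoord 1 (X z))"
      unfolding word_poly_word_rot[OF R(1)]
    proof (rule word_poly_cong)
      fix i assume "i \<le> n"
      then show "(\<Sum>k\<le>n. R i k * hcoord 1 (ch z) k) = hcoord 1 (X z) i"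
        by (cases i) (auto simp: R0 X_def)
    qed
    moreover have "word_poly n d T (hcoord 1 (X z)) = hcoord 1 (X z) 0 ^ d * ?f (X z)"
      by (rule word_poly_eq_poly_fun) simp
    ultimately show ?thesis by (simp add: Y_def)
  qed
  define x' where "x' i = (\<Sum>k\<le>n. R (Suc i) k * hcoord 1 x k)" for i
  have x'_near: "\<bar>x' i - (if i = 0 then r else 0)\<bar> \<le> real n * e" if i: "i < n" for i
  proof -
    have "x' i - (if i = 0 then r else 0) = (\<Sum>k\<le>n. R (Suc i) k * hcoord 1 x k) - (\<Sum>k\<le>n. R (Suc i) k * hcoord 1 x0 k)"
      using R(3)[of "Suc i"] i by (simp add: x'_def)
    also have "\<dots> = (\<Sum>k<n. R (Suc i) (Suc k) * (x k - x0 k))"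
      by (simp add: sum_hcoord sum_subtractf right_diff_distrib)
    finally have "\<bar>x' i - (if i = 0 then r else 0)\<bar> \<le> (\<Sum>k<n. \<bar>R (Suc i) (Suc k) * (x k - x0 k)\<bar>)"
      by (simp only: sum_abs)
    also have "\<dots> \<le> (\<Sum>k<n. 1 * e)"
      unfolding abs_mult using i near
      by (intro sum_mono mult_mono sym_orth_abs_le[OF R(1)]) auto
    finally show ?thesis by simp
  qed
  define D where "D = 1 + r * x' 0"
  \<comment> \<open>As \<open>x' 0\<close> is within 1 of \<open>r\<close>, \<open>D\<close> is at
    least \<open>1 + r\<^sup>2 - r\<close>, which is at least \<open>s / 2\<close> because
    \<open>(r - 1)\<^sup>2\<close> is nonnegative.\<close>
  have D: "D \<ge> s / 2"
  proof -
    have "\<bar>x' 0 - r\<bar> \<le> 1" using x'_near[of 0] n e by simp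
    then have "r - x' 0 \<le> 1" by simp
    then have "r * (r - x' 0) \<le> r * 1" using r0 by (rule mult_left_mono)
    moreover have "0 \<le> (r - 1)\<^sup>2" by simp
    ultimately show ?thesis by (simp add: D_def s_def power2_eq_square algebra_simps)
  qed
  have D0: "D > 0" using D s by simp
  \<comment> \<open>The reflection is an involution, so \<open>z\<close> is given by the formula of
    \<open>ch\<close> applied to \<open>x'\<close>.\<close>
  define z where "z = (\<lambda>i. if i = 0 then (r - x' 0) / D else sqrt s * x' i / D)"
  have Dz: "1 + r * z 0 = s / D"
    using D0 by (simp add: z_def field_simps) (simp add: D_def s_def power2_eq_square algebra_simps)
  have bound: "a / D \<le> 2 * a / s" if "a \<ge> 0" for a
    proof -
    have "a * s \<le> a * (2 * D)" using D that by (intro mult_left_mono) auto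
    then show ?thesis using D0 s by (simp add: field_simps)
  qed
  \<comment> \<open>The radial displacement shrinks by \<open>1 / s\<close>, against
    \<open>1 / sqrt s\<close> in the other directions; the gain keeps \<open>r * z 0\<close> under
    control for large \<open>r\<close>.\<close>
  have z0: "\<bar>z 0\<bar> \<le> 2 * (real n * e) / s"
  proof -
    have "\<bar>z 0\<bar> = \<bar>x' 0 - r\<bar> / D" using D0 by (simp add: z_def abs_minus_commute)
    also have "\<dots> \<le> 2 * \<bar>x' 0 - r\<bar> / s" by (rule bound) simp
    also have "\<dots> \<le> 2 * (real n * e) / s"
      using x'_near[of 0] n s by (intro divide_right_mono mult_left_mono) auto
    finally show ?thesis .
  qed
  have ne: "real n * e \<ge> 0" using x'_near[of 0] n by linarith
  have zi: "\<bar>z i\<bar> \<le> 2 * (real n * e) / sqrt s" if i: "i < n" for i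
  proof (cases "i = 0")
    case True
    have "sqrt s \<le> s" using s mult_left_mono[of 1 "sqrt s" "sqrt s"] by simp
    then have "2 * (real n * e) / s \<le> 2 * (real n * e) / sqrt s"
      using s ne by (intro divide_left_mono) auto
    then show ?thesis using z0 True by simp
  next
    case False
    have "\<bar>z i\<bar> = sqrt s * (\<bar>x' i\<bar> / D)" using False D0 s by (simp add: z_def abs_mult)
    also have "\<dots> \<le> sqrt s * (2 * \<bar>x' i\<bar> / s)" using s by (intro mult_left_mono bound) auto
    also have "\<dots> \<le> sqrt s * (2 * (real n * e) / s)"
      using x'_near[of i] False i s by (intro mult_left_mono divide_right_mono) auto
    also have "\<dots> = 2 * (real n * e) * (sqrt s / s)" by simp
    also have "sqrt s / s = 1 / sqrt s" using s by (simp add: field_simps)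
    finally show ?thesis by simp
  qed
  have x_zero: "x i = 0" if "i \<ge> n" for i
    using x that openin_subset[of "Euclidean_space n"]
    by (force simp: local_minima_def topspace_Euclidean_space)
  have ch_z: "ch z i = x' i" for i
  proof (cases "i = 0")
    case True
    have "r - z 0 = s * x' 0 / D"
      using D0 by (simp add: z_def field_simps) (simp add: D_def s_def power2_eq_square algebra_simps)
    then show ?thesis using True D0 s unfolding ch_def Dz by simp
  next
    case False
    have "sqrt s * z i = s * x' i / D" using False s(3) by (simp add: z_def mult.assoc[symmetric])
    then show ?thesis using False D0 s unfolding ch_def Dz by simp
  qed
  have Xz: "X z = x"
  proof
    fix i
    show "X z i = x i"
    proof (cases "i < n")
      case True
      have "X z i = (\<Sum>k\<le>n. R (Suc i) k * (\<Sum>l\<le>n. R k l * hcoord 1 x l))"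
        unfolding X_def using True
      proof (simp only: if_True, intro sum.cong refl arg_cong2[where f="(*)"])
        fix k assume "k \<in> {..n}"
        then show "hcoord 1 (ch z) k = (\<Sum>l\<le>n. R k l * hcoord 1 x l)"
          by (cases k) (auto simp: R0 ch_z x'_def)
      qed
      also have "\<dots> = hcoord 1 x (Suc i)"
        by (rule sym_orth_involution[OF R(1)]) (use True in simp)
      finally show ?thesis by simp
    next
      case False
      then show ?thesis using x_zero by (simp add: X_def)
    qed
  qed
  have curve: "eventually (\<lambda>t. ?f x \<le> ?f (X (\<lambda>i. z i + t * w i)) \<and> 1 + r * (z 0 + t * w 0) > 0) (at 0)" for w
  proof -
    define S where "S = {t :: real. 1 + r * (z 0 + t * w 0) > 0}"
    have S: "open S" "0 \<in> S"
      using D0 s Dz by (auto simp: S_def intro!: open_Collect_less continuous_intros)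
    have ch_cont: "continuous_on S (\<lambda>t. hcoord 1 (ch (\<lambda>i. z i + t * w i)) k)" for k
      by (cases k; cases "k - 1") (auto simp: ch_def S_def intro!: continuous_intros)
    have "eventually (\<lambda>t. ?f x \<le> ?f (X (\<lambda>i. z i + t * w i))) (at 0)"
    proof (rule local_min_along_curve[OF x S])
      show "continuous_on S (\<lambda>t. X (\<lambda>i. z i + t * w i) i)" if "i < n" for i
        using that by (auto simp: X_def intro!: continuous_intros ch_cont)
      show "X (\<lambda>i. z i + t * w i) i = 0" if "i \<ge> n" for t i
        using that by (simp add: X_def)
      show "X (\<lambda>i. z i + 0 * w i) = x" using Xz by simp
    qed
    moreover have "eventually (\<lambda>t. t \<in> S) (at 0)"
      using S by (rule eventually_at_in_open')
    ultimately show ?thesis by eventually_elim (auto simp: S_def)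
  qed
  have chart_z: "?f x = (sqrt s / (1 + r * z 0)) ^ d * poly (line_poly n d c z w) 0" for w
    using chart[of z] Dz D0 s by (simp add: Xz poly_line_poly)
  have chart_t: "?f (X (\<lambda>i. z i + t * w i)) = (sqrt s / (1 + r * (z 0 + t * w 0))) ^ d * poly (line_poly n d c z w) t"
    if "1 + r * (z 0 + t * w 0) > 0" for t w
    using chart[of "\<lambda>i. z i + t * w i"] that by (simp add: poly_line_poly)
  \<comment> \<open>For \<open>w 0 = 0\<close> the positive factor in front of the chart polynomial
    is constant along the line and can be cancelled.\<close>
  have loc: "eventually (\<lambda>t. poly (line_poly n d c z w) 0 \<le> poly (line_poly n d c z w) t) (at 0)"
    if w: "w 0 = 0" for w
    using curve[of w]
  proof eventually_elim
    case (elim t)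
    have "(sqrt s / (1 + r * z 0)) ^ d > 0" using Dz D0 s by simp
    moreover have "(sqrt s / (1 + r * z 0)) ^ d * poly (line_poly n d c z w) 0
        \<le> (sqrt s / (1 + r * z 0)) ^ d * poly (line_poly n d c z w) t"
      using elim chart_z[of w] chart_t[where t=t and w=w] w by simp
    ultimately show ?case by (simp only: mult_le_cancel_left_pos)
  qed
  define w0 where "w0 = (\<lambda>i :: nat. if i = 0 then 1 else 0 :: real)"
  define p where "p = line_poly n d c z w0"
  define a where "a = 1 + r * z 0"
  have a: "a > 0" using Dz D0 s by (simp add: a_def)
  \<comment> \<open>In the radial direction the factor varies with \<open>t\<close>; only the
    vanishing of the first derivative of the quotient is extracted.\<close>
  have "eventually (\<lambda>t. poly p 0 / a ^ d \<le> poly p t / (a + r * t) ^ d) (at 0)"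
    using curve[of w0]
  proof eventually_elim
    case (elim t)
    have eq: "1 + r * (z 0 + t * w0 0) = a + r * t" by (simp add: a_def w0_def algebra_simps)
    have "(sqrt s / a) ^ d * poly p 0 \<le> (sqrt s / (a + r * t)) ^ d * poly p t"
      using elim chart_z[of w0] chart_t[where t=t and w=w0] unfolding eq p_def[symmetric] a_def[symmetric] by simp
    then have "sqrt s ^ d * (poly p 0 / a ^ d) \<le> sqrt s ^ d * (poly p t / (a + r * t) ^ d)"
      by (simp add: power_divide)
    then show ?case using s by (subst (asm) mult_le_cancel_left_pos) auto
  qed
  then obtain h where h: "h > 0" "\<And>t. t \<noteq> 0 \<Longrightarrow> \<bar>t\<bar> < h \<Longrightarrow> poly p 0 / a ^ d \<le> poly p t / (a + r * t) ^ d"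
    by (auto simp: eventually_at dist_real_def)
  have der: "((\<lambda>t. poly p t / (a + r * t) ^ d) has_real_derivative
      (poly (pderiv p) 0 * a ^ d - poly p 0 * (real d * a ^ (d - 1) * r)) / (a ^ d * a ^ d)) (at 0)"
    by (rule derivative_eq_intros poly_DERIV refl | use a in force)+
  have "(poly (pderiv p) 0 * a ^ d - poly p 0 * (real d * a ^ (d - 1) * r)) / (a ^ d * a ^ d) = 0"
  proof (rule DERIV_local_min[OF der h(1)])
    show "\<forall>y. \<bar>0 - y\<bar> < h \<longrightarrow> poly p 0 / (a + r * 0) ^ d \<le> poly p y / (a + r * y) ^ d"
      using h(2) by (metis abs_minus_commute add.right_neutral diff_zero mult_zero_right order_refl)
  qed
  then have eq: "poly (pderiv p) 0 * a ^ d = poly p 0 * (real d * a ^ (d - 1) * r)"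
    using a by simp
  have "a * coeff p 1 = real d * r * coeff p 0"
  proof (cases d)
    case 0
    then have "coeff p 1 * 1 = 0" using eq by (simp add: poly_0_coeff_0 coeff_pderiv)
    then show ?thesis using 0 by simp
  next
    case (Suc d')
    have "(a * coeff p 1) * a ^ d' = (real d * r * coeff p 0) * a ^ d'"
      using eq Suc by (simp add: poly_0_coeff_0 coeff_pderiv mult_ac)
    then show ?thesis using a by simp
  qed
  then show ?thesis
    using z0 zi poly_local_min_coeffs[OF loc] by (intro that[of z]) (simp_all add: p_def w0_def a_def)
qed

section \<open>The law of the jet\<close>

definition jet_sd :: "nat \<Rightarrow> nat \<times> nat \<Rightarrow> real" where
  "jet_sd d p = (if snd p = 0 then 1 else if fst p = 0 then sqrt (real d)
     else if fst p = snd p then sqrt (real d) * sqrt (real d - 1) / sqrt 2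
     else sqrt (real d) * sqrt (real d - 1))"

definition jet_vars :: "nat \<Rightarrow> nat \<Rightarrow> ((nat \<Rightarrow> nat) \<Rightarrow> real) \<Rightarrow> nat \<times> nat \<Rightarrow> real" where
  "jet_vars n d c = (\<lambda>p\<in>tri (Suc n). c (jet_index p) / sqrt (multinomial_coeff n d (jet_index p)))"

lemma multinomial_coeff_jet_index:
  assumes p: "p \<in> tri (Suc n)" and d: "d \<ge> 2"
  shows "sqrt (multinomial_coeff n d (jet_index p)) = jet_sd d p"
proof -
  obtain i k where ik: "p = (i, k)" "i \<le> k" "k \<le> n" using p by (cases p) (auto simp: tri_def)
  have d1: "fact d / fact (d - 1) = real d"
    using d fact_reduce[of d, where 'a=real] by simp
  have d2: "fact d / fact (d - 2) = real d * (real d - 1)"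
    using d fact_reduce[of d, where 'a=real] fact_reduce[of "d - 1", where 'a=real]
    by (simp add: numeral_2_eq_2 of_nat_diff)
  have "(\<Prod>l<n. fact (jet_index p l) :: real) = (\<Prod>l<n. if Suc l = i \<and> i = k then 2 else 1)"
    by (intro prod.cong) (auto simp: jet_index_def ik(1))
  also have "\<dots> = (if i = k \<and> i \<noteq> 0 then 2 else 1)"
  proof (cases "i = k \<and> i \<noteq> 0")
    case True
    then obtain a where a: "i = Suc a" by (cases i) auto
    have "(\<Prod>l<n. if Suc l = i \<and> i = k then 2 else 1 :: real) = (\<Prod>l<n. if l = a then 2 else 1)"
      using True a by (intro prod.cong) auto
    then show ?thesis using True a ik by simp
  next
    case False
    then show ?thesis by (auto intro!: prod.neutral)
  qed
  finally have prod: "(\<Prod>l<n. fact (jet_index p l) :: real) = (if i = k \<and> i \<noteq> 0 then 2 else 1)" .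
  have m: "multinomial_coeff n d (jet_index p)
      = fact d / ((if i = k \<and> i \<noteq> 0 then 2 else 1) * fact (d - ((if i = 0 then 0 else 1) + (if k = 0 then 0 else 1))))"
    unfolding multinomial_coeff_def prod sum_jet_index[OF p] by (simp add: ik(1))
  consider "k = 0" | "i = 0" "k \<noteq> 0" | "i \<noteq> 0" "i = k" | "i \<noteq> 0" "i \<noteq> k" "k \<noteq> 0" using ik by auto
  then show ?thesis
  proof cases
    case 1
    then show ?thesis unfolding m using ik by (simp add: jet_sd_def)
  next
    case 2
    then show ?thesis unfolding m using d1 by (simp add: jet_sd_def ik(1))
  next
    case 3
    then have eq: "multinomial_coeff n d (jet_index p) = (fact d / fact (d - 2)) / 2"
      by (simp add: m numeral_2_eq_2)
    show ?thesis unfolding eq d2 using 3 by (simp add: jet_sd_def ik(1) real_sqrt_mult real_sqrt_divide)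
  next
    case 4
    then have eq: "multinomial_coeff n d (jet_index p) = fact d / fact (d - 2)"
      by (simp add: m numeral_2_eq_2)
    show ?thesis unfolding eq d2 using 4 by (simp add: jet_sd_def ik(1) real_sqrt_mult)
  qed
qed

lemma coeff_measurable:
  "\<alpha> \<in> multi_indices n d \<Longrightarrow> (\<lambda>c. c \<alpha>) \<in> borel_measurable (coeff_measure n d)"
  using distributed_measurable[OF distributed_coeff] by simp

lemma distr_normalised_coeff:
  "distr (coeff_measure n d) (std_gauss (multi_indices n d))
     (\<lambda>c. \<lambda>\<alpha>\<in>multi_indices n d. c \<alpha> / sqrt (multinomial_coeff n d \<alpha>))
   = std_gauss (multi_indices n d)"
proof -
  let ?I = "multi_indices n d" and ?\<mu> = "coeff_measure n d"
  let ?X = "\<lambda>\<alpha> c. c \<alpha> / sqrt (multinomial_coeff n d \<alpha>)"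
  interpret prob_space ?\<mu> by (rule prob_space_coeff_measure)
  have "(\<lambda>_. 0) \<in> ?I" by (simp add: multi_indices_def)
  then have ne: "?I \<noteq> {}" by blast
  have ind: "indep_vars (\<lambda>_. borel) ?X ?I"
    using indep_coeffs by (rule indep_vars_compose2[where Y="\<lambda>\<alpha> x. x / sqrt (multinomial_coeff n d \<alpha>)"]) simp
  have law: "distr ?\<mu> borel (?X \<alpha>) = std_normal" if \<alpha>: "\<alpha> \<in> ?I" for \<alpha>
  proof -
    have s: "sqrt (multinomial_coeff n d \<alpha>) > 0" using multinomial_coeff_pos by simp
    have "distributed ?\<mu> lborel (\<lambda>c. (c \<alpha> - 0) / sqrt (multinomial_coeff n d \<alpha>)) std_normal_density"
      using normal_standard_normal_convert[OF s, of "\<lambda>c. c \<alpha>" 0] distributed_coeff[OF \<alpha>] by simp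
    then have "distr ?\<mu> lborel (?X \<alpha>) = std_normal"
      using distributed_distr_eq_density by simp
    moreover have "distr ?\<mu> borel (?X \<alpha>) = distr ?\<mu> lborel (?X \<alpha>)" by (rule distr_cong) auto
    ultimately show ?thesis by simp
  qed
  have "distr ?\<mu> (\<Pi>\<^sub>M \<alpha>\<in>?I. borel) (\<lambda>c. \<lambda>\<alpha>\<in>?I. ?X \<alpha> c) = (\<Pi>\<^sub>M \<alpha>\<in>?I. distr ?\<mu> borel (?X \<alpha>))"
    using ind ne by (subst indep_vars_iff_distr_eq_PiM'[symmetric]) (auto simp: indep_vars_def)
  also have "\<dots> = std_gauss ?I"
    using law by (intro PiM_cong) auto
  finally show ?thesis
    by (subst distr_cong[OF refl _ refl, of _ "\<Pi>\<^sub>M \<alpha>\<in>?I. borel"]) (auto intro!: sets_PiM_cong)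
qed

lemma jet_index_multi_indices: "p \<in> tri (Suc n) \<Longrightarrow> d \<ge> 2 \<Longrightarrow> jet_index p \<in> multi_indices n d"
  using jet_index_image[of d n] by auto

lemma jet_vars_measurable:
  assumes d: "d \<ge> 2"
  shows "jet_vars n d \<in> coeff_measure n d \<rightarrow>\<^sub>M std_gauss (tri (Suc n))"
  unfolding jet_vars_def[abs_def]
proof (rule measurable_restrict)
  fix p assume "p \<in> tri (Suc n)"
  then have "jet_index p \<in> multi_indices n d" using d by (rule jet_index_multi_indices)
  from coeff_measurable[OF this]
  show "(\<lambda>c. c (jet_index p) / sqrt (multinomial_coeff n d (jet_index p))) \<in> coeff_measure n d \<rightarrow>\<^sub>M std_normal"
    by simp
qed

lemma distr_jet_vars:
  assumes d: "d \<ge> 2"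
  shows "distr (coeff_measure n d) (std_gauss (tri (Suc n))) (jet_vars n d)
    = std_gauss (tri (Suc n))"
proof -
  let ?I = "multi_indices n d" and ?\<mu> = "coeff_measure n d"
  let ?N = "\<lambda>c. \<lambda>\<alpha>\<in>?I. c \<alpha> / sqrt (multinomial_coeff n d \<alpha>)"
  let ?r = "\<lambda>g. \<lambda>p\<in>tri (Suc n). g (jet_index p)"
  have N: "?N \<in> ?\<mu> \<rightarrow>\<^sub>M std_gauss ?I"
  proof (rule measurable_restrict)
    fix \<alpha> assume "\<alpha> \<in> ?I"
    from coeff_measurable[OF this]
    show "(\<lambda>c. c \<alpha> / sqrt (multinomial_coeff n d \<alpha>)) \<in> ?\<mu> \<rightarrow>\<^sub>M std_normal" by simp
  qed
  have r: "?r \<in> std_gauss ?I \<rightarrow>\<^sub>M std_gauss (tri (Suc n))"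
    by (rule measurable_restrict) (rule measurable_component_singleton[OF jet_index_multi_indices[OF _ d]])
  have "std_gauss (tri (Suc n)) = distr (std_gauss ?I) (std_gauss (tri (Suc n))) ?r"
    using d by (intro distr_PiM_reindex[symmetric] prob_space_std_normal inj_jet_index) (auto intro: jet_index_multi_indices)
  also have "\<dots> = distr (distr ?\<mu> (std_gauss ?I) ?N) (std_gauss (tri (Suc n))) ?r"
    by (simp only: distr_normalised_coeff)
  also have "\<dots> = distr ?\<mu> (std_gauss (tri (Suc n))) (?r \<circ> ?N)"
    by (rule distr_distr[OF r N])
  also have "?r \<circ> ?N = jet_vars n d"
    using d by (auto simp: fun_eq_iff jet_vars_def jet_index_multi_indices)
  finally show ?thesis ..
qed

text \<open>The shift by 2 drops the homogenising and the radial index. The added identity leaves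
  room for the third-order error made in moving the Hessian from the minimum to the chart
  centre.\<close>

definition hess_psd :: "nat \<Rightarrow> (nat \<times> nat \<Rightarrow> real) \<Rightarrow> bool" where
  "hess_psd n g \<longleftrightarrow> psd_rec (n - 1) (\<lambda>i j. goe_mat (\<lambda>p. g (fst p + 2, snd p + 2)) i j + (if i = j then 1 else 0))"

text \<open>The event that the chart centre is close to a local minimum, in terms of the normalised jet
  \<open>g\<close>. In the application \<open>A = sqrt d * r\<close>, \<open>B = sqrt (d - 1) * r / sqrt (1 + r\<^sup>2)\<close> and \<open>\<kappa>\<close>
  is proportional to the size of the cell.\<close>

definition near_crit :: "nat \<Rightarrow> real \<Rightarrow> real \<Rightarrow> real \<Rightarrow> (nat \<times> nat \<Rightarrow> real) \<Rightarrow> bool" where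
  "near_crit n A B \<kappa> g \<longleftrightarrow>
    (\<forall>j\<in>{2..n}. \<bar>g (0, j)\<bar> \<le> 2 * \<kappa> * (1 + hess_sum n g)) \<and>
    \<bar>g (0, 1) - A * g (0, 0)\<bar> \<le> \<kappa> * (B * \<bar>g (0, 1)\<bar> + 5 * (1 + hess_sum n g)) \<and> hess_psd n g"

section \<open>From a minimum in the chart to conditions on the normalised jet\<close>

lemma sum_sym_tri:
  fixes f :: "nat \<Rightarrow> nat \<Rightarrow> real"
  assumes "\<And>i j. f i j = f j i"
  shows "(\<Sum>i<m. \<Sum>j<m. f i j) = (\<Sum>p\<in>tri m. if fst p = snd p then f (fst p) (snd p) else 2 * f (fst p) (snd p))"
proof (induction m)
  case 0
  then show ?case by (simp add: tri_def)
next
  case (Suc m)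
  let ?h = "\<lambda>p. if fst p = snd p then f (fst p) (snd p) else 2 * f (fst p) (snd p)"
  have disj: "insert (m, m) (tri_col m) \<inter> tri m = {}" and mm: "(m, m) \<notin> tri_col m"
    by (auto simp: tri_def tri_col_def)
  have "(\<Sum>p\<in>tri (Suc m). ?h p) = (\<Sum>p\<in>insert (m, m) (tri_col m). ?h p) + (\<Sum>p\<in>tri m. ?h p)"
    unfolding tri_Suc by (rule sum.union_disjoint[OF _ _ disj]) simp_all
  also have "(\<Sum>p\<in>insert (m, m) (tri_col m). ?h p) = f m m + (\<Sum>p\<in>tri_col m. ?h p)"
    by (subst sum.insert[OF _ mm]) simp_all
  also have "(\<Sum>p\<in>tri_col m. ?h p) = (\<Sum>i<m. 2 * f i m)"
    unfolding tri_col_def by (subst sum.reindex) (auto simp: inj_on_def intro!: sum.cong)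
  also have "\<dots> = (\<Sum>i<m. f i m) + (\<Sum>i<m. f m i)"
    using assms[of m] by (simp add: sum_distrib_left[symmetric])
  finally show ?case
    using Suc by (simp add: sum.distrib)
qed

text \<open>Twice the quadratic Taylor part is the Hessian form. Its diagonal coefficients have
  standard deviation smaller by \<open>sqrt 2\<close>, and doubling them against the off-diagonal
  ones leaves the \<open>sqrt 2\<close> of \<open>goe_mat\<close>.\<close>

lemma goe_quadratic_form:
  assumes cg: "\<And>p. p \<in> tri (Suc n) \<Longrightarrow> cj p = jet_sd d p * g p" and n: "n \<ge> 1" and w0: "w 0 = 0"
    and v: "\<And>i. i < n - 1 \<Longrightarrow> w (Suc i) = v i"
  shows "2 * (\<Sum>p\<in>{p \<in> tri (Suc n). fst p > 0}. cj p * (hcoord 0 w (fst p) * hcoord 0 w (snd p)))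
    = sqrt (real d) * sqrt (real d - 1) * (\<Sum>i<n-1. \<Sum>j<n-1. goe_mat (\<lambda>p. g (fst p + 2, snd p + 2)) i j * v i * v j)"
proof -
  define m where "m = n - 1"
  let ?q = "sqrt (real d) * sqrt (real d - 1)"
  let ?G = "\<lambda>p. g (fst p + 2, snd p + 2)"
  let ?s = "\<lambda>p :: nat \<times> nat. (fst p + 2, snd p + 2)"
  let ?h = "\<lambda>p. cj p * (hcoord 0 w (fst p) * hcoord 0 w (snd p))"
  have sub: "?s ` tri m \<subseteq> {p \<in> tri (Suc n). fst p > 0}" using n by (auto simp: tri_def m_def)
  have zero: "?h p = 0" if p: "p \<in> {p \<in> tri (Suc n). fst p > 0} - ?s ` tri m" for p
  proof -
    obtain i k where ik: "p = (i, k)" "0 < i" "i \<le> k" "k \<le> n" using p by (cases p) (auto simp: tri_def)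
    have "i = 1"
    proof (rule ccontr)
      assume "i \<noteq> 1"
      then have "p = ?s (i - 2, k - 2)" "(i - 2, k - 2) \<in> tri m"
        using ik n by (auto simp: tri_def m_def)
      then show False using p by blast
    qed
    then show ?thesis using ik w0 by (simp add: hcoord_def)
  qed
  have "(\<Sum>p\<in>{p \<in> tri (Suc n). fst p > 0}. ?h p) = (\<Sum>p\<in>?s ` tri m. ?h p)"
    using sub zero by (intro sum.mono_neutral_right) auto
  also have "\<dots> = (\<Sum>p\<in>tri m. ?h (?s p))"
    by (subst sum.reindex) (auto simp: inj_on_def)
  finally have "2 * (\<Sum>p\<in>{p \<in> tri (Suc n). fst p > 0}. ?h p) = (\<Sum>p\<in>tri m. 2 * ?h (?s p))"
    by (simp add: sum_distrib_left)
  also have "\<dots> = (\<Sum>p\<in>tri m. ?q * (if fst p = snd p then goe_mat ?G (fst p) (snd p) * v (fst p) * v (snd p)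
      else 2 * (goe_mat ?G (fst p) (snd p) * v (fst p) * v (snd p))))"
  proof (rule sum.cong[OF refl])
    fix p assume p: "p \<in> tri m"
    obtain i k where ik: "p = (i, k)" "i \<le> k" "k < m" using p by (cases p) (auto simp: tri_def)
    have "?s p \<in> tri (Suc n)" using sub p by blast
    then have c: "cj (i + 2, k + 2) = jet_sd d (i + 2, k + 2) * g (i + 2, k + 2)"
      using cg[of "?s p"] by (simp add: ik(1))
    have h: "hcoord 0 w (i + 2) = v i" "hcoord 0 w (k + 2) = v k"
      using v[of i] v[of k] ik by (auto simp: m_def numeral_2_eq_2)
    show "2 * ?h (?s p) = ?q * (if fst p = snd p then goe_mat ?G (fst p) (snd p) * v (fst p) * v (snd p)
      else 2 * (goe_mat ?G (fst p) (snd p) * v (fst p) * v (snd p)))"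
    proof (cases "i = k")
      case True
      have "2 / sqrt 2 = sqrt (2 :: real)" by (simp add: real_div_sqrt)
      then have q2: "2 * (q / sqrt 2) = q * sqrt 2" for q :: real by (simp add: field_simps)
      have c': "cj (i + 2, k + 2) = ?q / sqrt 2 * g (i + 2, k + 2)"
        unfolding c using True by (simp add: jet_sd_def)
      have "2 * ?h (?s p) = 2 * (cj (i + 2, k + 2) * (hcoord 0 w (i + 2) * hcoord 0 w (k + 2)))"
        by (simp only: ik(1) fst_conv snd_conv)
      also have "\<dots> = (2 * (?q / sqrt 2)) * g (i + 2, k + 2) * (v i * v k)"
        unfolding c' h by (simp only: mult_ac)
      also have "\<dots> = ?q * (sqrt 2 * g (i + 2, k + 2) * v i * v k)"
        unfolding q2 by (simp only: mult_ac)
      finally show ?thesis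
        using True by (simp only: ik(1) fst_conv snd_conv goe_mat_def if_True simp_thms)
    next
      case False
      then have "min i k = i" "max i k = k" using ik by auto
      then show ?thesis
        using False c h by (simp add: ik(1) jet_sd_def goe_mat_def mult_ac)
    qed
  qed
  also have "\<dots> = ?q * (\<Sum>i<m. \<Sum>j<m. goe_mat ?G i j * v i * v j)"
    unfolding sum_distrib_left[symmetric]
    by (subst sum_sym_tri) (auto simp: goe_mat_def min.commute max.commute mult_ac)
  finally show ?thesis by (simp add: m_def)
qed

text \<open>Hypothesis \<open>small\<close> brings all terms containing the coefficient bound
  \<open>M\<close> down to the order of \<open>D\<close>. Second-order errors in the gradient cannot
  be treated this way, because they are themselves of order \<open>D\<close>; they stay as multiples
  of \<open>hess_sum\<close>, so that the resulting event does not mention \<open>M\<close>.\<close>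

lemma near_crit_of_chart:
  assumes n: "n \<ge> 1" and d: "d \<ge> 2" and r: "r \<ge> 0" and s: "s = 1 + r\<^sup>2"
    and D: "0 \<le> D" "D \<le> 1"
    and z0: "\<bar>z 0\<bar> \<le> D / sqrt s" and z: "\<And>i. i < n \<Longrightarrow> \<bar>z i\<bar> \<le> D"
    and M: "(\<Sum>\<alpha>\<in>multi_indices n d. \<bar>c \<alpha>\<bar>) \<le> M"
    and small: "2 ^ d * M * D * (2 + real d * (r + 1) * (3 * real n + 2)) \<le> 1"
    and grad: "\<And>w. w 0 = 0 \<Longrightarrow> coeff (line_poly n d c z w) 1 = 0"
    and hess: "\<And>w. w 0 = 0 \<Longrightarrow> coeff (line_poly n d c z w) 2 \<ge> 0"
    and radial: "(1 + r * z 0) * coeff (line_poly n d c z (\<lambda>i. if i = 0 then 1 else 0)) 1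
      = real d * r * coeff (line_poly n d c z (\<lambda>i. if i = 0 then 1 else 0)) 0"
  shows "near_crit n (sqrt (real d) * r) (sqrt (real d - 1) * r / sqrt s) (D * sqrt (real d - 1)) (jet_vars n d c)"
proof -
  define g where "g = jet_vars n d c"
  define cj where "cj p = c (jet_index p)" for p
  define a b where "a = sqrt (real d)" and "b = sqrt (real d - 1)"
  define H where "H = hess_sum n g"
  define M1 where "M1 = 2 ^ d * M"
  have a: "a \<ge> 1" "a * a = real d" and b: "b \<ge> 1" "b * b = real d - 1"
    using d by (auto simp: a_def b_def)
  have ab: "a * b \<ge> 1" using a b mult_mono[of 1 a 1 b] by simp
  have H0: "H \<ge> 0" unfolding H_def by (rule hess_sum_nonneg)
  have M0: "M \<ge> 0" using M by (rule order_trans[rotated]) (simp add: sum_nonneg)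
  have MM1: "M \<le> M1" unfolding M1_def using M0 by (simp add: mult_le_cancel_right1)
  have M1: "M1 \<ge> 0" using M0 by (simp add: M1_def)
  have small': "M1 * D * (2 + real d * (r + 1) * (3 * real n + 2)) \<le> 1"
    using small by (simp add: M1_def)
  have M1D: "2 * (M1 * D) \<le> 1"
  proof -
    have "M1 * D * 2 \<le> M1 * D * (2 + real d * (r + 1) * (3 * real n + 2))"
      using M1 D r by (intro mult_left_mono) auto
    then show ?thesis using small' by simp
  qed
  have cg: "cj p = jet_sd d p * g p" if p: "p \<in> tri (Suc n)" for p
  proof -
    have "jet_sd d p > 0" using multinomial_coeff_jet_index[OF p d] multinomial_coeff_pos[of n d "jet_index p"]
      by (metis real_sqrt_gt_0_iff)
    then show ?thesis using p multinomial_coeff_jet_index[OF p d] by (simp add: cj_def g_def jet_vars_def)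
  qed
  have hess_le: "hess_sum n cj \<le> a * b * H"
  proof -
    have "hess_sum n cj \<le> (\<Sum>p\<in>{p \<in> tri (Suc n). fst p > 0}. a * b * \<bar>g p\<bar>)"
      unfolding hess_sum_def
    proof (rule sum_mono)
      fix p assume p: "p \<in> {p \<in> tri (Suc n). fst p > 0}"
      have "a * b / sqrt 2 \<le> a * b" using ab by (simp add: divide_le_eq mult_le_cancel_left1)
      then have "\<bar>jet_sd d p\<bar> \<le> a * b"
        using p a b d by (auto simp: jet_sd_def a_def b_def tri_def)
      then show "\<bar>cj p\<bar> \<le> a * b * \<bar>g p\<bar>"
        using cg p by (simp add: abs_mult mult_right_mono)
    qed
    then show ?thesis by (simp add: H_def hess_sum_def sum_distrib_left)
  qed
  have hess_M: "hess_sum n cj \<le> M"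
  proof -
    have "hess_sum n cj \<le> (\<Sum>p\<in>tri (Suc n). \<bar>c (jet_index p)\<bar>)"
      unfolding hess_sum_def cj_def by (intro sum_mono2) auto
    also have "\<dots> = (\<Sum>\<alpha>\<in>jet_index ` tri (Suc n). \<bar>c \<alpha>\<bar>)"
      by (subst sum.reindex[OF inj_jet_index]) simp
    also have "\<dots> \<le> (\<Sum>\<alpha>\<in>multi_indices n d. \<bar>c \<alpha>\<bar>)"
      using d by (intro sum_mono2) (auto simp: finite_multi_indices jet_index_multi_indices)
    finally show ?thesis using M by simp
  qed
  have g0: "cj (0, 0) = g (0, 0)" using cg[of "(0, 0)"] by (simp add: tri_def jet_sd_def)
  have g0j: "cj (0, j) = a * g (0, j)" if "1 \<le> j" "j \<le> n" for j
    using cg[of "(0, j)"] that by (simp add: tri_def jet_sd_def a_def)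
  have rs: "r \<le> sqrt s" using r by (simp add: s real_le_rsqrt)
  have sqs: "sqrt s \<ge> 1" by (simp add: s)
  have grad_jet: "\<bar>coeff (line_poly n d c z (\<lambda>i. if i = j then 1 else 0)) 1 - cj (0, Suc j)\<bar>
      \<le> 2 * D * hess_sum n cj + M1 * D\<^sup>2" if "j < n" for j
    unfolding cj_def[abs_def] M1_def by (rule gradient_jet[OF d D that _ M]) (rule z)
  have lin0: "\<bar>cj (0, Suc j)\<bar> \<le> 2 * D * hess_sum n cj + M1 * D\<^sup>2" if j: "0 < j" "j < n" for j
  proof -
    have "coeff (line_poly n d c z (\<lambda>i. if i = j then 1 else 0)) 1 = 0"
      using j by (intro grad) simp
    then show ?thesis
      using grad_jet[OF j(2)] by linarith
  qed
  have MD2: "M1 * D\<^sup>2 \<le> D"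
  proof -
    have "M1 * D * D \<le> 1 * D" using M1D M1 D by (intro mult_right_mono) auto
    then show ?thesis by (simp add: power2_eq_square mult_ac)
  qed
  have cond1: "\<bar>g (0, j)\<bar> \<le> 2 * (D * b) * (1 + H)" if j: "j \<in> {2..n}" for j
  proof -
    have "a * \<bar>g (0, j)\<bar> = \<bar>cj (0, j)\<bar>" using g0j[of j] j a by (simp add: abs_mult)
    also have "\<dots> \<le> 2 * D * hess_sum n cj + M1 * D\<^sup>2" using lin0[of "j - 1"] j by (cases j) auto
    also have "\<dots> \<le> 2 * D * (a * b * H) + D * (2 * (a * b))"
    proof (intro add_mono mult_left_mono hess_le)
      have "D * 1 \<le> D * (2 * (a * b))" using ab D by (intro mult_left_mono) auto
      then show "M1 * D\<^sup>2 \<le> D * (2 * (a * b))" using MD2 by simp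
    qed (use D in auto)
    also have "\<dots> = a * (2 * (D * b) * (1 + H))" by (simp add: algebra_simps)
    finally show ?thesis using a by simp
  qed
  define p1 p0 where "p1 = coeff (line_poly n d c z (\<lambda>i. if i = 0 then 1 else 0)) 1"
    and "p0 = coeff (line_poly n d c z (\<lambda>i. if i = 0 then 1 else 0)) 0"
  define E1 E0 where "E1 = p1 - a * g (0, 1)" and "E0 = p0 - (g (0, 0) + a * g (0, 1) * z 0)"
  have E1: "\<bar>E1\<bar> \<le> 2 * D * (a * b * H) + M1 * D\<^sup>2"
  proof -
    have "\<bar>p1 - cj (0, Suc 0)\<bar> \<le> 2 * D * hess_sum n cj + M1 * D\<^sup>2"
      unfolding p1_def using n by (intro grad_jet) simp
    also have "\<dots> \<le> 2 * D * (a * b * H) + M1 * D\<^sup>2"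
      using D by (intro add_right_mono mult_left_mono hess_le) auto
    finally show ?thesis using g0j[of 1] n by (simp add: E1_def)
  qed
  have E0: "\<bar>E0\<bar> \<le> (3 * real n + 2) * (M1 * D\<^sup>2)"
  proof -
    define Gb where "Gb = 2 * D * hess_sum n cj + M1 * D\<^sup>2"
    have Gb0: "Gb \<ge> 0" using D M1 hess_sum_nonneg by (simp add: Gb_def)
    have Gb: "Gb \<le> 3 * (M1 * D)"
    proof -
      have "D * hess_sum n cj \<le> D * M1" using D hess_M MM1 by (intro mult_left_mono) auto
      moreover have "M1 * D\<^sup>2 \<le> M1 * D" using D M1 by (intro mult_left_mono) (auto simp: power2_eq_square intro: mult_left_le)
      ultimately show ?thesis by (simp add: Gb_def mult_ac)
    qed
    have "\<bar>p0 - (cj (0, 0) + cj (0, Suc 0) * z 0)\<bar> \<le> real n * Gb * D + D\<^sup>2 * hess_sum n cj + M1 * D ^ 3"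
      unfolding p0_def cj_def[abs_def] M1_def
      by (rule value_jet[OF d n D _ M _ Gb0]) (use z lin0 in \<open>simp_all add: Gb_def cj_def[abs_def]\<close>)
    also have "\<dots> \<le> real n * (3 * (M1 * D)) * D + D\<^sup>2 * M1 + M1 * D\<^sup>2"
    proof (intro add_mono mult_right_mono mult_left_mono)
      show "D ^ 3 \<le> D\<^sup>2" using D by (intro power_decreasing) auto
    qed (use D M1 Gb hess_M MM1 in auto)
    also have "\<dots> = (3 * real n + 2) * (M1 * D\<^sup>2)" by (simp add: power2_eq_square algebra_simps)
    finally show ?thesis using g0 g0j[of 1] n by (simp add: E0_def)
  qed
  have rz: "\<bar>r * z 0\<bar> \<le> r * (D / sqrt s)" using mult_left_mono[OF z0 r] r by (simp add: abs_mult)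
  have rz1: "\<bar>r * z 0\<bar> \<le> 1"
  proof -
    have "r * (D / sqrt s) = D * (r / sqrt s)" by simp
    also have "\<dots> \<le> 1 * 1" using D rs sqs r by (intro mult_mono) auto
    finally show ?thesis using rz by simp
  qed
  \<comment> \<open>The product \<open>r * z 0 * a * g (0, 1)\<close> occurs on both sides of the
    radial equation, on one of them with the factor \<open>d\<close>; the difference gives
    \<open>d - 1 = b * b\<close>.\<close>
  have key: "a * (g (0, 1) - a * r * g (0, 0))
      = (b * b) * (r * z 0) * (a * g (0, 1)) - (1 + r * z 0) * E1 + real d * r * E0"
  proof -
    have "(1 + r * z 0) * (a * g (0, 1) + E1) = real d * r * (g (0, 0) + a * g (0, 1) * z 0 + E0)"
      using radial by (simp add: E1_def E0_def p1_def p0_def)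
    then have "a * g (0, 1) - real d * r * g (0, 0)
        = (real d - 1) * (r * z 0) * (a * g (0, 1)) - (1 + r * z 0) * E1 + real d * r * E0"
      by (simp add: algebra_simps)
    moreover have "a * (g (0, 1) - a * r * g (0, 0)) = a * g (0, 1) - (a * a) * r * g (0, 0)"
      by (simp add: algebra_simps)
    ultimately show ?thesis unfolding a(2) b(2) by simp
  qed
  have "a * \<bar>g (0, 1) - a * r * g (0, 0)\<bar> = \<bar>a * (g (0, 1) - a * r * g (0, 0))\<bar>"
    using a by (simp add: abs_mult)
  also have "\<dots> \<le> \<bar>(b * b) * (r * z 0) * (a * g (0, 1))\<bar> + \<bar>(1 + r * z 0) * E1\<bar> + \<bar>real d * r * E0\<bar>"
    unfolding key by linarith
  also have "\<dots> \<le> a * (D * b * (b * r / sqrt s * \<bar>g (0, 1)\<bar>)) + 2 * (2 * D * (a * b * H) + M1 * D\<^sup>2)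
      + real d * r * ((3 * real n + 2) * (M1 * D\<^sup>2))"
  proof (intro add_mono)
    have "\<bar>(b * b) * (r * z 0) * (a * g (0, 1))\<bar> = (b * b) * \<bar>r * z 0\<bar> * (a * \<bar>g (0, 1)\<bar>)"
      using a(1) b(1) by (simp add: abs_mult)
    also have "\<dots> \<le> (b * b) * (r * (D / sqrt s)) * (a * \<bar>g (0, 1)\<bar>)"
      using a(1) b(1) by (intro mult_right_mono mult_left_mono rz) auto
    finally show "\<bar>(b * b) * (r * z 0) * (a * g (0, 1))\<bar> \<le> a * (D * b * (b * r / sqrt s * \<bar>g (0, 1)\<bar>))"
      by (simp add: mult_ac)
    have "\<bar>1 + r * z 0\<bar> \<le> 2" using rz1 by linarith
    then show "\<bar>(1 + r * z 0) * E1\<bar> \<le> 2 * (2 * D * (a * b * H) + M1 * D\<^sup>2)"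
      unfolding abs_mult using E1 by (intro mult_mono) auto
    show "\<bar>real d * r * E0\<bar> \<le> real d * r * ((3 * real n + 2) * (M1 * D\<^sup>2))"
      using r E0 by (simp add: abs_mult mult_left_mono)
  qed
  also have "\<dots> = a * (D * b * (b * r / sqrt s * \<bar>g (0, 1)\<bar>)) + 4 * D * (a * b * H)
      + D * (M1 * D * (2 + real d * r * (3 * real n + 2)))"
    by (simp add: power2_eq_square algebra_simps)
  also have "\<dots> \<le> a * (D * b * (b * r / sqrt s * \<bar>g (0, 1)\<bar>)) + 4 * D * (a * b * H) + D * (a * b)"
  proof (intro add_left_mono mult_left_mono)
    have "real d * r * (3 * real n + 2) \<le> real d * (r + 1) * (3 * real n + 2)"
      by (intro mult_right_mono mult_left_mono) auto
    then have "M1 * D * (2 + real d * r * (3 * real n + 2)) \<le> M1 * D * (2 + real d * (r + 1) * (3 * real n + 2))"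
      using M1 D by (intro mult_left_mono add_left_mono) auto
    then show "M1 * D * (2 + real d * r * (3 * real n + 2)) \<le> a * b" using small' ab by simp
  qed (use D in auto)
  \<comment> \<open>Origin of the 5 in \<open>near_crit\<close>: \<open>4 * H\<close> comes from the
    radial gradient error, 1 from all higher-order terms.\<close>
  also have "\<dots> \<le> a * (D * b * (b * r / sqrt s * \<bar>g (0, 1)\<bar> + 5 * (1 + H)))"
  proof -
    have "D * (a * b) * (4 * H + 1) \<le> D * (a * b) * (5 * (1 + H))"
      using D ab H0 by (intro mult_left_mono) auto
    then show ?thesis by (simp add: algebra_simps)
  qed
  finally have cond2: "\<bar>g (0, 1) - a * r * g (0, 0)\<bar> \<le> D * b * (b * r / sqrt s * \<bar>g (0, 1)\<bar> + 5 * (1 + H))"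
    using a by (subst (asm) mult_le_cancel_left_pos) auto
  let ?G = "goe_mat (\<lambda>p. g (fst p + 2, snd p + 2))"
  have cond3: "psd_rec (n - 1) (\<lambda>i j. ?G i j + (if i = j then 1 else 0))"
  proof (rule psd_imp_psd_rec)
    show "?G i j + (if i = j then 1 else 0) = ?G j i + (if j = i then 1 else 0)" for i j
      by (auto simp: goe_mat_def min.commute max.commute)
  next
    fix v :: "nat \<Rightarrow> real"
    define w where "w l = (if 1 \<le> l \<and> l < n then v (l - 1) else 0)" for l
    define K where "K = sqrt (\<Sum>i<n-1. (v i)\<^sup>2)"
    have K2: "K\<^sup>2 = (\<Sum>i<n-1. (v i)\<^sup>2)" by (simp add: K_def sum_nonneg)
    have K0: "K \<ge> 0" by (simp add: K_def sum_nonneg)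
    have wK: "\<bar>w i\<bar> \<le> K" for i
    proof (cases "1 \<le> i \<and> i < n")
      case True
      then have "(v (i - 1))\<^sup>2 \<le> (\<Sum>i<n-1. (v i)\<^sup>2)" by (intro member_le_sum) auto
      then have "\<bar>v (i - 1)\<bar> \<le> K" unfolding K_def by (metis real_sqrt_abs real_sqrt_le_mono)
      then show ?thesis using True by (simp add: w_def)
    next
      case False
      then show ?thesis using K0 by (auto simp: w_def)
    qed
    let ?Q = "\<Sum>p\<in>{p \<in> tri (Suc n). fst p > 0}. cj p * (hcoord 0 w (fst p) * hcoord 0 w (snd p))"
    have "\<bar>coeff (line_poly n d c z w) 2 - ?Q\<bar> \<le> M1 * D * K\<^sup>2"
      unfolding cj_def M1_def by (rule hessian_jet[OF d D K0 wK _ M]) (rule z)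
    moreover have "coeff (line_poly n d c z w) 2 \<ge> 0" by (rule hess) (simp add: w_def)
    ultimately have Q: "?Q \<ge> - (M1 * D * K\<^sup>2)" by linarith
    have "2 * ?Q = a * b * (\<Sum>i<n-1. \<Sum>j<n-1. ?G i j * v i * v j)"
      unfolding a_def b_def by (rule goe_quadratic_form[OF cg n]) (auto simp: w_def)
    \<comment> \<open>The third-order error in the form is at most the squared norm of
      \<open>v\<close>, which is the identity matrix in \<open>hess_psd\<close>.\<close>
    moreover have "2 * (M1 * D * K\<^sup>2) \<le> a * b * K\<^sup>2"
    proof -
      have "2 * (M1 * D) * K\<^sup>2 \<le> 1 * K\<^sup>2" using M1D by (intro mult_right_mono) auto
      also have "\<dots> \<le> a * b * K\<^sup>2" using ab by (intro mult_right_mono) auto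
      finally show ?thesis by simp
    qed
    ultimately have "a * b * ((\<Sum>i<n-1. \<Sum>j<n-1. ?G i j * v i * v j) + K\<^sup>2) \<ge> 0"
      using Q by (simp add: distrib_left)
    then have "(\<Sum>i<n-1. \<Sum>j<n-1. ?G i j * v i * v j) + K\<^sup>2 \<ge> 0"
      using ab by (simp add: zero_le_mult_iff)
    moreover have "(\<Sum>i<n-1. \<Sum>j<n-1. (?G i j + (if i = j then 1 else 0)) * v i * v j)
        = (\<Sum>i<n-1. \<Sum>j<n-1. ?G i j * v i * v j) + K\<^sup>2"
    proof -
      have "(\<Sum>j<n-1. (?G i j + (if i = j then 1 else 0)) * v i * v j) = (\<Sum>j<n-1. ?G i j * v i * v j) + (v i)\<^sup>2"
        if "i < n - 1" for i
      proof -
        have "(\<Sum>j<n-1. (?G i j + (if i = j then 1 else 0)) * v i * v j)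
            = (\<Sum>j<n-1. ?G i j * v i * v j + (if j = i then (v i)\<^sup>2 else 0))"
          by (intro sum.cong) (auto simp: algebra_simps power2_eq_square)
        then show ?thesis using that by (simp add: sum.distrib)
      qed
      then show ?thesis unfolding K2 by (simp add: sum.distrib)
    qed
    ultimately show "(\<Sum>i<n-1. \<Sum>j<n-1. (?G i j + (if i = j then 1 else 0)) * v i * v j) \<ge> 0" by simp
  qed
  show ?thesis
    using cond1 cond2 cond3 unfolding near_crit_def hess_psd_def g_def[symmetric] H_def[symmetric] a_def[symmetric] b_def[symmetric]
    by auto
qed

section \<open>The probability of a nearly critical jet\<close>

lemma std_normal_interval_le: "emeasure std_normal {t. \<bar>t - y\<bar> \<le> w} \<le> ennreal w"
proof -
  have dens: "std_normal_density t \<le> 1 / 2" for t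
  proof -
    have "sqrt 4 \<le> sqrt (2 * pi)" using pi_ge_two by (intro real_sqrt_le_mono) simp
    then have "1 / sqrt (2 * pi) \<le> 1 / 2" by (intro divide_left_mono) auto
    moreover have "exp (- t\<^sup>2 / 2) \<le> 1" by simp
    ultimately have "1 / sqrt (2 * pi) * exp (- t\<^sup>2 / 2) \<le> 1 / 2 * 1"
      by (intro mult_mono) auto
    then show ?thesis by (simp add: std_normal_density_def)
  qed
  have set: "{t. \<bar>t - y\<bar> \<le> w} = {y - w..y + w}" by auto
  have "emeasure std_normal {t. \<bar>t - y\<bar> \<le> w}
      = (\<integral>\<^sup>+t. ennreal (std_normal_density t) * indicator {y - w..y + w} t \<partial>lborel)"
    unfolding set by (subst emeasure_density) auto
  also have "\<dots> \<le> (\<integral>\<^sup>+t. ennreal (1 / 2) * indicator {y - w..y + w} t \<partial>lborel)"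
    using dens by (intro nn_integral_mono mult_right_mono ennreal_leI) auto
  also have "\<dots> = ennreal (1 / 2) * emeasure lborel {y - w..y + w}"
    by (rule nn_integral_cmult_indicator) simp
  also have "\<dots> \<le> ennreal w"
  proof (cases "w \<ge> 0")
    case True
    then have "ennreal (1 / 2) * emeasure lborel {y - w..y + w} = ennreal (1 / 2 * (2 * w))"
      by (subst ennreal_mult) auto
    then show ?thesis by simp
  qed simp
  finally show ?thesis .
qed

lemma nn_integral_PiM_component:
  assumes "i \<in> I" and f: "f \<in> borel_measurable borel"
  shows "(\<integral>\<^sup>+g. f (g i) \<partial>std_gauss I) = (\<integral>\<^sup>+t. f t \<partial>std_normal)"
proof -
  have "distr (std_gauss I) std_normal (\<lambda>g. g i) = std_normal"
    using assms(1) by (intro distr_PiM_component prob_space_std_normal)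
  then have "(\<integral>\<^sup>+t. f t \<partial>std_normal) = (\<integral>\<^sup>+t. f t \<partial>distr (std_gauss I) std_normal (\<lambda>g. g i))"
    by simp
  also have "\<dots> = (\<integral>\<^sup>+g. f (g i) \<partial>std_gauss I)"
    using assms by (intro nn_integral_distr measurable_component_singleton) auto
  finally show ?thesis ..
qed

lemma pred_le_real:
  fixes f h :: "'a \<Rightarrow> real"
  assumes [measurable]: "f \<in> borel_measurable M" "h \<in> borel_measurable M"
  shows "Measurable.pred M (\<lambda>g. f g \<le> h g)"
  by measurable

lemma indicator_pred_measurable:
  assumes [measurable]: "Measurable.pred M P"
  shows "(\<lambda>g. indicator {g. P g} g :: ennreal) \<in> borel_measurable M"
  by (simp add: indicator_def)

lemma indicator_le_measurable:
  fixes f h :: "'a \<Rightarrow> real"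
  assumes [measurable]: "f \<in> borel_measurable M" "h \<in> borel_measurable M"
  shows "(\<lambda>g. indicator {g. f g \<le> h g} g :: ennreal) \<in> borel_measurable M"
  by (simp add: indicator_def)

text \<open>Conditionally on the other coordinates the condition is an interval of length
  \<open>2 * w\<close> for a standard normal variable, whose density is at most 1/2.\<close>

lemma integrate_out_coordinate:
  assumes I: "finite I" "i \<in> I"
    and meas: "y \<in> borel_measurable (std_gauss I)" "w \<in> borel_measurable (std_gauss I)"
      "\<Phi> \<in> borel_measurable (std_gauss I)"
    and indep: "\<And>g t. y (g(i := t)) = y g" "\<And>g t. w (g(i := t)) = w g" "\<And>g t. \<Phi> (g(i := t)) = \<Phi> g"
  shows "(\<integral>\<^sup>+g. indicator {g. \<bar>g i - y g\<bar> \<le> w g} g * \<Phi> g \<partial>std_gauss I)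
    \<le> (\<integral>\<^sup>+g. ennreal (w g) * \<Phi> g \<partial>std_gauss I)"
proof -
  define J where "J = I - {i}"
  have J: "finite J" "i \<notin> J" "I = insert i J" using I by (auto simp: J_def)
  note meas' = meas[unfolded J(3)]
  have comp: "(\<lambda>g. g i) \<in> borel_measurable (std_gauss (insert i J))"
    using measurable_component_singleton[of i "insert i J" "\<lambda>_. std_normal"] by simp
  have lhs_meas: "(\<lambda>g. indicator {g. \<bar>g i - y g\<bar> \<le> w g} g * \<Phi> g) \<in> borel_measurable (std_gauss (insert i J))"
    by (intro borel_measurable_times_ennreal indicator_le_measurable borel_measurable_abs borel_measurable_diff comp meas')
  have rhs_meas: "(\<lambda>g. ennreal (w g) * \<Phi> g) \<in> borel_measurable (std_gauss (insert i J))"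
    by (intro borel_measurable_times_ennreal measurable_compose[OF meas'(2) measurable_ennreal] meas'(3))
  have "(\<integral>\<^sup>+g. indicator {g. \<bar>g i - y g\<bar> \<le> w g} g * \<Phi> g \<partial>std_gauss I)
      = (\<integral>\<^sup>+x. \<integral>\<^sup>+t. indicator {g. \<bar>g i - y g\<bar> \<le> w g} (x(i := t)) * \<Phi> (x(i := t)) \<partial>std_normal \<partial>std_gauss J)"
    unfolding J(3) by (rule std_normal_prod.product_nn_integral_insert[OF J(1,2) lhs_meas])
  also have "\<dots> = (\<integral>\<^sup>+x. \<integral>\<^sup>+t. \<Phi> x * indicator {t. \<bar>t - y x\<bar> \<le> w x} t \<partial>std_normal \<partial>std_gauss J)"
    using indep by (intro nn_integral_cong) (simp add: indicator_def mult.commute)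
  also have "\<dots> = (\<integral>\<^sup>+x. \<Phi> x * emeasure std_normal {t. \<bar>t - y x\<bar> \<le> w x} \<partial>std_gauss J)"
    by (intro nn_integral_cong nn_integral_cmult_indicator) simp
  also have "\<dots> \<le> (\<integral>\<^sup>+x. \<Phi> x * ennreal (w x) \<partial>std_gauss J)"
    by (intro nn_integral_mono mult_left_mono std_normal_interval_le) simp
  also have "\<dots> = (\<integral>\<^sup>+x. \<integral>\<^sup>+t. ennreal (w (x(i := t))) * \<Phi> (x(i := t)) \<partial>std_normal \<partial>std_gauss J)"
  proof (rule nn_integral_cong)
    fix x
    interpret prob_space std_normal by (rule prob_space_std_normal)
    show "\<Phi> x * ennreal (w x) = (\<integral>\<^sup>+t. ennreal (w (x(i := t))) * \<Phi> (x(i := t)) \<partial>std_normal)"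
      unfolding indep using emeasure_space_1 by (simp add: mult.commute)
  qed
  also have "\<dots> = (\<integral>\<^sup>+g. ennreal (w g) * \<Phi> g \<partial>std_gauss I)"
    unfolding J(3) by (rule std_normal_prod.product_nn_integral_insert[OF J(1,2) rhs_meas, symmetric])
  finally show ?thesis .
qed

lemma integrate_out_coordinates:
  assumes I: "finite I"
    and u: "u \<in> borel_measurable (std_gauss I)"
  shows "finite J \<Longrightarrow> J \<subseteq> I \<Longrightarrow> (\<And>j g t. j \<in> J \<Longrightarrow> u (g(j := t)) = u g) \<Longrightarrow>
    (\<And>j g t. j \<in> J \<Longrightarrow> \<Phi> (g(j := t)) = \<Phi> g) \<Longrightarrow> \<Phi> \<in> borel_measurable (std_gauss I) \<Longrightarrow>
    (\<integral>\<^sup>+g. (\<Prod>j\<in>J. indicator {g. \<bar>g j\<bar> \<le> u g} g) * \<Phi> g \<partial>std_gauss I)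
    \<le> (\<integral>\<^sup>+g. ennreal (u g) ^ card J * \<Phi> g \<partial>std_gauss I)"
proof (induction J arbitrary: \<Phi> rule: finite_induct)
  case (insert k J)
  have comp: "(\<lambda>g. g j) \<in> borel_measurable (std_gauss I)" if "j \<in> I" for j
    using measurable_component_singleton[OF that, of "\<lambda>_. std_normal"] by simp
  have ind: "(\<lambda>g. indicator {g. \<bar>g j\<bar> \<le> u g} g :: ennreal) \<in> borel_measurable (std_gauss I)" if "j \<in> I" for j
    by (intro indicator_le_measurable borel_measurable_abs comp that u)
  let ?\<Psi> = "\<lambda>g. (\<Prod>j\<in>J. indicator {g. \<bar>g j\<bar> \<le> u g} g) * \<Phi> g"
  have \<Psi>: "?\<Psi> \<in> borel_measurable (std_gauss I)"
    using insert.prems by (intro borel_measurable_times_ennreal borel_measurable_prod_ennreal ind) auto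
  have \<Psi>_indep: "?\<Psi> (g(k := t)) = ?\<Psi> g" for g t
  proof -
    have upd: "u (g(k := t)) = u g" "\<Phi> (g(k := t)) = \<Phi> g"
      by (rule insert.prems(2) insert.prems(3); simp)+
    have "(\<Prod>j\<in>J. indicator {g. \<bar>g j\<bar> \<le> u g} (g(k := t)) :: ennreal) = (\<Prod>j\<in>J. indicator {g. \<bar>g j\<bar> \<le> u g} g)"
      using insert.hyps by (intro prod.cong refl) (simp only: indicator_def mem_Collect_eq upd, auto)
    then show ?thesis by (simp only: upd)
  qed
  have "(\<integral>\<^sup>+g. (\<Prod>j\<in>insert k J. indicator {g. \<bar>g j\<bar> \<le> u g} g) * \<Phi> g \<partial>std_gauss I)
      = (\<integral>\<^sup>+g. indicator {g. \<bar>g k - 0\<bar> \<le> u g} g * ?\<Psi> g \<partial>std_gauss I)"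
    using insert.hyps by (simp add: mult.assoc)
  also have "\<dots> \<le> (\<integral>\<^sup>+g. ennreal (u g) * ?\<Psi> g \<partial>std_gauss I)"
  proof (rule integrate_out_coordinate[OF I _ _ u \<Psi> _ _ \<Psi>_indep])
    show "k \<in> I" using insert.prems(1) by simp
    show "u (g(k := t)) = u g" for g t by (rule insert.prems(2)) simp
  qed simp_all
  also have "\<dots> = (\<integral>\<^sup>+g. (\<Prod>j\<in>J. indicator {g. \<bar>g j\<bar> \<le> u g} g) * (ennreal (u g) * \<Phi> g) \<partial>std_gauss I)"
    by (simp add: mult_ac)
  also have "\<dots> \<le> (\<integral>\<^sup>+g. ennreal (u g) ^ card J * (ennreal (u g) * \<Phi> g) \<partial>std_gauss I)"
  proof (rule insert.IH)
    show "J \<subseteq> I" using insert.prems(1) by simp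
    fix j g t assume j: "j \<in> J"
    show u': "u (g(j := t)) = u g" by (rule insert.prems(2)) (use j in simp)
    have "\<Phi> (g(j := t)) = \<Phi> g" by (rule insert.prems(3)) (use j in simp)
    then show "ennreal (u (g(j := t))) * \<Phi> (g(j := t)) = ennreal (u g) * \<Phi> g" by (simp only: u')
  next
    show "(\<lambda>g. ennreal (u g) * \<Phi> g) \<in> borel_measurable (std_gauss I)"
      by (intro borel_measurable_times_ennreal measurable_compose[OF u measurable_ennreal] insert.prems(4))
  qed
  also have "\<dots> = (\<integral>\<^sup>+g. ennreal (u g) ^ card (insert k J) * \<Phi> g \<partial>std_gauss I)"
    using insert.hyps by (simp add: mult_ac)
  finally show ?case .
qed simp

section \<open>Moments of the jet and the probability of the Hessian condition\<close>

lemma card_tri: "2 * card (tri m) = m * (m + 1)"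
proof (induction m)
  case 0
  have "tri 0 = {}" by (auto simp: tri_def)
  then show ?case by simp
qed (simp add: card_tri_Suc)

lemma card_tri_le:
  assumes "n \<ge> 1"
  shows "card (tri (Suc n)) \<le> 3 * n\<^sup>2"
proof -
  have "2 * card (tri (Suc n)) = n * n + 3 * n + 2" using card_tri[of "Suc n"] by (simp add: algebra_simps)
  moreover have "n \<le> n * n" "1 \<le> n * n" using assms by auto
  ultimately show ?thesis unfolding power2_eq_square by linarith
qed

lemma ennreal_le_sqrt:
  assumes "x\<^sup>2 \<le> ennreal c" "c \<ge> 0"
  shows "x \<le> ennreal (sqrt c)"
proof (cases x)
  case (real r)
  then have "r\<^sup>2 \<le> c" using assms by (simp add: ennreal_power)
  then have "r \<le> sqrt c" by (rule real_le_rsqrt)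
  then show ?thesis using real by (simp add: ennreal_leI)
next
  case top
  then show ?thesis using assms by (simp add: top_unique)
qed

text \<open>A loss of order \<open>exp (C * n * ln n)\<close> is harmless against a Gaussian factor
  in \<open>n\<close>. The exponent \<open>2 * n\<close> is the square of the \<open>n\<close>-th
  power that Cauchy-Schwarz will produce.\<close>

lemma moment_sum_le:
  assumes n: "n \<ge> 1"
  shows "(\<integral>\<^sup>+g. ennreal ((1 + (\<Sum>p\<in>tri (Suc n). \<bar>g p\<bar>)) ^ (2 * n)) \<partial>std_gauss (tri (Suc n)))
    \<le> ennreal ((4 * (real n)\<^sup>2) ^ (2 * n + 1) * (2 * real n) ^ (2 * n))"
proof -
  let ?T = "tri (Suc n)"
  let ?M = "std_gauss ?T"
  interpret prob_space ?M by (intro prob_space_PiM prob_space_std_normal)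
  define N where "N = 1 + real (card ?T)"
  have N: "N \<le> 4 * (real n)\<^sup>2" "N \<ge> 1"
  proof -
    have "real (card ?T) \<le> real (3 * n\<^sup>2)" using card_tri_le[OF n] by (rule of_nat_mono)
    moreover have "1 \<le> (real n)\<^sup>2" using n by simp
    ultimately show "N \<le> 4 * (real n)\<^sup>2" by (simp add: N_def)
  qed (simp add: N_def)
  have pointwise: "(1 + (\<Sum>p\<in>?T. \<bar>g p\<bar>)) ^ (2 * n) \<le> N ^ (2 * n) * (1 + (\<Sum>p\<in>?T. (g p) ^ (2 * n)))" for g :: "nat \<times> nat \<Rightarrow> real"
  proof -
    define Z where "Z = 1 + (\<Sum>p\<in>?T. (g p) ^ (2 * n))"
    have Z: "Z \<ge> 1" unfolding Z_def by (simp add: sum_nonneg)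
    \<comment> \<open>A common upper bound for 1 and all \<open>\<bar>g p\<bar>\<close> whose
      \<open>2 * n\<close>-th power is a sum of moments.\<close>
    define X where "X = root (2 * n) Z"
    have X: "X \<ge> 1" "X ^ (2 * n) = Z" using Z n by (simp_all add: X_def)
    have "\<bar>g p\<bar> \<le> X" if "p \<in> ?T" for p
    proof (rule power_le_imp_le_base)
      have "(g p) ^ (2 * n) \<le> (\<Sum>p\<in>?T. (g p) ^ (2 * n))"
        using that by (intro member_le_sum) auto
      then have "\<bar>g p\<bar> ^ (2 * n) \<le> X ^ (2 * n)" unfolding X(2) Z_def by (simp add: power_even_abs)
      then show "\<bar>g p\<bar> ^ Suc (2 * n - 1) \<le> X ^ Suc (2 * n - 1)" using n by simp
    qed (use X in simp)
    then have "(\<Sum>p\<in>?T. \<bar>g p\<bar>) \<le> (\<Sum>p\<in>?T. X)" by (rule sum_mono)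
    then have "1 + (\<Sum>p\<in>?T. \<bar>g p\<bar>) \<le> N * X" using X by (simp add: N_def algebra_simps)
    then have "(1 + (\<Sum>p\<in>?T. \<bar>g p\<bar>)) ^ (2 * n) \<le> (N * X) ^ (2 * n)"
      by (intro power_mono) (auto intro!: add_nonneg_nonneg sum_nonneg)
    then show ?thesis by (simp add: power_mult_distrib X Z_def)
  qed
  have moment: "(\<integral>\<^sup>+g. ennreal ((g p) ^ (2 * n)) \<partial>?M) \<le> ennreal (fact (2 * n))" if p: "p \<in> ?T" for p
  proof -
    have "(\<integral>\<^sup>+g. ennreal ((g p) ^ (2 * n)) \<partial>?M) = (\<integral>\<^sup>+t. ennreal (t ^ (2 * n)) \<partial>std_normal)"
      using p by (intro nn_integral_PiM_component[where f="\<lambda>t. ennreal (t ^ (2 * n))"]) auto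
    also have "\<dots> = (\<integral>\<^sup>+t. ennreal (std_normal_density t * t ^ (2 * n)) \<partial>lborel)"
      by (subst nn_integral_density) (auto simp: ennreal_mult)
    also have "\<dots> = ennreal (fact (2 * n) / (2 ^ n * fact n))"
      using std_normal_moment_even[of n]
      by (subst nn_integral_eq_integral) (auto simp: has_bochner_integral_iff)
    also have "\<dots> \<le> ennreal (fact (2 * n))"
    proof (rule ennreal_leI)
      have "(1 :: real) * 1 \<le> 2 ^ n * fact n" by (intro mult_mono) (auto simp: fact_ge_1)
      then show "fact (2 * n) / (2 ^ n * fact n) \<le> (fact (2 * n) :: real)" by (simp add: divide_le_eq)
    qed
    finally show ?thesis .
  qed
  have comp: "(\<lambda>g. ennreal ((g p) ^ (2 * n))) \<in> borel_measurable ?M" if "p \<in> ?T" for p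
  proof -
    have [measurable]: "(\<lambda>g. g p) \<in> borel_measurable ?M"
      using measurable_component_singleton[OF that, of "\<lambda>_. std_normal"] by simp
    show ?thesis by measurable
  qed
  have "(\<integral>\<^sup>+g. ennreal ((1 + (\<Sum>p\<in>?T. \<bar>g p\<bar>)) ^ (2 * n)) \<partial>?M)
      \<le> (\<integral>\<^sup>+g. ennreal (N ^ (2 * n)) * (1 + (\<Sum>p\<in>?T. ennreal ((g p) ^ (2 * n)))) \<partial>?M)"
  proof (rule nn_integral_mono)
    fix g :: "nat \<times> nat \<Rightarrow> real"
    have "ennreal ((1 + (\<Sum>p\<in>?T. \<bar>g p\<bar>)) ^ (2 * n)) \<le> ennreal (N ^ (2 * n) * (1 + (\<Sum>p\<in>?T. (g p) ^ (2 * n))))"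
      by (rule ennreal_leI[OF pointwise])
    also have "\<dots> = ennreal (N ^ (2 * n)) * (1 + (\<Sum>p\<in>?T. ennreal ((g p) ^ (2 * n))))"
      using N by (simp add: ennreal_mult sum_nonneg sum_ennreal flip: ennreal_1 ennreal_plus)
    finally show "ennreal ((1 + (\<Sum>p\<in>?T. \<bar>g p\<bar>)) ^ (2 * n)) \<le> ennreal (N ^ (2 * n)) * (1 + (\<Sum>p\<in>?T. ennreal ((g p) ^ (2 * n))))" .
  qed
  also have "\<dots> = ennreal (N ^ (2 * n)) * (1 + (\<Sum>p\<in>?T. \<integral>\<^sup>+g. ennreal ((g p) ^ (2 * n)) \<partial>?M))"
  proof -
    have meas: "(\<lambda>g. \<Sum>p\<in>?T. ennreal ((g p) ^ (2 * n))) \<in> borel_measurable ?M"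
      by (intro borel_measurable_sum comp)
    have "(\<integral>\<^sup>+g. 1 + (\<Sum>p\<in>?T. ennreal ((g p) ^ (2 * n))) \<partial>?M)
        = (\<integral>\<^sup>+g. 1 \<partial>?M) + (\<integral>\<^sup>+g. (\<Sum>p\<in>?T. ennreal ((g p) ^ (2 * n))) \<partial>?M)"
      by (rule nn_integral_add) (simp, rule meas)
    also have "(\<integral>\<^sup>+g. 1 \<partial>?M) = 1" using emeasure_space_1 by simp
    also have "(\<integral>\<^sup>+g. (\<Sum>p\<in>?T. ennreal ((g p) ^ (2 * n))) \<partial>?M) = (\<Sum>p\<in>?T. \<integral>\<^sup>+g. ennreal ((g p) ^ (2 * n)) \<partial>?M)"
      by (rule nn_integral_sum[OF comp])
    finally have "(\<integral>\<^sup>+g. 1 + (\<Sum>p\<in>?T. ennreal ((g p) ^ (2 * n))) \<partial>?M) = 1 + (\<Sum>p\<in>?T. \<integral>\<^sup>+g. ennreal ((g p) ^ (2 * n)) \<partial>?M)" .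
    moreover have "(\<integral>\<^sup>+g. ennreal (N ^ (2 * n)) * (1 + (\<Sum>p\<in>?T. ennreal ((g p) ^ (2 * n)))) \<partial>?M)
        = ennreal (N ^ (2 * n)) * (\<integral>\<^sup>+g. 1 + (\<Sum>p\<in>?T. ennreal ((g p) ^ (2 * n))) \<partial>?M)"
      by (rule nn_integral_cmult) (intro borel_measurable_add meas, simp)
    ultimately show ?thesis by (simp only:)
  qed
  also have "\<dots> \<le> ennreal (N ^ (2 * n)) * (1 + (\<Sum>p\<in>?T. ennreal (fact (2 * n))))"
    by (intro mult_left_mono add_left_mono sum_mono moment) auto
  also have "\<dots> = ennreal (N ^ (2 * n) * (1 + real (card ?T) * fact (2 * n)))"
  proof -
    have "(\<Sum>p\<in>?T. ennreal (fact (2 * n))) = ennreal (\<Sum>p\<in>?T. fact (2 * n))"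
      by (rule sum_ennreal) simp
    then have "1 + (\<Sum>p\<in>?T. ennreal (fact (2 * n))) = ennreal 1 + ennreal (real (card ?T) * fact (2 * n))"
      by simp
    also have "\<dots> = ennreal (1 + real (card ?T) * fact (2 * n))"
      by (rule ennreal_plus[symmetric]) auto
    finally show ?thesis using N by (simp add: ennreal_mult)
  qed
  also have "\<dots> \<le> ennreal ((4 * (real n)\<^sup>2) ^ (2 * n + 1) * (2 * real n) ^ (2 * n))"
  proof (rule ennreal_leI)
    have "1 + real (card ?T) * fact (2 * n) \<le> N * fact (2 * n)"
      using fact_ge_1[of "2 * n", where 'a=real] by (simp add: N_def algebra_simps)
    also have "\<dots> \<le> N * (2 * real n) ^ (2 * n)"
    proof (rule mult_left_mono)
      have "(fact (2 * n) :: real) \<le> of_nat ((2 * n) ^ (2 * n))" by (rule fact_le_power)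
      then show "fact (2 * n) \<le> (2 * real n) ^ (2 * n)" by simp
    qed (use N in simp)
    finally have "N ^ (2 * n) * (1 + real (card ?T) * fact (2 * n)) \<le> N ^ (2 * n) * (N * (2 * real n) ^ (2 * n))"
      using N by (intro mult_left_mono) auto
    also have "\<dots> = N ^ (2 * n + 1) * (2 * real n) ^ (2 * n)" by simp
    also have "\<dots> \<le> (4 * (real n)\<^sup>2) ^ (2 * n + 1) * (2 * real n) ^ (2 * n)"
      using N by (intro mult_right_mono power_mono) auto
    finally show "N ^ (2 * n) * (1 + real (card ?T) * fact (2 * n)) \<le> (4 * (real n)\<^sup>2) ^ (2 * n + 1) * (2 * real n) ^ (2 * n)" .
  qed
  finally show ?thesis .
qed

lemma shift_tri:
  assumes "n \<ge> 1" "p \<in> tri (n - 1)"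
  shows "(fst p + 2, snd p + 2) \<in> tri (Suc n)"
  using assms by (auto simp: tri_def)

lemma shift_measurable:
  assumes n: "n \<ge> 1"
  shows "(\<lambda>g. \<lambda>p\<in>tri (n - 1). g (fst p + 2, snd p + 2)) \<in> std_gauss (tri (Suc n)) \<rightarrow>\<^sub>M std_gauss (tri (n - 1))"
  by (rule measurable_restrict) (rule measurable_component_singleton[OF shift_tri[OF n]])

lemma hess_psd_shift:
  "hess_psd n g \<longleftrightarrow> psd_rec (n - 1) (\<lambda>i j. goe_mat (\<lambda>p\<in>tri (n - 1). g (fst p + 2, snd p + 2)) i j + (if i = j then 1 else 0))"
  unfolding hess_psd_def by (rule psd_rec_cong) (auto simp: goe_mat_def tri_def min_def max_def)

lemma goe_psd_pred:
  "Measurable.pred (std_gauss (tri m)) (\<lambda>g. psd_rec m (\<lambda>i j. goe_mat g i j + (if i = j then 1 else 0)))"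
  by (intro measurable_psd_rec borel_measurable_add goe_mat_measurable measurable_const) auto

lemma hess_psd_pred:
  assumes n: "n \<ge> 1"
  shows "Measurable.pred (std_gauss (tri (Suc n))) (hess_psd n)"
  unfolding hess_psd_shift[abs_def] by (rule measurable_compose[OF shift_measurable[OF n] goe_psd_pred])

lemma hess_psd_prob:
  assumes n: "n \<ge> 1"
  shows "(\<integral>\<^sup>+g. indicator {g. hess_psd n g} g \<partial>std_gauss (tri (Suc n)))
    \<le> ennreal (exp (- (real (n - 1))\<^sup>2 / 12 + 3 * real (n - 1) / 2 + real (n - 1) * sqrt (1 + real (n - 1))))"
proof -
  let ?r = "\<lambda>g. \<lambda>p\<in>tri (n - 1). g (fst p + 2, snd p + 2)"
  let ?P = "{g. psd_rec (n - 1) (\<lambda>i j. goe_mat g i j + (if i = j then 1 else 0))}"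
  have "(\<integral>\<^sup>+g. indicator {g. hess_psd n g} g \<partial>std_gauss (tri (Suc n)))
      = (\<integral>\<^sup>+g. indicator ?P (?r g) \<partial>std_gauss (tri (Suc n)))"
    by (intro nn_integral_cong) (simp add: indicator_def hess_psd_shift)
  also have "\<dots> = (\<integral>\<^sup>+g. indicator ?P g \<partial>distr (std_gauss (tri (Suc n))) (std_gauss (tri (n - 1))) ?r)"
  proof (rule nn_integral_distr[OF shift_measurable[OF n], symmetric])
    note [measurable] = goe_psd_pred[of "n - 1"]
    have "indicator ?P \<in> borel_measurable (std_gauss (tri (n - 1)))"
      by (simp add: indicator_def[abs_def])
    then show "indicator ?P \<in> borel_measurable (distr (std_gauss (tri (Suc n))) (std_gauss (tri (n - 1))) ?r)"
      by simp
  qed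
  also have "distr (std_gauss (tri (Suc n))) (std_gauss (tri (n - 1))) ?r = std_gauss (tri (n - 1))"
    using shift_tri[OF n] by (intro distr_PiM_reindex prob_space_std_normal) (auto simp: inj_on_def)
  also have "(\<integral>\<^sup>+g. indicator ?P g \<partial>std_gauss (tri (n - 1)))
      \<le> ennreal (exp (- (real (n - 1))\<^sup>2 / 12 + 3 * real (n - 1) / 2 + real (n - 1) * sqrt (1 + real (n - 1))))"
    by (rule goe_psd_prob)
  finally show ?thesis .
qed

text \<open>The factor \<open>15 * 2 ^ n\<close> comes from the interval widths. The square root
  comes from Cauchy-Schwarz, applied to the moment bound and the probability bound for
  semidefiniteness.\<close>

definition crit_const :: "nat \<Rightarrow> real" where
  "crit_const n = 15 * 2 ^ n * sqrt ((4 * (real n)\<^sup>2) ^ (2 * n + 1) * (2 * real n) ^ (2 * n)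
     * exp (- (real (n - 1))\<^sup>2 / 12 + 3 * real (n - 1) / 2 + real (n - 1) * sqrt (1 + real (n - 1))))"

lemma hess_sum_measurable [measurable]:
  "hess_sum n \<in> borel_measurable (std_gauss (tri (Suc n)))"
proof -
  have "(\<lambda>g. g p) \<in> borel_measurable (std_gauss (tri (Suc n)))" if "p \<in> tri (Suc n)" for p
    using measurable_component_singleton[OF that, of "\<lambda>_. std_normal"] by simp
  then show ?thesis
    unfolding hess_sum_def[abs_def] by (intro borel_measurable_sum borel_measurable_abs) auto
qed

lemma hess_sum_upd: "hess_sum n (g((0, j) := t)) = hess_sum n g"
  unfolding hess_sum_def by (intro sum.cong) auto

lemma hess_psd_upd: "hess_psd n (g((0, j) := t)) = hess_psd n g"
  unfolding hess_psd_def by (rule psd_rec_cong) (auto simp: goe_mat_def)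

lemma near_crit_pred:
  assumes n: "n \<ge> 1"
  shows "Measurable.pred (std_gauss (tri (Suc n))) (near_crit n A B \<kappa>)"
proof -
  define M where "M = std_gauss (tri (Suc n))"
  have comp: "(\<lambda>g. g (0, j)) \<in> borel_measurable M" if "j \<le> n" for j
    using measurable_component_singleton[of "(0, j)" "tri (Suc n)" "\<lambda>_. std_normal"] that by (simp add: tri_def M_def)
  have hs: "hess_sum n \<in> borel_measurable M" unfolding M_def by (rule hess_sum_measurable)
  have [measurable]: "Measurable.pred M (\<lambda>g. \<forall>j\<in>{2..n}. \<bar>g (0, j)\<bar> \<le> 2 * \<kappa> * (1 + hess_sum n g))"
    by (intro pred_intros_finite pred_le_real borel_measurable_abs borel_measurable_times
        borel_measurable_add borel_measurable_const comp hs) auto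
  have [measurable]: "Measurable.pred M (\<lambda>g. \<bar>g (0, 1) - A * g (0, 0)\<bar> \<le> \<kappa> * (B * \<bar>g (0, 1)\<bar> + 5 * (1 + hess_sum n g)))"
    by (intro pred_le_real borel_measurable_abs borel_measurable_times borel_measurable_diff
        borel_measurable_add borel_measurable_const comp hs) (use n in auto)
  note [measurable] = hess_psd_pred[OF n, folded M_def]
  show ?thesis
    unfolding near_crit_def[abs_def] M_def[symmetric] by measurable
qed

text \<open>The gradient coordinates are integrated out first, each with a density bounded by 1. In the
  radial direction \<open>g (0, 0)\<close> is used when \<open>A \<ge> 1\<close> and \<open>g (0, 1)\<close> otherwise.\<close>

lemma near_crit_prob:
  assumes n: "n \<ge> 1" and d: "d \<ge> 2" and r: "r \<ge> 0" and s: "s = 1 + r\<^sup>2" and k: "0 \<le> \<kappa>" "\<kappa> \<le> 1 / 2"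
  defines "A \<equiv> sqrt (real d) * r" and "B \<equiv> sqrt (real d - 1) * r / sqrt s"
  shows "emeasure (std_gauss (tri (Suc n))) {g \<in> space (std_gauss (tri (Suc n))). near_crit n A B \<kappa> g}
    \<le> ennreal (crit_const n * \<kappa> ^ n / sqrt s)"
proof -
  let ?T = "tri (Suc n)"
  define M where "M = std_gauss ?T"
  let ?J = "(\<lambda>j. (0 :: nat, j)) ` {2..n}"
  define L where "L g = 1 + hess_sum n g" for g
  define S where "S g = 1 + (\<Sum>p\<in>?T. \<bar>g p\<bar>)" for g :: "nat \<times> nat \<Rightarrow> real"
  define \<Psi> where "\<Psi> g = (indicator {g. hess_psd n g} g :: ennreal)" for g
  define W where "W g = (indicator {g. \<bar>g (0, 1) - A * g (0, 0)\<bar> \<le> \<kappa> * (B * \<bar>g (0, 1)\<bar> + 5 * L g)} g :: ennreal)" for g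
  \<comment> \<open>15 is 10 times 3/2: the 10 is the constant 5 of \<open>near_crit\<close>
    doubled, and 3/2 bounds \<open>sqrt s\<close> in the case \<open>A < 1\<close>. The other case
    fits into the same constant.\<close>
  define c where "c = 15 * \<kappa> / sqrt s"
  have sq: "s \<ge> 1" "sqrt s \<ge> 1" by (simp_all add: s)
  have c0: "c \<ge> 0" using k sq by (simp add: c_def)
  have L1: "L g \<ge> 1" for g using hess_sum_nonneg[of n g] by (simp add: L_def)
  have comp: "(\<lambda>g. g (0, j)) \<in> borel_measurable M" if "j \<le> n" for j
    using measurable_component_singleton[of "(0, j)" ?T "\<lambda>_. std_normal"] that by (simp add: tri_def M_def)
  have hs: "hess_sum n \<in> borel_measurable M" unfolding M_def by (rule hess_sum_measurable)
  have L_meas: "L \<in> borel_measurable M"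
    unfolding L_def[abs_def] by (intro borel_measurable_add borel_measurable_const hs)
  have S_meas: "S \<in> borel_measurable M"
    unfolding S_def[abs_def]
    using measurable_component_singleton[of _ ?T "\<lambda>_. std_normal"]
    by (intro borel_measurable_add borel_measurable_sum borel_measurable_abs) (auto simp: M_def)
  have \<Psi>_meas: "\<Psi> \<in> borel_measurable M"
    unfolding \<Psi>_def[abs_def] M_def by (rule indicator_pred_measurable[OF hess_psd_pred[OF n]])
  have W_meas: "W \<in> borel_measurable M"
    unfolding W_def[abs_def]
    by (intro indicator_le_measurable borel_measurable_abs borel_measurable_times borel_measurable_diff
        borel_measurable_add borel_measurable_const comp L_meas) (use n in auto)
  have L_pow_meas: "(\<lambda>g. ennreal (2 * \<kappa> * L g) ^ (n - 1) * \<Psi> g) \<in> borel_measurable M"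
    by (intro borel_measurable_times_ennreal borel_measurable_power_ennreal \<Psi>_meas
        measurable_compose[OF _ measurable_ennreal] borel_measurable_times borel_measurable_const L_meas)
  have S_pow_meas: "(\<lambda>g. ennreal (S g ^ n)) \<in> borel_measurable M"
    by (intro measurable_compose[OF _ measurable_ennreal] borel_measurable_power S_meas)
  have W1: "W g \<le> 1" for g by (simp add: W_def indicator_def)
  have LS: "L g + \<bar>g (0, j)\<bar> \<le> S g" if "j \<le> n" for g j
  proof -
    have "\<bar>g (0, j)\<bar> + hess_sum n g = (\<Sum>p\<in>insert (0, j) {p \<in> ?T. fst p > 0}. \<bar>g p\<bar>)"
      unfolding hess_sum_def by (subst sum.insert) auto
    also have "\<dots> \<le> (\<Sum>p\<in>?T. \<bar>g p\<bar>)"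
    proof (rule sum_mono2)
      show "insert (0, j) {p \<in> ?T. fst p > 0} \<subseteq> ?T" using that by (auto simp: tri_def)
    qed simp_all
    finally show ?thesis by (simp add: L_def S_def)
  qed
  have S1: "S g \<ge> 1" "L g \<le> S g" for g using LS[of 0 g] L1[of g] by (auto intro: order_trans)
  have ind: "indicator {g. near_crit n A B \<kappa> g} g = (\<Prod>p\<in>?J. indicator {g. \<bar>g p\<bar> \<le> 2 * \<kappa> * L g} g) * (W g * \<Psi> g)" for g
  proof -
    have "(\<Prod>p\<in>?J. indicator {g. \<bar>g p\<bar> \<le> 2 * \<kappa> * L g} g :: ennreal) = (if \<forall>j\<in>{2..n}. \<bar>g (0, j)\<bar> \<le> 2 * \<kappa> * L g then 1 else 0)"
      by (subst prod.reindex) (auto simp: inj_on_def indicator_def intro!: prod.neutral prod_zero)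
    then show ?thesis
      by (auto simp: near_crit_def W_def \<Psi>_def L_def indicator_def)
  qed
  have "emeasure M {g \<in> space M. near_crit n A B \<kappa> g} = (\<integral>\<^sup>+g. indicator {g. near_crit n A B \<kappa> g} g \<partial>M)"
  proof -
    have "{g \<in> space M. near_crit n A B \<kappa> g} \<in> sets M" using near_crit_pred[OF n] by (simp add: M_def)
    then have "emeasure M {g \<in> space M. near_crit n A B \<kappa> g} = (\<integral>\<^sup>+g. indicator {g \<in> space M. near_crit n A B \<kappa> g} g \<partial>M)"
      by simp
    also have "\<dots> = (\<integral>\<^sup>+g. indicator {g. near_crit n A B \<kappa> g} g \<partial>M)"
      by (intro nn_integral_cong) (simp add: indicator_def)
    finally show ?thesis .
  qed
  also have "\<dots> \<le> (\<integral>\<^sup>+g. ennreal (2 * \<kappa> * L g) ^ card ?J * (W g * \<Psi> g) \<partial>M)"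
    unfolding ind M_def
  proof (rule integrate_out_coordinates)
    show "(\<lambda>g. 2 * \<kappa> * L g) \<in> borel_measurable (std_gauss ?T)"
      "(\<lambda>g. W g * \<Psi> g) \<in> borel_measurable (std_gauss ?T)"
      unfolding M_def[symmetric]
      by (intro borel_measurable_times borel_measurable_const L_meas borel_measurable_times_ennreal W_meas \<Psi>_meas)+
    show "?J \<subseteq> ?T" by (auto simp: tri_def)
    fix p g t assume "p \<in> ?J"
    then obtain j where p: "p = (0, j)" "j \<ge> 2" by auto
    show "2 * \<kappa> * L (g(p := t)) = 2 * \<kappa> * L g" by (simp add: L_def p hess_sum_upd)
    show "W (g(p := t)) * \<Psi> (g(p := t)) = W g * \<Psi> g"
      using p by (simp add: W_def \<Psi>_def L_def hess_sum_upd hess_psd_upd indicator_def)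
  qed simp_all
  also have "card ?J = n - 1" by (subst card_image) (auto simp: inj_on_def)
  also have "(\<integral>\<^sup>+g. ennreal (2 * \<kappa> * L g) ^ (n - 1) * (W g * \<Psi> g) \<partial>M)
      = (\<integral>\<^sup>+g. W g * (ennreal (2 * \<kappa> * L g) ^ (n - 1) * \<Psi> g) \<partial>M)"
    by (simp add: mult_ac)
  also have "\<dots> \<le> (\<integral>\<^sup>+g. ennreal (c * S g) * (ennreal (2 * \<kappa> * L g) ^ (n - 1) * \<Psi> g) \<partial>M)"
  proof -
    have zero: "\<exists>i\<in>{0, 1 :: nat}. \<exists>y. y \<in> borel_measurable M \<and> (\<forall>g t. y (g((0, i) := t)) = y g) \<and>
      (\<forall>g. W g \<le> indicator {g. \<bar>g (0, i) - y g\<bar> \<le> c * (\<bar>g (0, 1 - i)\<bar> + L g)} g)"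
    proof (cases "A \<ge> 1")
      case True
      have rpos: "r > 0" using True r by (cases "r = 0") (auto simp: A_def)
      have BA: "B / A \<le> 1 / sqrt s"
      proof -
        have "sqrt (real d - 1) \<le> sqrt (real d)" by simp
        then have "sqrt (real d - 1) / sqrt (real d) \<le> 1" using d by (simp add: divide_le_eq)
        moreover have "B / A = (sqrt (real d - 1) / sqrt (real d)) / sqrt s"
          using rpos by (simp add: A_def B_def field_simps)
        ultimately show ?thesis using sq by (simp only:) (intro divide_right_mono, auto)
      qed
      \<comment> \<open>Both 1 and \<open>r\<^sup>2\<close> are at most \<open>d * r\<^sup>2\<close>
        here, so \<open>s\<close> is at most a constant times \<open>A\<^sup>2\<close>. Division by
        \<open>A\<close> thus produces the factor \<open>1 / sqrt s\<close>.\<close>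
      have A1: "1 / A \<le> 2 / sqrt s"
      proof -
        have "1\<^sup>2 \<le> A\<^sup>2" using True by (intro power_mono) auto
        then have "1 \<le> real d * r\<^sup>2" by (simp add: A_def power_mult_distrib)
        moreover have "1 * r\<^sup>2 \<le> real d * r\<^sup>2" using d by (intro mult_right_mono) auto
        ultimately have "s \<le> 4 * (real d * r\<^sup>2)" by (simp add: s)
        then have "sqrt s \<le> sqrt (4 * (real d * r\<^sup>2))" by (rule real_sqrt_le_mono)
        also have "\<dots> = 2 * A" using r by (simp add: A_def real_sqrt_mult)
        finally show ?thesis using True sq by (simp add: field_simps)
      qed
      have "W g \<le> indicator {g. \<bar>g (0, 0) - g (0, 1) / A\<bar> \<le> c * (\<bar>g (0, 1)\<bar> + L g)} g" for g
      proof (cases "\<bar>g (0, 1) - A * g (0, 0)\<bar> \<le> \<kappa> * (B * \<bar>g (0, 1)\<bar> + 5 * L g)")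
        case T: True
        have "\<bar>g (0, 0) - g (0, 1) / A\<bar> = \<bar>g (0, 1) - A * g (0, 0)\<bar> / A"
        proof -
          have "g (0, 0) - g (0, 1) / A = - ((g (0, 1) - A * g (0, 0)) / A)" using True by (simp add: field_simps)
          then show ?thesis using True by (simp add: abs_divide)
        qed
        also have "\<dots> \<le> \<kappa> * (B * \<bar>g (0, 1)\<bar> + 5 * L g) / A" using T True by (intro divide_right_mono) auto
        also have "\<dots> = \<kappa> * (B / A * \<bar>g (0, 1)\<bar> + 5 * L g * (1 / A))" using True by (simp add: field_simps)
        also have "\<dots> \<le> \<kappa> * (1 / sqrt s * \<bar>g (0, 1)\<bar> + 5 * L g * (2 / sqrt s))"
          using k L1[of g] by (intro mult_left_mono add_mono mult_right_mono BA A1) auto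
        also have "\<dots> = \<kappa> / sqrt s * (\<bar>g (0, 1)\<bar> + 10 * L g)" by (simp add: distrib_left add_divide_distrib)
        also have "\<dots> \<le> \<kappa> / sqrt s * (15 * (\<bar>g (0, 1)\<bar> + L g))"
          using k sq L1[of g] by (intro mult_left_mono) auto
        also have "\<dots> = c * (\<bar>g (0, 1)\<bar> + L g)" by (simp add: c_def)
        finally show ?thesis using W1[of g] by (simp add: indicator_def)
      qed (simp add: W_def)
      then show ?thesis
        by (intro bexI[of _ 0] exI[of _ "\<lambda>g. g (0, 1) / A"] conjI allI)
          (auto intro!: borel_measurable_divide comp[OF n, simplified])
    next
      case False
      have A: "0 \<le> A" "A \<le> 1" using False r by (auto simp: A_def)
      have B: "B \<le> 1"
      proof -
        have "sqrt (real d - 1) * r \<le> sqrt (real d) * r" using r by (intro mult_right_mono) auto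
        then have "sqrt (real d - 1) * r \<le> sqrt s" using A sq unfolding A_def by linarith
        then show ?thesis using sq by (simp add: B_def)
      qed
      \<comment> \<open>Here \<open>r \<le> 1\<close>, so \<open>sqrt s\<close> is bounded and
        inserting \<open>1 / sqrt s\<close> into the estimate costs only a constant.\<close>
      have "1 * r \<le> A" unfolding A_def using d r by (intro mult_right_mono) auto
      then have "r\<^sup>2 \<le> 1" using A r by (simp add: power_le_one)
      then have "sqrt s \<le> sqrt ((3 / 2)\<^sup>2)" by (intro real_sqrt_le_mono) (simp add: s power2_eq_square)
      then have s32: "sqrt s \<le> 3 / 2" by simp
      have "W g \<le> indicator {g. \<bar>g (0, 1) - A * g (0, 0)\<bar> \<le> c * (\<bar>g (0, 0)\<bar> + L g)} g" for g
      proof (cases "\<bar>g (0, 1) - A * g (0, 0)\<bar> \<le> \<kappa> * (B * \<bar>g (0, 1)\<bar> + 5 * L g)")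
        case T: True
        define e where "e = \<bar>g (0, 1) - A * g (0, 0)\<bar>"
        have "\<bar>A * g (0, 0)\<bar> \<le> 1 * \<bar>g (0, 0)\<bar>" unfolding abs_mult using A by (intro mult_right_mono) auto
        then have g01: "\<bar>g (0, 1)\<bar> \<le> e + \<bar>g (0, 0)\<bar>" by (simp add: e_def)
        have "e \<le> \<kappa> * (B * \<bar>g (0, 1)\<bar> + 5 * L g)" using T by (simp add: e_def)
        also have "\<dots> \<le> \<kappa> * (1 * \<bar>g (0, 1)\<bar> + 5 * L g)"
          using k B by (intro mult_left_mono add_right_mono mult_right_mono) auto
        also have "\<dots> \<le> \<kappa> * (e + \<bar>g (0, 0)\<bar> + 5 * L g)" using k g01 by (intro mult_left_mono) auto
        also have "\<dots> = \<kappa> * e + \<kappa> * (\<bar>g (0, 0)\<bar> + 5 * L g)" by (simp add: algebra_simps)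
        \<comment> \<open>The variable \<open>g (0, 1)\<close> also occurs in its own interval
          width; \<open>\<kappa> \<le> 1 / 2\<close> absorbs that occurrence into the left-hand
          side.\<close>
        also have "\<kappa> * e \<le> 1 / 2 * e" using k by (intro mult_right_mono) (auto simp: e_def)
        finally have "e \<le> 2 * (\<kappa> * (\<bar>g (0, 0)\<bar> + 5 * L g))" by simp
        also have "\<dots> = \<kappa> * (2 * \<bar>g (0, 0)\<bar> + 10 * L g)" by (simp add: algebra_simps)
        also have "\<dots> \<le> \<kappa> * (10 * (\<bar>g (0, 0)\<bar> + L g))" using k by (intro mult_left_mono) auto
        also have "\<dots> = \<kappa> * (\<bar>g (0, 0)\<bar> + L g) * 10" by simp
        also have "\<dots> \<le> \<kappa> * (\<bar>g (0, 0)\<bar> + L g) * (15 / sqrt s)"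
          using k L1[of g] s32 sq by (intro mult_left_mono) (auto simp: field_simps)
        also have "\<dots> = c * (\<bar>g (0, 0)\<bar> + L g)" by (simp add: c_def)
        finally show ?thesis using W1[of g] by (simp add: indicator_def e_def)
      qed (simp add: W_def)
      then show ?thesis
        by (intro bexI[of _ 1] exI[of _ "\<lambda>g. A * g (0, 0)"] conjI allI)
          (auto intro!: borel_measurable_times comp)
    qed
    then obtain i y where i: "i \<in> {0, 1 :: nat}" and y: "y \<in> borel_measurable M" "\<And>g t. y (g((0, i) := t)) = y g"
      and W: "\<And>g. W g \<le> indicator {g. \<bar>g (0, i) - y g\<bar> \<le> c * (\<bar>g (0, 1 - i)\<bar> + L g)} g"
      by blast
    have i': "1 - i \<le> n" "(0, i) \<in> ?T" "(0, 1 - i) \<noteq> (0 :: nat, i)" using i n by (auto simp: tri_def)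
    have "(\<integral>\<^sup>+g. W g * (ennreal (2 * \<kappa> * L g) ^ (n - 1) * \<Psi> g) \<partial>M)
        \<le> (\<integral>\<^sup>+g. indicator {g. \<bar>g (0, i) - y g\<bar> \<le> c * (\<bar>g (0, 1 - i)\<bar> + L g)} g * (ennreal (2 * \<kappa> * L g) ^ (n - 1) * \<Psi> g) \<partial>M)"
      by (intro nn_integral_mono mult_right_mono W) simp
    also have "\<dots> \<le> (\<integral>\<^sup>+g. ennreal (c * (\<bar>g (0, 1 - i)\<bar> + L g)) * (ennreal (2 * \<kappa> * L g) ^ (n - 1) * \<Psi> g) \<partial>M)"
    proof -
      have meas: "(\<lambda>g. c * (\<bar>g (0, 1 - i)\<bar> + L g)) \<in> borel_measurable M"
        by (intro borel_measurable_times borel_measurable_const borel_measurable_add borel_measurable_abs comp i' L_meas)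
      have upd: "L (g((0, i) := t)) = L g" "\<Psi> (g((0, i) := t)) = \<Psi> g" for g t
        by (simp_all add: L_def hess_sum_upd \<Psi>_def hess_psd_upd indicator_def)
      have upd': "(g((0, i) := t)) (0, 1 - i) = g (0, 1 - i)" for g :: "nat \<times> nat \<Rightarrow> real" and t
        using i'(3) by (rule fun_upd_other)
      show ?thesis
        unfolding M_def
        by (rule integrate_out_coordinate[OF finite_tri i'(2) y(1)[unfolded M_def] meas[unfolded M_def] L_pow_meas[unfolded M_def] y(2)])
          (simp_all only: upd upd')
    qed
    also have "\<dots> \<le> (\<integral>\<^sup>+g. ennreal (c * S g) * (ennreal (2 * \<kappa> * L g) ^ (n - 1) * \<Psi> g) \<partial>M)"
      using LS[OF i'(1)] c0 by (intro nn_integral_mono mult_right_mono ennreal_leI mult_left_mono) (auto simp: add.commute)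
    finally show ?thesis .
  qed
  also have "\<dots> \<le> (\<integral>\<^sup>+g. ennreal (15 * 2 ^ n * \<kappa> ^ n / sqrt s) * (ennreal (S g ^ n) * \<Psi> g) \<partial>M)"
  proof (rule nn_integral_mono)
    fix g
    have "ennreal (c * S g) * ennreal (2 * \<kappa> * L g) ^ (n - 1) = ennreal (c * S g * (2 * \<kappa> * L g) ^ (n - 1))"
    proof -
      have "0 \<le> 2 * \<kappa> * L g" "0 \<le> c * S g" using c0 k S1[of g] L1[of g] by auto
      then show ?thesis by (simp only: ennreal_power) (intro ennreal_mult[symmetric] zero_le_power)
    qed
    also have "\<dots> \<le> ennreal (15 * 2 ^ n * \<kappa> ^ n / sqrt s * S g ^ n)"
    proof (rule ennreal_leI)
      have "c * S g * (2 * \<kappa> * L g) ^ (n - 1) \<le> c * S g * (2 * \<kappa> * S g) ^ (n - 1)"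
        using c0 k S1[of g] L1[of g] by (intro mult_left_mono power_mono mult_nonneg_nonneg) auto
      also have "\<dots> = 15 / sqrt s * 2 ^ (n - 1) * (\<kappa> * \<kappa> ^ (n - 1)) * (S g * S g ^ (n - 1))"
        by (simp add: c_def power_mult_distrib)
      also have "\<dots> = 15 / sqrt s * 2 ^ (n - 1) * \<kappa> ^ n * S g ^ n"
        using n by (simp only: power_Suc[symmetric]) simp
      also have "\<dots> \<le> 15 / sqrt s * 2 ^ n * \<kappa> ^ n * S g ^ n"
        using sq k S1[of g] by (intro mult_right_mono mult_left_mono power_increasing) auto
      finally show "c * S g * (2 * \<kappa> * L g) ^ (n - 1) \<le> 15 * 2 ^ n * \<kappa> ^ n / sqrt s * S g ^ n" by simp
    qed
    also have "\<dots> = ennreal (15 * 2 ^ n * \<kappa> ^ n / sqrt s) * ennreal (S g ^ n)"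
      using k sq S1[of g] by (intro ennreal_mult) auto
    finally show "ennreal (c * S g) * (ennreal (2 * \<kappa> * L g) ^ (n - 1) * \<Psi> g)
        \<le> ennreal (15 * 2 ^ n * \<kappa> ^ n / sqrt s) * (ennreal (S g ^ n) * \<Psi> g)"
      unfolding mult.assoc[symmetric] by (rule mult_right_mono) simp
  qed
  also have "\<dots> = ennreal (15 * 2 ^ n * \<kappa> ^ n / sqrt s) * (\<integral>\<^sup>+g. ennreal (S g ^ n) * \<Psi> g \<partial>M)"
    by (intro nn_integral_cmult borel_measurable_times_ennreal S_pow_meas \<Psi>_meas)
  also have "\<dots> \<le> ennreal (15 * 2 ^ n * \<kappa> ^ n / sqrt s) * ennreal (crit_const n / (15 * 2 ^ n))"
  proof (rule mult_left_mono)
    let ?a = "(4 * (real n)\<^sup>2) ^ (2 * n + 1) * (2 * real n) ^ (2 * n)"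
    let ?b = "exp (- (real (n - 1))\<^sup>2 / 12 + 3 * real (n - 1) / 2 + real (n - 1) * sqrt (1 + real (n - 1)))"
    \<comment> \<open>\<open>S\<close> and the Hessian condition share the second-order entries and
      are not independent; Cauchy-Schwarz separates them.\<close>
    have "(\<integral>\<^sup>+g. ennreal (S g ^ n) * \<Psi> g \<partial>M)\<^sup>2 \<le> (\<integral>\<^sup>+g. (ennreal (S g ^ n))\<^sup>2 \<partial>M) * (\<integral>\<^sup>+g. (\<Psi> g)\<^sup>2 \<partial>M)"
      by (rule Cauchy_Schwarz_nn_integral[OF S_pow_meas \<Psi>_meas])
    also have "(\<integral>\<^sup>+g. (ennreal (S g ^ n))\<^sup>2 \<partial>M) = (\<integral>\<^sup>+g. ennreal (S g ^ (2 * n)) \<partial>M)"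
      by (intro nn_integral_cong) (use S1(1) in \<open>simp add: ennreal_power power_mult[symmetric] mult.commute order_trans[OF zero_le_one]\<close>)
    also have "(\<integral>\<^sup>+g. (\<Psi> g)\<^sup>2 \<partial>M) = (\<integral>\<^sup>+g. indicator {g. hess_psd n g} g \<partial>M)"
      by (intro nn_integral_cong) (simp add: \<Psi>_def indicator_def)
    also have "(\<integral>\<^sup>+g. ennreal (S g ^ (2 * n)) \<partial>M) * (\<integral>\<^sup>+g. indicator {g. hess_psd n g} g \<partial>M) \<le> ennreal ?a * ennreal ?b"
      unfolding S_def M_def by (intro mult_mono moment_sum_le[OF n] hess_psd_prob[OF n]) auto
    also have "\<dots> = ennreal (?a * ?b)" by (rule ennreal_mult[symmetric]) auto
    finally have "(\<integral>\<^sup>+g. ennreal (S g ^ n) * \<Psi> g \<partial>M) \<le> ennreal (sqrt (?a * ?b))"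
      by (rule ennreal_le_sqrt) auto
    then show "(\<integral>\<^sup>+g. ennreal (S g ^ n) * \<Psi> g \<partial>M) \<le> ennreal (crit_const n / (15 * 2 ^ n))"
      by (simp add: crit_const_def)
  qed simp
  also have "\<dots> = ennreal (crit_const n * \<kappa> ^ n / sqrt s)"
  proof -
    have "crit_const n \<ge> 0" by (simp add: crit_const_def)
    then have "ennreal (15 * 2 ^ n * \<kappa> ^ n / sqrt s) * ennreal (crit_const n / (15 * 2 ^ n))
        = ennreal (15 * 2 ^ n * \<kappa> ^ n / sqrt s * (crit_const n / (15 * 2 ^ n)))"
      using k sq by (intro ennreal_mult[symmetric]) auto
    then show ?thesis by (simp add: mult.commute)
  qed
  finally show ?thesis by (simp only: M_def)
qed

section \<open>Cells and Riemann sums\<close>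

text \<open>The rotations depend on the cell, but the law of the tensor does not notice them; what
  remains is the image measure along tensor, coefficients and normalised jet.\<close>

lemma emeasure_rotated_near_crit:
  fixes A B \<kappa> :: real
  assumes n: "n \<ge> 1" and d: "d \<ge> 2" and R: "sym_orth n R" "sym_orth n R'"
  defines "\<gamma> \<equiv> std_gauss (hom_words n d)"
    and "cev \<equiv> \<lambda>T. near_crit n A B \<kappa> (jet_vars n d (word_coeff n d T))"
  shows "{T \<in> space \<gamma>. cev (word_rot n d R' (word_rot n d R T))} \<in> sets \<gamma>"
    and "emeasure \<gamma> {T \<in> space \<gamma>. cev (word_rot n d R' (word_rot n d R T))}
      = emeasure (std_gauss (tri (Suc n))) {g \<in> space (std_gauss (tri (Suc n))). near_crit n A B \<kappa> g}"
proof -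
  let ?P = "std_gauss (tri (Suc n))"
  let ?\<mu> = "coeff_measure n d"
  have rot: "word_rot n d R \<in> \<gamma> \<rightarrow>\<^sub>M \<gamma>" "word_rot n d R' \<in> \<gamma> \<rightarrow>\<^sub>M \<gamma>"
    unfolding \<gamma>_def by (rule word_rot_measurable)+
  have wc: "word_coeff n d \<in> \<gamma> \<rightarrow>\<^sub>M ?\<mu>" unfolding \<gamma>_def by (rule word_coeff_measurable)
  have crit: "Measurable.pred ?P (near_crit n A B \<kappa>)" by (rule near_crit_pred[OF n])
  have ev_pred: "Measurable.pred \<gamma> cev"
    unfolding cev_def by (rule measurable_compose[OF wc measurable_compose[OF jet_vars_measurable[OF d] crit]])
  have cev': "Measurable.pred \<gamma> (\<lambda>T. cev (word_rot n d R' T))"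
    by (rule measurable_compose[OF rot(2) ev_pred])
  have cev'': "Measurable.pred \<gamma> (\<lambda>T. cev (word_rot n d R' (word_rot n d R T)))"
    by (rule measurable_compose[OF rot(1) cev'])
  then show sets: "{T \<in> space \<gamma>. cev (word_rot n d R' (word_rot n d R T))} \<in> sets \<gamma>"
    by (simp add: pred_def)
  have "emeasure \<gamma> {T \<in> space \<gamma>. cev (word_rot n d R' (word_rot n d R T))}
      = (\<integral>\<^sup>+T. indicator {T. cev T} (word_rot n d R' (word_rot n d R T)) \<partial>\<gamma>)"
    by (rule trans[OF nn_integral_indicator[OF sets, symmetric]]) (intro nn_integral_cong, simp add: indicator_def)
  also have "\<dots> = (\<integral>\<^sup>+T. indicator {T. cev T} (word_rot n d R' T) \<partial>\<gamma>)"
    unfolding \<gamma>_def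
    by (rule nn_integral_word_rot[OF R(1), where f="\<lambda>T. indicator {T. cev T} (word_rot n d R' T)"])
      (use indicator_pred_measurable[OF cev'] in \<open>simp add: \<gamma>_def indicator_def\<close>)
  also have "\<dots> = (\<integral>\<^sup>+T. indicator {T. cev T} T \<partial>\<gamma>)"
    unfolding \<gamma>_def by (rule nn_integral_word_rot[OF R(2)])
      (use indicator_pred_measurable[OF ev_pred] in \<open>simp add: \<gamma>_def\<close>)
  also have "\<dots> = (\<integral>\<^sup>+T. indicator {c. near_crit n A B \<kappa> (jet_vars n d c)} (word_coeff n d T) \<partial>\<gamma>)"
    by (intro nn_integral_cong) (simp add: indicator_def cev_def)
  also have "\<dots> = (\<integral>\<^sup>+c. indicator {c. near_crit n A B \<kappa> (jet_vars n d c)} c \<partial>distr \<gamma> ?\<mu> (word_coeff n d))"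
    using indicator_pred_measurable[OF measurable_compose[OF jet_vars_measurable[OF d] crit]]
    by (intro nn_integral_distr[OF wc, symmetric]) simp
  also have "\<dots> = (\<integral>\<^sup>+c. indicator {g. near_crit n A B \<kappa> g} (jet_vars n d c) \<partial>?\<mu>)"
    unfolding \<gamma>_def distr_word_coeff by (intro nn_integral_cong) (simp add: indicator_def)
  also have "\<dots> = (\<integral>\<^sup>+g. indicator {g. near_crit n A B \<kappa> g} g \<partial>distr ?\<mu> ?P (jet_vars n d))"
    using indicator_pred_measurable[OF crit]
    by (intro nn_integral_distr[OF jet_vars_measurable[OF d], symmetric]) simp
  also have "\<dots> = (\<integral>\<^sup>+g. indicator {g \<in> space ?P. near_crit n A B \<kappa> g} g \<partial>?P)"
    unfolding distr_jet_vars[OF d] by (intro nn_integral_cong) (simp add: indicator_def)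
  also have "\<dots> = emeasure ?P {g \<in> space ?P. near_crit n A B \<kappa> g}"
    using crit by (intro nn_integral_indicator) (simp add: pred_def)
  finally show "emeasure \<gamma> {T \<in> space \<gamma>. cev (word_rot n d R' (word_rot n d R T))}
      = emeasure ?P {g \<in> space ?P. near_crit n A B \<kappa> g}" .
qed

text \<open>One measurable event serves all minima in the cell. The truncation \<open>Kb\<close>
  makes the Taylor remainder deterministic. In the bound, \<open>n\<close> factors
  \<open>e / sqrt s\<close> come from the size of the cell seen in the rotated chart, and the last
  \<open>1 / sqrt s\<close> from the radial condition.\<close>

lemma cell_event:
  assumes n: "n \<ge> 1" and d: "d \<ge> 2" and e: "e > 0" "real n * e \<le> 1" "4 * real n * e * sqrt (real d - 1) \<le> 1"
    and Kb: "Kb \<ge> 0" and C: "C = real (card (hom_words n d))"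
    and r: "r = sqrt (\<Sum>i<n. (x0 i)\<^sup>2)"
    and small: "2 ^ d * (C * (C * Kb)) * (2 * real n * e) * (2 + real d * (r + 1) * (3 * real n + 2)) \<le> 1"
  defines "\<gamma> \<equiv> std_gauss (hom_words n d)" and "s \<equiv> 1 + r\<^sup>2"
  shows "\<exists>E\<in>sets \<gamma>. emeasure \<gamma> E \<le> ennreal (crit_const n * (2 * real n * sqrt (real d - 1)) ^ n * (e ^ n / sqrt s ^ (n + 1))) \<and>
    (\<forall>T\<in>space \<gamma>. (\<Sum>w\<in>hom_words n d. \<bar>T w\<bar>) \<le> Kb \<longrightarrow>
      (\<exists>x\<in>local_minima n (poly_fun n d (word_coeff n d T)). \<forall>i<n. \<bar>x i - x0 i\<bar> \<le> e) \<longrightarrow> T \<in> E)"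
proof -
  obtain R where R: "sym_orth n R" "\<And>i. i \<le> n \<Longrightarrow> R i 0 = (if i = 0 then 1 else 0)"
    "\<And>i. i \<le> n \<Longrightarrow> (\<Sum>k\<le>n. R i k * hcoord 1 x0 k) = hcoord 1 (\<lambda>i. if i = 0 then r else 0) i"
    using ex_rotation_to_axis[OF r n] by metis
  let ?R' = "axis_reflection r"
  have r0: "r \<ge> 0" by (simp add: r sum_nonneg)
  have sq: "s \<ge> 1" "sqrt s \<ge> 1" by (simp_all add: s_def)
  have R': "sym_orth n ?R'" by (rule axis_reflection(1)[OF n r0])
  define D where "D = 2 * (real n * e) / sqrt s"
  have D0: "D \<ge> 0" using e sq by (simp add: D_def)
  have D2: "D \<le> 2 * (real n * e)"
  proof -
    have "2 * (real n * e) / sqrt s \<le> 2 * (real n * e) / 1"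
      using e sq by (intro divide_left_mono) auto
    then show ?thesis by (simp add: D_def)
  qed
  have sd: "sqrt (real d - 1) \<ge> 1" using d by simp
  have ne4: "4 * (real n * e) \<le> 1"
  proof -
    have "4 * real n * e * 1 \<le> 4 * real n * e * sqrt (real d - 1)"
      using e sd by (intro mult_left_mono) auto
    then show ?thesis using e(3) by simp
  qed
  have D1: "D \<le> 1" using D2 ne4 by simp
  define \<kappa> where "\<kappa> = D * sqrt (real d - 1)"
  have k: "0 \<le> \<kappa>" "\<kappa> \<le> 1 / 2"
  proof -
    show "0 \<le> \<kappa>" using D0 sd by (simp add: \<kappa>_def)
    have "\<kappa> \<le> 2 * (real n * e) * sqrt (real d - 1)"
      unfolding \<kappa>_def using D2 sd by (intro mult_right_mono) auto
    then show "\<kappa> \<le> 1 / 2" using e(3) by simp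
  qed
  define A B where "A = sqrt (real d) * r" and "B = sqrt (real d - 1) * r / sqrt s"
  define E where "E = {T \<in> space \<gamma>. near_crit n A B \<kappa> (jet_vars n d (word_coeff n d (word_rot n d ?R' (word_rot n d R T))))}"
  have E: "E \<in> sets \<gamma>" unfolding E_def \<gamma>_def by (rule emeasure_rotated_near_crit(1)[OF n d R(1) R'])
  have "emeasure \<gamma> E = emeasure (std_gauss (tri (Suc n))) {g \<in> space (std_gauss (tri (Suc n))). near_crit n A B \<kappa> g}"
    unfolding E_def \<gamma>_def by (rule emeasure_rotated_near_crit(2)[OF n d R(1) R'])
  also have "\<dots> \<le> ennreal (crit_const n * \<kappa> ^ n / sqrt s)"
    unfolding A_def B_def by (rule near_crit_prob[OF n d r0 _ k]) (simp add: s_def)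
  also have "crit_const n * \<kappa> ^ n / sqrt s = crit_const n * (2 * real n * sqrt (real d - 1)) ^ n * (e ^ n / sqrt s ^ (n + 1))"
  proof -
    have "\<kappa> = (2 * real n * sqrt (real d - 1)) * (e / sqrt s)" by (simp add: \<kappa>_def D_def)
    then show ?thesis by (simp add: power_mult_distrib power_divide mult_ac)
  qed
  finally have prob: "emeasure \<gamma> E \<le> ennreal (crit_const n * (2 * real n * sqrt (real d - 1)) ^ n * (e ^ n / sqrt s ^ (n + 1)))" .
  have "T \<in> E" if T: "T \<in> space \<gamma>" and TK: "(\<Sum>w\<in>hom_words n d. \<bar>T w\<bar>) \<le> Kb"
    and x: "x \<in> local_minima n (poly_fun n d (word_coeff n d T))" and near: "\<And>i. i < n \<Longrightarrow> \<bar>x i - x0 i\<bar> \<le> e" for T x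
  proof -
    define c where "c = word_coeff n d (word_rot n d ?R' (word_rot n d R T))"
    obtain z where z: "\<bar>z 0\<bar> \<le> 2 * (real n * e) / s" "\<And>i. i < n \<Longrightarrow> \<bar>z i\<bar> \<le> 2 * (real n * e) / sqrt s"
      "\<And>w. w 0 = 0 \<Longrightarrow> coeff (line_poly n d c z w) 1 = 0"
      "\<And>w. w 0 = 0 \<Longrightarrow> coeff (line_poly n d c z w) 2 \<ge> 0"
      "(1 + r * z 0) * coeff (line_poly n d c z (\<lambda>i. if i = 0 then 1 else 0)) 1
        = real d * r * coeff (line_poly n d c z (\<lambda>i. if i = 0 then 1 else 0)) 0"
    proof (rule local_min_in_chart[OF n r R(1) _ _ x _ e(2)])
      show "R i 0 = (if i = 0 then 1 else 0)" if "i \<le> n" for i by (rule R(2)[OF that])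
      show "(\<Sum>k\<le>n. R i k * hcoord 1 x0 k) = hcoord 1 (\<lambda>i. if i = 0 then r else 0) i" if "i \<le> n" for i
        by (rule R(3)[OF that])
      show "\<bar>x i - x0 i\<bar> \<le> e" if "i < n" for i by (rule near[OF that])
    next
      fix z assume "\<bar>z 0\<bar> \<le> 2 * (real n * e) / (1 + r\<^sup>2)"
        "\<And>i. i < n \<Longrightarrow> \<bar>z i\<bar> \<le> 2 * (real n * e) / sqrt (1 + r\<^sup>2)"
        "\<And>w. w 0 = 0 \<Longrightarrow> coeff (line_poly n d (word_coeff n d (word_rot n d ?R' (word_rot n d R T))) z w) 1 = 0"
        "\<And>w. w 0 = 0 \<Longrightarrow> 0 \<le> coeff (line_poly n d (word_coeff n d (word_rot n d ?R' (word_rot n d R T))) z w) 2"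
        "(1 + r * z 0) * coeff (line_poly n d (word_coeff n d (word_rot n d ?R' (word_rot n d R T))) z (\<lambda>i. if i = 0 then 1 else 0)) 1
          = real d * r * coeff (line_poly n d (word_coeff n d (word_rot n d ?R' (word_rot n d R T))) z (\<lambda>i. if i = 0 then 1 else 0)) 0"
      then show thesis unfolding c_def[symmetric] s_def[symmetric] by (rule that)
    qed
    have C0: "C \<ge> 0" by (simp add: C)
    have M: "(\<Sum>\<alpha>\<in>multi_indices n d. \<bar>c \<alpha>\<bar>) \<le> C * (C * Kb)"
    proof -
      have "(\<Sum>\<alpha>\<in>multi_indices n d. \<bar>c \<alpha>\<bar>) \<le> (\<Sum>w\<in>hom_words n d. \<bar>word_rot n d ?R' (word_rot n d R T) w\<bar>)"
        unfolding c_def by (rule sum_abs_word_coeff_le)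
      also have "\<dots> \<le> C * (\<Sum>w\<in>hom_words n d. \<bar>word_rot n d R T w\<bar>)"
        unfolding C by (rule sum_abs_word_rot_le[OF R'])
      also have "\<dots> \<le> C * (C * (\<Sum>w\<in>hom_words n d. \<bar>T w\<bar>))"
        using sum_abs_word_rot_le[OF R(1), of d T] C0 unfolding C by (intro mult_left_mono) auto
      also have "\<dots> \<le> C * (C * Kb)" using TK C0 by (intro mult_left_mono) auto
      finally show ?thesis .
    qed
    have "near_crit n A B \<kappa> (jet_vars n d c)"
      unfolding A_def B_def \<kappa>_def
    proof (rule near_crit_of_chart[OF n d r0 _ D0 D1 _ _ M _ z(3) z(4) z(5)])
      show "s = 1 + r\<^sup>2" by (simp add: s_def)
      have "D / sqrt s = 2 * (real n * e) / s" using sq by (simp add: D_def)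
      then show "\<bar>z 0\<bar> \<le> D / sqrt s" using z(1) by simp
      show "\<bar>z i\<bar> \<le> D" if "i < n" for i using z(2)[OF that] by (simp add: D_def)
      have "2 ^ d * (C * (C * Kb)) * D * (2 + real d * (r + 1) * (3 * real n + 2))
          \<le> 2 ^ d * (C * (C * Kb)) * (2 * real n * e) * (2 + real d * (r + 1) * (3 * real n + 2))"
        using C0 Kb D2 r0 by (intro mult_right_mono mult_left_mono) auto
      then show "2 ^ d * (C * (C * Kb)) * D * (2 + real d * (r + 1) * (3 * real n + 2)) \<le> 1"
        using small by linarith
    qed
    then show ?thesis using T by (simp add: E_def c_def)
  qed
  then show ?thesis using E prob by blast
qed

text \<open>No measurability of \<open>f\<close> is assumed: simple functions below \<open>f\<close>
  pull back to simple functions, which gives this direction. It is applied to the counting function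
  of the minima, whose measurability is thereby bypassed.\<close>

lemma nn_integral_distr_le:
  assumes T: "T \<in> M \<rightarrow>\<^sub>M N"
  shows "(\<integral>\<^sup>+x. f x \<partial>distr M N T) \<le> (\<integral>\<^sup>+x. f (T x) \<partial>M)"
  unfolding nn_integral_def[of "distr M N T"]
proof (rule SUP_least)
  fix g assume g: "g \<in> {g. simple_function (distr M N T) g \<and> g \<le> f}"
  then have sf: "simple_function (distr M N T) g" and gf: "g \<le> f" by auto
  have "integral\<^sup>S (distr M N T) g = (\<integral>\<^sup>+x. g x \<partial>distr M N T)"
    by (rule nn_integral_eq_simple_integral[OF sf, symmetric])
  also have "\<dots> = (\<integral>\<^sup>+x. g (T x) \<partial>M)"
    by (rule nn_integral_distr[OF T]) (rule borel_measurable_simple_function[OF sf])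
  also have "\<dots> \<le> (\<integral>\<^sup>+x. f (T x) \<partial>M)"
    using gf by (intro nn_integral_mono) (simp add: le_fun_def)
  finally show "integral\<^sup>S (distr M N T) g \<le> (\<integral>\<^sup>+x. f (T x) \<partial>M)" .
qed

text \<open>The sum is dominated by a telescoping one: up to sign,
  \<open>n * x powr (- (1 / n))\<close> is an antiderivative of
  \<open>x powr (- (1 + 1 / n))\<close>.\<close>

lemma riemann_sum_half_line:
  assumes n: "n \<ge> 1" and e: "e > 0"
  shows "(\<Sum>j=1..K. e * (1 + e * real j) powr (- (1 + 1 / real n))) \<le> real n - real n * (1 + e * real K) powr (- (1 / real n))"
proof (induction K)
  case (Suc K)
  define a b where "a = 1 + e * real K" and "b = 1 + e * real (Suc K)"
  have a: "a > 0" and b: "b > 0" and ba: "b - a = e"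
    using e by (auto simp: a_def b_def algebra_simps intro: add_pos_nonneg)
  \<comment> \<open>In place of the mean value theorem, \<open>1 - 1 / q \<le> ln q\<close> and
    \<open>ln q \<le> n * (q powr (1 / n) - 1)\<close> are used for
    \<open>q = b / a\<close>.\<close>
  have "1 - a / b \<le> - ln (a / b)" using ln_le_minus_one[of "a / b"] a b by simp
  also have "- ln (a / b) = ln (b / a)" using a b by (simp add: ln_div)
  also have "\<dots> \<le> real n * (exp (ln (b / a) / real n) - 1)"
    using exp_ge_add_one_self[of "ln (b / a) / real n"] n by (simp add: field_simps)
  also have "exp (ln (b / a) / real n) = (b / a) powr (1 / real n)"
    using a b by (simp add: powr_def)
  finally have "e / b \<le> real n * ((b / a) powr (1 / real n) - 1)"
    using b ba by (simp add: field_simps)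
  then have "e / b * b powr (- (1 / real n)) \<le> real n * ((b / a) powr (1 / real n) - 1) * b powr (- (1 / real n))"
    by (rule mult_right_mono) simp
  also have "e / b * b powr (- (1 / real n)) = e * b powr (- (1 + 1 / real n))"
    using b by (simp add: powr_add powr_minus field_simps powr_diff)
  also have "real n * ((b / a) powr (1 / real n) - 1) * b powr (- (1 / real n))
      = real n * a powr (- (1 / real n)) - real n * b powr (- (1 / real n))"
    using a b by (simp add: powr_divide powr_minus field_simps)
  finally show ?case
    using Suc by (simp add: a_def b_def)
qed simp

lemma riemann_sum_line:
  assumes n: "n \<ge> 1" and e: "0 < e" "e \<le> 1"
  shows "(\<Sum>v\<in>{- int K..int K}. e * (1 + e * \<bar>real_of_int v\<bar>) powr (- (1 + 1 / real n))) \<le> 3 * real n"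
proof -
  let ?h = "\<lambda>x. e * (1 + e * x) powr (- (1 + 1 / real n))"
  have split: "{- int K..int K} = insert 0 ((\<lambda>j. int j) ` {1..K} \<union> (\<lambda>j. - int j) ` {1..K})"
  proof (intro equalityI subsetI)
    fix v assume v: "v \<in> {- int K..int K}"
    consider "v = 0" | "v > 0" | "v < 0" by linarith
    then show "v \<in> insert 0 ((\<lambda>j. int j) ` {1..K} \<union> (\<lambda>j. - int j) ` {1..K})"
    proof cases
      case 2
      then have "v = int (nat v)" "nat v \<in> {1..K}" using v by auto
      then show ?thesis by blast
    next
      case 3
      then have "v = - int (nat (- v))" "nat (- v) \<in> {1..K}" using v by auto
      then show ?thesis by blast
    qed simp
  qed auto
  have "(\<Sum>v\<in>{- int K..int K}. ?h \<bar>real_of_int v\<bar>)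
      = ?h 0 + ((\<Sum>v\<in>(\<lambda>j. int j) ` {1..K}. ?h \<bar>real_of_int v\<bar>) + (\<Sum>v\<in>(\<lambda>j. - int j) ` {1..K}. ?h \<bar>real_of_int v\<bar>))"
    unfolding split by (subst sum.insert, simp, force, subst sum.union_disjoint) auto
  also have "(\<Sum>v\<in>(\<lambda>j. int j) ` {1..K}. ?h \<bar>real_of_int v\<bar>) = (\<Sum>j=1..K. ?h (real j))"
    by (subst sum.reindex) (auto simp: inj_on_def)
  also have "(\<Sum>v\<in>(\<lambda>j. - int j) ` {1..K}. ?h \<bar>real_of_int v\<bar>) = (\<Sum>j=1..K. ?h (real j))"
    by (subst sum.reindex) (auto simp: inj_on_def)
  also have "?h 0 + ((\<Sum>j=1..K. ?h (real j)) + (\<Sum>j=1..K. ?h (real j))) \<le> 1 + (real n + real n)"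
  proof -
    have "(\<Sum>j=1..K. ?h (real j)) \<le> real n"
      using riemann_sum_half_line[OF n e(1), of K] by (rule order_trans) simp
    then show ?thesis using e(2) by simp
  qed
  also have "\<dots> \<le> 3 * real n" using n by simp
  finally show ?thesis .
qed

text \<open>The exponent \<open>(n + 1) / 2\<close> of \<open>s\<close> is shared equally among the
  coordinates. Each share \<open>p\<close> is slightly more than 1/2, and since \<open>s\<close> is
  at least half the square of \<open>1 + \<bar>x i\<bar>\<close>, every coordinate receives a
  summable weight.\<close>

lemma cell_weight_le:
  assumes n: "n \<ge> 1"
  shows "1 / sqrt (1 + (\<Sum>i<n. (x i)\<^sup>2)) ^ (n + 1) \<le> (\<Prod>i<n. 2 * (1 + \<bar>x i\<bar>) powr (- (1 + 1 / real n)))"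
proof -
  define s where "s = 1 + (\<Sum>i<n. (x i)\<^sup>2)"
  define p where "p = (1 + 1 / real n) / 2"
  have s: "s \<ge> 1" by (simp add: s_def sum_nonneg)
  have p: "0 < p" "p \<le> 1" using n by (auto simp: p_def add_pos_nonneg)
  have factor: "(s powr p) \<ge> inverse (2 * (1 + \<bar>x i\<bar>) powr (- (1 + 1 / real n)))" if "i < n" for i
  proof -
    have "(x i)\<^sup>2 \<le> (\<Sum>i<n. (x i)\<^sup>2)" using that by (intro member_le_sum) auto
    moreover have "(1 + \<bar>x i\<bar>)\<^sup>2 \<le> 2 * (1 + (x i)\<^sup>2)"
    proof -
      have "0 \<le> (1 - \<bar>x i\<bar>)\<^sup>2" by simp
      then show ?thesis by (simp add: power2_eq_square algebra_simps)
    qed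
    ultimately have "(1 + \<bar>x i\<bar>)\<^sup>2 / 2 \<le> s" by (simp add: s_def)
    then have "((1 + \<bar>x i\<bar>)\<^sup>2 / 2) powr p \<le> s powr p" using p by (intro powr_mono2) auto
    moreover have "((1 + \<bar>x i\<bar>)\<^sup>2 / 2) powr p = (1 + \<bar>x i\<bar>) powr (1 + 1 / real n) / 2 powr p"
    proof -
      have "((1 + \<bar>x i\<bar>)\<^sup>2) powr p = (1 + \<bar>x i\<bar>) powr (2 * p)"
      proof -
        have "(1 + \<bar>x i\<bar>)\<^sup>2 = (1 + \<bar>x i\<bar>) powr 2" by (subst powr_numeral) auto
        then show ?thesis by (simp only: powr_powr)
      qed
      moreover have "2 * p = 1 + 1 / real n" by (simp add: p_def)
      ultimately show ?thesis by (simp add: powr_divide)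
    qed
    moreover have "(1 + \<bar>x i\<bar>) powr (1 + 1 / real n) / 2 \<le> (1 + \<bar>x i\<bar>) powr (1 + 1 / real n) / 2 powr p"
    proof -
      have "2 powr p \<le> (2 :: real) powr 1" using p by (intro powr_mono) auto
      then show ?thesis by (intro divide_left_mono) auto
    qed
    moreover have "inverse (2 * (1 + \<bar>x i\<bar>) powr (- (1 + 1 / real n))) = (1 + \<bar>x i\<bar>) powr (1 + 1 / real n) / 2"
      by (simp only: powr_minus) (simp add: field_simps)
    ultimately show ?thesis by linarith
  qed
  have half: "s powr (1 / 2) = sqrt s" using s by (intro powr_half_sqrt) auto
  have "sqrt s ^ (n + 1) = (s powr (1 / 2)) powr real (n + 1)"
    unfolding half by (rule powr_realpow[symmetric]) (use s in simp)
  also have "\<dots> = s powr (p * real n)"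
  proof -
    have "1 / 2 * real (n + 1) = p * real n" using n by (simp add: p_def field_simps)
    then show ?thesis by (simp only: powr_powr)
  qed
  also have "\<dots> = (s powr p) ^ n"
    unfolding powr_powr[symmetric] by (rule powr_realpow) (use s in simp)
  finally have "sqrt s ^ (n + 1) = (\<Prod>i<n. s powr p)" by simp
  also have "\<dots> \<ge> (\<Prod>i<n. inverse (2 * (1 + \<bar>x i\<bar>) powr (- (1 + 1 / real n))))"
    using factor by (intro prod_mono) auto
  finally have "inverse (\<Prod>i<n. 2 * (1 + \<bar>x i\<bar>) powr (- (1 + 1 / real n))) \<le> sqrt s ^ (n + 1)"
    by (simp add: prod_inversef[symmetric] comp_def)
  moreover have pos: "0 < (\<Prod>i<n. 2 * (1 + \<bar>x i\<bar>) powr (- (1 + 1 / real n)))"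
    by (intro prod_pos) (auto simp: add_pos_nonneg)
  ultimately have "inverse (sqrt s ^ (n + 1)) \<le> inverse (inverse (\<Prod>i<n. 2 * (1 + \<bar>x i\<bar>) powr (- (1 + 1 / real n))))"
    by (intro le_imp_inverse_le) auto
  then show ?thesis by (simp add: s_def divide_inverse)
qed

text \<open>The bound is uniform in the mesh \<open>e\<close> and in the size of the grid, as
  passing to the limit requires; it is of order \<open>exp (n * ln n + C * n)\<close>.\<close>

lemma riemann_sum_grid:
  assumes n: "n \<ge> 1" and e: "0 < e" "e \<le> 1"
  shows "(\<Sum>v\<in>{..<n} \<rightarrow>\<^sub>E {- int K..int K}. e ^ n / sqrt (1 + (\<Sum>i<n. (e * real_of_int (v i))\<^sup>2)) ^ (n + 1))
    \<le> (6 * real n) ^ n"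
proof -
  let ?G = "{..<n} \<rightarrow>\<^sub>E {- int K..int K}"
  let ?h = "\<lambda>v. 2 * (e * (1 + e * \<bar>real_of_int v\<bar>) powr (- (1 + 1 / real n)))"
  have "(\<Sum>v\<in>?G. e ^ n / sqrt (1 + (\<Sum>i<n. (e * real_of_int (v i))\<^sup>2)) ^ (n + 1)) \<le> (\<Sum>v\<in>?G. \<Prod>i<n. ?h (v i))"
  proof (rule sum_mono)
    fix v :: "nat \<Rightarrow> int"
    have "e ^ n * (1 / sqrt (1 + (\<Sum>i<n. (e * real_of_int (v i))\<^sup>2)) ^ (n + 1))
        \<le> e ^ n * (\<Prod>i<n. 2 * (1 + \<bar>e * real_of_int (v i)\<bar>) powr (- (1 + 1 / real n)))"
      using e by (intro mult_left_mono cell_weight_le[OF n]) auto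
    also have "\<dots> = (\<Prod>i<n. e * (2 * (1 + \<bar>e * real_of_int (v i)\<bar>) powr (- (1 + 1 / real n))))"
      by (simp add: prod.distrib)
    also have "\<dots> = (\<Prod>i<n. ?h (v i))"
      using e by (intro prod.cong) (auto simp: abs_mult)
    finally show "e ^ n / sqrt (1 + (\<Sum>i<n. (e * real_of_int (v i))\<^sup>2)) ^ (n + 1) \<le> (\<Prod>i<n. ?h (v i))" by simp
  qed
  also have "\<dots> = (\<Prod>i<n. \<Sum>v\<in>{- int K..int K}. ?h v)"
    by (rule prod_sum_PiE[symmetric]) auto
  also have "\<dots> \<le> (\<Prod>i<n. 6 * real n)"
  proof (rule prod_mono)
    fix i assume "i \<in> {..<n}"
    have "(\<Sum>v\<in>{- int K..int K}. ?h v) = 2 * (\<Sum>v\<in>{- int K..int K}. e * (1 + e * \<bar>real_of_int v\<bar>) powr (- (1 + 1 / real n)))"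
      by (rule sum_distrib_left[symmetric])
    also have "\<dots> \<le> 2 * (3 * real n)" by (intro mult_left_mono riemann_sum_line[OF n e]) simp
    finally show "0 \<le> (\<Sum>v\<in>{- int K..int K}. ?h v) \<and> (\<Sum>v\<in>{- int K..int K}. ?h v) \<le> 6 * real n"
      using e by (auto intro!: sum_nonneg)
  qed
  finally show ?thesis by simp
qed

section \<open>The expected number of minima\<close>

text \<open>Finite subsets also settle the infinite case: sets of every finite size then force
  \<open>L\<close> to be infinite.\<close>

lemma emeasure_count_space_leI:
  assumes "\<And>F. finite F \<Longrightarrow> F \<subseteq> S \<Longrightarrow> of_nat (card F) \<le> (L :: ennreal)"
  shows "emeasure (count_space UNIV) S \<le> L"
proof (cases "finite S")
  case True
  then show ?thesis using assms[of S] by (simp add: emeasure_count_space_finite)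
next
  case False
  have "L = top"
  proof (rule ccontr)
    assume "L \<noteq> top"
    then have "L < top" by (simp add: less_top)
    then obtain m where "L < of_nat m" using ennreal_Ex_less_of_nat by blast
    moreover obtain F where "finite F" "card F = m" "F \<subseteq> S"
      using infinite_arbitrarily_large[OF False] by blast
    ultimately show False using assms[of F] by auto
  qed
  then show ?thesis by simp
qed

lemma local_minima_outside: "x \<in> local_minima n f \<Longrightarrow> i \<ge> n \<Longrightarrow> x i = 0"
  using openin_subset[of "Euclidean_space n"] by (force simp: local_minima_def topspace_Euclidean_space)

text \<open>Every finite set of local minima is eventually separated by the cells of a fine grid, so that
  Fatou's lemma bounds the expected number of minima by sums over the cells.\<close>

lemma expected_minima_le:
  assumes n: "n \<ge> 1" and d: "d \<ge> 2"
  shows "expected_minima d n \<le> ennreal (crit_const n * (2 * real n * sqrt (real d - 1)) ^ n * (6 * real n) ^ n)"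
proof -
  define \<gamma> where "\<gamma> = std_gauss (hom_words n d)"
  define C where "C = real (card (hom_words n d))"
  \<comment> \<open>\<open>H k\<close> adds up every lower bound that \<open>cell_event\<close>
    imposes on \<open>1 / e\<close> at truncation level \<open>k\<close>, with \<open>r\<close>
    replaced by its bound \<open>n * (k + 1)\<close>. The summand \<open>Suc k\<close> makes the
    mesh tend to 0.\<close>
  define H where "H k = 2 ^ d * (C * (C * real k)) * (2 * real n) * (2 + real d * (real n * (real k + 1) + 1) * (3 * real n + 2))
    + 4 * real n * sqrt (real d - 1) + real n + real (Suc k)" for k :: nat
  define q where "q k = nat \<lceil>H k\<rceil>" for k
  define e where "e k = 1 / real (q k)" for k
  \<comment> \<open>Cells for the cube \<open>\<bar>x i\<bar> \<le> k\<close>; the bound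
    \<open>k + 1\<close> leaves a margin of one unit for rounding down.\<close>
  define G where "G k = ({..<n} \<rightarrow>\<^sub>E {- int (q k * (k + 1))..int (q k * (k + 1))})" for k
  define c where "c = crit_const n * (2 * real n * sqrt (real d - 1)) ^ n"
  define wt where "wt k v = e k ^ n / sqrt (1 + (\<Sum>i<n. (e k * real_of_int (v i))\<^sup>2)) ^ (n + 1)" for k and v :: "nat \<Rightarrow> int"
  define LM where "LM T = local_minima n (poly_fun n d (word_coeff n d T))" for T
  have C0: "C \<ge> 0" by (simp add: C_def)
  have "crit_const n \<ge> 0" by (simp add: crit_const_def)
  then have c0: "c \<ge> 0" using d by (simp add: c_def)
  have parts: "0 \<le> 2 ^ d * (C * (C * real k)) * (2 * real n) * (2 + real d * (real n * (real k + 1) + 1) * (3 * real n + 2))"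
    "0 \<le> 4 * real n * sqrt (real d - 1)" for k
    using C0 d by auto
  have Hk: "real (Suc k) \<le> H k" for k using parts(1)[of k] parts(2) by (simp add: H_def)
  have Hq: "H k \<le> real (q k)" for k
    unfolding q_def by (simp add: real_nat_ceiling_ge)
  have q1: "q k \<ge> 1" for k using Hk[of k] Hq[of k] by linarith
  have e0: "e k > 0" "e k \<le> 1" for k using q1[of k] by (auto simp: e_def)
  have eH: "a * e k \<le> 1" if "a \<le> H k" for a k
  proof -
    have "a \<le> real (q k)" using that Hq[of k] by linarith
    then show ?thesis using q1[of k] by (simp add: e_def divide_le_eq)
  qed
  have e_lim: "e \<longlonglongrightarrow> 0"
  proof (rule tendsto_sandwich[OF _ _ tendsto_const LIMSEQ_inverse_real_of_nat])
    show "\<forall>\<^sub>F k in sequentially. 0 \<le> e k" using e0(1) by (simp add: less_imp_le)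
    have "e k \<le> inverse (real (Suc k))" for k
      using eH[OF Hk[of k]] by (simp add: field_simps)
    then show "\<forall>\<^sub>F k in sequentially. e k \<le> inverse (real (Suc k))" by simp
  qed
  have finite_G: "finite (G k)" for k unfolding G_def by (intro finite_PiE) auto
  define covers where "covers k v E \<longleftrightarrow> E \<in> sets \<gamma> \<and> emeasure \<gamma> E \<le> ennreal (c * wt k v) \<and>
    (\<forall>T\<in>space \<gamma>. (\<Sum>w\<in>hom_words n d. \<bar>T w\<bar>) \<le> real k \<longrightarrow>
      (\<exists>x\<in>LM T. \<forall>i<n. \<bar>x i - e k * real_of_int (v i)\<bar> \<le> e k) \<longrightarrow> T \<in> E)" for k v E
  have cell: "\<exists>E. v \<in> G k \<longrightarrow> covers k v E" for k v
  proof (cases "v \<in> G k")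
    case True
    define x0 where "x0 i = e k * real_of_int (v i)" for i
    define r where "r = sqrt (\<Sum>i<n. (x0 i)\<^sup>2)"
    have r2: "r\<^sup>2 = (\<Sum>i<n. (x0 i)\<^sup>2)" by (simp add: r_def sum_nonneg)
    have r_le: "r \<le> real n * (real k + 1)"
    proof -
      have "r \<le> (\<Sum>i<n. \<bar>x0 i\<bar>)" using L2_set_le_sum_abs[of x0 "{..<n}"] by (simp add: r_def L2_set_def)
      also have "\<dots> \<le> (\<Sum>i<n. real k + 1)"
      proof (rule sum_mono)
        fix i assume "i \<in> {..<n}"
        then have "v i \<in> {- int (q k * (k + 1))..int (q k * (k + 1))}" using True by (auto simp: G_def PiE_iff)
        then have "\<bar>v i\<bar> \<le> int (q k * (k + 1))" by auto
        then have "real_of_int \<bar>v i\<bar> \<le> real_of_int (int (q k * (k + 1)))" by (simp only: of_int_le_iff)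
        then have "\<bar>real_of_int (v i)\<bar> \<le> real (q k) * (real k + 1)" by (simp add: algebra_simps)
        then have "e k * \<bar>real_of_int (v i)\<bar> \<le> e k * (real (q k) * (real k + 1))"
          using e0[of k] by (intro mult_left_mono) auto
        also have "\<dots> = real k + 1" using q1[of k] by (simp add: e_def)
        finally show "\<bar>x0 i\<bar> \<le> real k + 1" using e0[of k] by (simp add: x0_def abs_mult)
      qed
      finally show ?thesis by simp
    qed
    have "real n * e k \<le> 1" by (rule eH) (use parts(1)[of k] parts(2) in \<open>simp add: H_def\<close>)
    moreover have "4 * real n * e k * sqrt (real d - 1) \<le> 1"
    proof -
      have "(4 * real n * sqrt (real d - 1)) * e k \<le> 1" by (rule eH) (use parts(1)[of k] parts(2) in \<open>simp add: H_def\<close>)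
      then show ?thesis by (simp add: mult_ac)
    qed
    moreover have "2 ^ d * (C * (C * real k)) * (2 * real n * e k) * (2 + real d * (r + 1) * (3 * real n + 2)) \<le> 1"
    proof -
      define P where "P = 2 ^ d * (C * (C * real k)) * (2 * real n)"
      have P: "P \<ge> 0" using C0 by (simp add: P_def)
      have "P * (2 + real d * (r + 1) * (3 * real n + 2)) \<le> P * (2 + real d * (real n * (real k + 1) + 1) * (3 * real n + 2))"
        using P r_le by (intro mult_left_mono add_left_mono mult_right_mono) auto
      also have "\<dots> \<le> H k" using parts(2) by (simp add: H_def P_def)
      finally have "P * (2 + real d * (r + 1) * (3 * real n + 2)) * e k \<le> 1" by (rule eH)
      then show ?thesis by (simp add: P_def mult_ac)
    qed
    ultimately have "\<exists>E\<in>sets \<gamma>. emeasure \<gamma> E \<le> ennreal (crit_const n * (2 * real n * sqrt (real d - 1)) ^ n * (e k ^ n / sqrt (1 + r\<^sup>2) ^ (n + 1))) \<and>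
      (\<forall>T\<in>space \<gamma>. (\<Sum>w\<in>hom_words n d. \<bar>T w\<bar>) \<le> real k \<longrightarrow>
        (\<exists>x\<in>local_minima n (poly_fun n d (word_coeff n d T)). \<forall>i<n. \<bar>x i - x0 i\<bar> \<le> e k) \<longrightarrow> T \<in> E)"
      unfolding \<gamma>_def using e0[of k] by (intro cell_event[OF n d _ _ _ _ C_def r_def]) auto
    then show ?thesis
      unfolding covers_def r2 c_def wt_def LM_def x0_def by blast
  qed auto
  obtain E where E: "\<And>k v. v \<in> G k \<Longrightarrow> E k v \<in> sets \<gamma>"
    "\<And>k v. v \<in> G k \<Longrightarrow> emeasure \<gamma> (E k v) \<le> ennreal (c * wt k v)"
    "\<And>k v T x. v \<in> G k \<Longrightarrow> T \<in> space \<gamma> \<Longrightarrow> (\<Sum>w\<in>hom_words n d. \<bar>T w\<bar>) \<le> real k \<Longrightarrow> x \<in> LM T \<Longrightarrow>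
      \<forall>i<n. \<bar>x i - e k * real_of_int (v i)\<bar> \<le> e k \<Longrightarrow> T \<in> E k v"
  proof -
    have "\<forall>k v. \<exists>E. v \<in> G k \<longrightarrow> covers k v E" using cell by blast
    then obtain E where "\<forall>k v. v \<in> G k \<longrightarrow> covers k v (E k v)"
      unfolding choice_iff by blast
    then show thesis unfolding covers_def by (intro that[of E]) blast+
  qed
  \<comment> \<open>The number of cells whose event occurs.\<close>
  define X where "X k T = (\<Sum>v\<in>G k. indicator (E k v) T :: ennreal)" for k T
  have X_meas: "X k \<in> borel_measurable \<gamma>" for k
    unfolding X_def[abs_def] using E(1) by (intro borel_measurable_sum borel_measurable_indicator) auto
  have count: "emeasure (count_space UNIV) (LM T) \<le> liminf (\<lambda>k. X k T)" if T: "T \<in> space \<gamma>" for T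
  proof (rule emeasure_count_space_leI)
    fix F assume F: "finite F" "F \<subseteq> LM T"
    have large: "\<forall>\<^sub>F k in sequentially. a \<le> real k" for a
      using filterlim_real_sequentially unfolding filterlim_at_top by blast
    have sep: "\<forall>\<^sub>F k in sequentially. \<exists>i<n. e k < \<bar>x i - y i\<bar>" if xy: "x \<in> F" "y \<in> F" "x \<noteq> y" for x y
    proof -
      obtain i where i: "x i \<noteq> y i" using xy(3) by blast
      then have "i < n"
        using local_minima_outside[of x n _ i] local_minima_outside[of y n _ i] xy F(2) by (force simp: LM_def not_less)
      moreover have "\<forall>\<^sub>F k in sequentially. e k < \<bar>x i - y i\<bar>"
        using e_lim i by (intro order_tendstoD(2)) auto
      ultimately show ?thesis by (auto elim: eventually_mono)
    qed
    \<comment> \<open>For large \<open>k\<close> the truncation admits \<open>T\<close>, the cube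
      contains \<open>F\<close>, and any two points of \<open>F\<close> differ by more than the mesh
      in some coordinate.\<close>
    have "\<forall>\<^sub>F k in sequentially. (\<Sum>w\<in>hom_words n d. \<bar>T w\<bar>) \<le> real k \<and> (\<forall>x\<in>F. \<forall>i\<in>{..<n}. \<bar>x i\<bar> \<le> real k)
      \<and> (\<forall>x\<in>F. \<forall>y\<in>F. x \<noteq> y \<longrightarrow> (\<exists>i<n. e k < \<bar>x i - y i\<bar>))"
      using F(1) large sep by (intro eventually_conj eventually_ball_finite ballI) (auto intro!: eventually_mono[OF sep])
    then have "\<forall>\<^sub>F k in sequentially. of_nat (card F) \<le> X k T"
    proof eventually_elim
      case (elim k)
      \<comment> \<open>The cell of a point, by rounding down. Two points in one cell differ by less
        than \<open>e k\<close> in each coordinate, so \<open>\<phi>\<close> is injective on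
        \<open>F\<close>.\<close>
      define \<phi> where "\<phi> x = (\<lambda>i\<in>{..<n}. \<lfloor>x i * real (q k)\<rfloor>)" for x :: "nat \<Rightarrow> real"
      have fl: "e k * real_of_int \<lfloor>a * real (q k)\<rfloor> \<le> a" "a < e k * real_of_int \<lfloor>a * real (q k)\<rfloor> + e k" for a
      proof -
        have "real_of_int \<lfloor>a * real (q k)\<rfloor> \<le> a * real (q k)" "a * real (q k) < real_of_int \<lfloor>a * real (q k)\<rfloor> + 1"
          by linarith+
        then show "e k * real_of_int \<lfloor>a * real (q k)\<rfloor> \<le> a" "a < e k * real_of_int \<lfloor>a * real (q k)\<rfloor> + e k"
          using q1[of k] by (auto simp: e_def field_simps)
      qed
      have \<phi>_G: "\<phi> x \<in> G k" if "x \<in> F" for x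
        unfolding G_def \<phi>_def
      proof (rule restrict_PiE_iff[THEN iffD2], intro ballI)
        fix i assume "i \<in> {..<n}"
        then have x: "\<bar>x i\<bar> \<le> real k" using elim that by blast
        have "\<bar>x i * real (q k)\<bar> \<le> real k * real (q k)"
          unfolding abs_mult using x by (intro mult_mono) auto
        moreover have "real (q k) \<ge> 1" using q1[of k] by simp
        moreover have "real (q k * (k + 1)) = real k * real (q k) + real (q k)" by (simp add: algebra_simps)
        ultimately have "- real (q k * (k + 1)) \<le> x i * real (q k)" "x i * real (q k) \<le> real (q k * (k + 1))"
          by linarith+
        then show "\<lfloor>x i * real (q k)\<rfloor> \<in> {- int (q k * (k + 1))..int (q k * (k + 1))}"
          by (simp only: atLeastAtMost_iff le_floor_iff floor_le_iff of_int_minus of_int_of_nat_eq) simp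
      qed
      have inj: "inj_on \<phi> F"
      proof (rule inj_onI, rule ccontr)
        fix x y assume xy: "x \<in> F" "y \<in> F" "\<phi> x = \<phi> y" "x \<noteq> y"
        then obtain i where i: "i < n" "e k < \<bar>x i - y i\<bar>" using elim by blast
        have "\<lfloor>x i * real (q k)\<rfloor> = \<lfloor>y i * real (q k)\<rfloor>"
          using fun_cong[OF xy(3), of i] i by (simp add: \<phi>_def)
        then show False using fl[of "x i"] fl[of "y i"] i(2) by simp
      qed
      have mem: "T \<in> E k (\<phi> x)" if x: "x \<in> F" for x
      proof (rule E(3)[OF \<phi>_G[OF x] T])
        show "(\<Sum>w\<in>hom_words n d. \<bar>T w\<bar>) \<le> real k" using elim by blast
        show "x \<in> LM T" using x F by blast
        show "\<forall>i<n. \<bar>x i - e k * real_of_int (\<phi> x i)\<bar> \<le> e k"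
        proof (intro allI impI)
          fix i assume "i < n"
          then show "\<bar>x i - e k * real_of_int (\<phi> x i)\<bar> \<le> e k"
            using fl[of "x i"] by (simp add: \<phi>_def)
        qed
      qed
      have "of_nat (card F) = (\<Sum>v\<in>\<phi> ` F. 1 :: ennreal)"
        using card_image[OF inj] by simp
      also have "\<dots> = (\<Sum>v\<in>\<phi> ` F. indicator (E k v) T)"
        using mem by (intro sum.cong) auto
      also have "\<dots> \<le> X k T"
        unfolding X_def using \<phi>_G finite_G by (intro sum_mono2) auto
      finally show ?case .
    qed
    then show "of_nat (card F) \<le> liminf (\<lambda>k. X k T)" by (rule Liminf_bounded)
  qed
  have int_X: "(\<integral>\<^sup>+T. X k T \<partial>\<gamma>) \<le> ennreal (c * (6 * real n) ^ n)" for k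
  proof -
    have "(\<integral>\<^sup>+T. X k T \<partial>\<gamma>) = (\<Sum>v\<in>G k. \<integral>\<^sup>+T. indicator (E k v) T \<partial>\<gamma>)"
      unfolding X_def using E(1) by (intro nn_integral_sum borel_measurable_indicator) auto
    also have "\<dots> = (\<Sum>v\<in>G k. emeasure \<gamma> (E k v))"
      using E(1) by (intro sum.cong refl nn_integral_indicator)
    also have "\<dots> \<le> (\<Sum>v\<in>G k. ennreal (c * wt k v))"
      using E(2) by (rule sum_mono)
    also have "\<dots> = ennreal (\<Sum>v\<in>G k. c * wt k v)"
      using c0 e0[of k] by (intro sum_ennreal mult_nonneg_nonneg) (auto simp: wt_def sum_nonneg)
    also have "\<dots> \<le> ennreal (c * (6 * real n) ^ n)"
      unfolding sum_distrib_left[symmetric] G_def wt_def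
      using c0 e0[of k] by (intro ennreal_leI mult_left_mono riemann_sum_grid[OF n]) auto
    finally show ?thesis .
  qed
  have "expected_minima d n = (\<integral>\<^sup>+a. emeasure (count_space UNIV) (local_minima n (poly_fun n d a)) \<partial>distr \<gamma> (coeff_measure n d) (word_coeff n d))"
    unfolding expected_minima_def \<gamma>_def distr_word_coeff ..
  also have "\<dots> \<le> (\<integral>\<^sup>+T. emeasure (count_space UNIV) (LM T) \<partial>\<gamma>)"
    unfolding LM_def \<gamma>_def by (rule nn_integral_distr_le[OF word_coeff_measurable])
  also have "\<dots> \<le> (\<integral>\<^sup>+T. liminf (\<lambda>k. X k T) \<partial>\<gamma>)"
    by (intro nn_integral_mono count)
  also have "\<dots> \<le> liminf (\<lambda>k. \<integral>\<^sup>+T. X k T \<partial>\<gamma>)"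
    by (rule nn_integral_liminf[OF X_meas])
  also have "\<dots> \<le> ennreal (c * (6 * real n) ^ n)"
    by (intro Liminf_le always_eventually allI int_X) simp
  finally show ?thesis by (simp add: c_def)
qed

text \<open>Under the square root the exponent 1/12 becomes 1/24, which exceeds 1/100; the other
  contributions to the logarithm are at most of order \<open>n * sqrt n\<close>.\<close>

lemma crit_const_decay:
  "\<exists>K>0. \<forall>n\<ge>1. crit_const n * (2 * real n) ^ n * (6 * real n) ^ n \<le> K * exp (- (1 / 100) * (real n)\<^sup>2)"
proof -
  \<comment> \<open>The logarithm of the left-hand side divided by
    \<open>exp (- (1 / 100) * x\<^sup>2)\<close>. As it tends to minus infinity, its exponential is
    bounded along the integers, and this bound is \<open>K\<close>.\<close>
  define L where "L x = ln 15 + x * ln 2 + ((2 * x + 1) * ln (4 * x\<^sup>2) + 2 * x * ln (2 * x)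
    + (- (x - 1)\<^sup>2 / 12 + 3 * (x - 1) / 2 + (x - 1) * sqrt x)) / 2 + x * ln (2 * x) + x * ln (6 * x) + x\<^sup>2 / 100"
    for x :: real
  have "filterlim L at_bot at_top"
    unfolding L_def by real_asymp
  then have "((\<lambda>x. exp (L x)) \<longlongrightarrow> 0) at_top"
    by (rule filterlim_compose[OF exp_at_bot])
  then have "(\<lambda>n. exp (L (real n))) \<longlonglongrightarrow> 0"
    by (rule filterlim_compose[OF _ filterlim_real_sequentially])
  then have "Bseq (\<lambda>n. exp (L (real n)))"
    by (intro convergent_imp_Bseq convergentI)
  then obtain K where K: "K > 0" "\<And>n. norm (exp (L (real n))) \<le> K"
    by (auto elim: BseqE)
  have pow: "x ^ k = exp (real k * ln x)" if "x > 0" for x :: real and k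
    using that by (simp add: exp_of_nat_mult)
  have sqrt_exp: "sqrt (exp y) = exp (y / 2)" for y :: real
    by (rule real_sqrt_unique) (simp_all add: power2_eq_square flip: exp_add)
  have "crit_const n * (2 * real n) ^ n * (6 * real n) ^ n \<le> K * exp (- (1 / 100) * (real n)\<^sup>2)" if n: "n \<ge> 1" for n
  proof -
    define x where "x = real n"
    have x: "x \<ge> 1" "real (n - 1) = x - 1" "1 + (x - 1) = x" using n by (simp_all add: x_def of_nat_diff)
    have 1: "(4 * x\<^sup>2) ^ (2 * n + 1) = exp ((2 * x + 1) * ln (4 * x\<^sup>2))"
      using x by (subst pow) (auto simp: x_def algebra_simps)
    have 2: "(2 * x) ^ (2 * n) = exp (2 * x * ln (2 * x))"
      using x by (subst pow) (auto simp: x_def)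
    have 3: "(2 * x) ^ n = exp (x * ln (2 * x))" "(6 * x) ^ n = exp (x * ln (6 * x))" "2 ^ n = exp (x * ln 2)"
      using x by (subst pow; simp add: x_def)+
    have sqrt_prod: "sqrt (exp a * exp b * exp c) = exp ((a + b + c) / 2)" for a b c :: real
      by (simp add: sqrt_exp flip: exp_add)
    have "crit_const n * (2 * x) ^ n * (6 * x) ^ n
        = exp (ln 15) * exp (x * ln 2) * exp (((2 * x + 1) * ln (4 * x\<^sup>2) + 2 * x * ln (2 * x)
          + (- (x - 1)\<^sup>2 / 12 + 3 * (x - 1) / 2 + (x - 1) * sqrt x)) / 2) * exp (x * ln (2 * x)) * exp (x * ln (6 * x))"
      unfolding crit_const_def x_def[symmetric] x(2,3) 1 2 3 sqrt_prod by simp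
    also have "\<dots> = exp (L x) * exp (- (1 / 100) * x\<^sup>2)"
      unfolding exp_add[symmetric] by (simp add: L_def)
    also have "\<dots> \<le> K * exp (- (1 / 100) * x\<^sup>2)"
      using K(2)[of n] by (intro mult_right_mono) (auto simp: x_def)
    finally show ?thesis by (simp add: x_def)
  qed
  then show ?thesis using K(1) by blast
qed

theorem theorem2:
  shows "\<exists>\<beta> K :: real. \<beta> > 0 \<and> K > 0 \<and>
    (\<forall>n d :: nat. n \<ge> 1 \<longrightarrow> d \<ge> 2 \<longrightarrow>
      expected_minima d n \<le>
        ennreal (K * exp (- \<beta> * (real n)\<^sup>2 + real n / 2 * ln (real d - 1))))"
proof -
  obtain K where K: "K > 0"
    "\<And>n. n \<ge> 1 \<Longrightarrow> crit_const n * (2 * real n) ^ n * (6 * real n) ^ n \<le> K * exp (- (1 / 100) * (real n)\<^sup>2)"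
    using crit_const_decay by blast
  have "expected_minima d n \<le> ennreal (K * exp (- (1 / 100) * (real n)\<^sup>2 + real n / 2 * ln (real d - 1)))"
    if n: "n \<ge> 1" and d: "d \<ge> 2" for n d :: nat
  proof -
    have d1: "real d - 1 > 0" using d by simp
    have "sqrt (real d - 1) = exp (ln (real d - 1) / 2)"
      using d1 by (simp add: ln_sqrt[symmetric])
    then have sq: "sqrt (real d - 1) ^ n = exp (real n / 2 * ln (real d - 1))"
      by (simp flip: exp_of_nat_mult)
    have "expected_minima d n \<le> ennreal (crit_const n * (2 * real n * sqrt (real d - 1)) ^ n * (6 * real n) ^ n)"
      by (rule expected_minima_le[OF n d])
    also have "crit_const n * (2 * real n * sqrt (real d - 1)) ^ n * (6 * real n) ^ n
        = (crit_const n * (2 * real n) ^ n * (6 * real n) ^ n) * sqrt (real d - 1) ^ n"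
      by (simp add: power_mult_distrib)
    also have "ennreal \<dots> \<le> ennreal ((K * exp (- (1 / 100) * (real n)\<^sup>2)) * sqrt (real d - 1) ^ n)"
      using d1 by (intro ennreal_leI mult_right_mono K(2)[OF n]) auto
    also have "(K * exp (- (1 / 100) * (real n)\<^sup>2)) * sqrt (real d - 1) ^ n
        = K * exp (- (1 / 100) * (real n)\<^sup>2 + real n / 2 * ln (real d - 1))"
      unfolding sq by (simp only: exp_add mult.assoc)
    finally show ?thesis .
  qed
  then show ?thesis
    using K(1) by (intro exI[of _ "1 / 100"] exI[of _ K]) auto
qed

end
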